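(* Let $l\ge1$ and let $\Lambda$ be the $\mathbb{Z}_2^l$-graph $\prod_{i=1}^lZ_2$ (the group $\mathbb{Z}_2^l$ regarded as a one-object category with degree map the identity). Then $C^*(\Lambda,c_\Lambda)\cong\mathbb{C}\mathrm{liff}_l$, the $l$-th complex Clifford algebra. This isomorphism is a graded isomorphism with respect to the grading $\alpha_{\delta_\Lambda}$ of $C^*(\Lambda,c_\Lambda)$ induced by $\delta_\Lambda$.
   Context: $c_\Lambda:\mathbb{Z}_2^l\times\mathbb{Z}_2^l\to\{\pm1\}$ is the $2$-cocycle $c_\Lambda(m,n)=(-1)^{\kappa(m,n)}$ with $\kappa(m,n)=\sum_{1\le j<i\le l}m_i\cdot n_j$. $C^*(\Lambda,c_\Lambda)$ is the universal $C^*$-algebra generated by elements $s_m$, $m\in\mathbb{Z}_2^l$, such that $s_0$ is a projection, $s_ms_n=c_\Lambda(m,n)s_{m+n}$, $s_m^*s_m=s_0$ and $s_ms_m^*=s_0$ for all $m,n$ (the Cuntz–Krieger relations for $\Lambda$ twisted by $c_\Lambda$). The functor $\delta_\Lambda:\mathbb{Z}_2^l\to\mathbb{Z}_2$ is $\delta_\Lambda(m)=\sum_im_i$, and $\alpha_{\delta_\Lambda}$ is the grading automorphism with $\alpha_{\delta_\Lambda}(s_m)=(-1)^{\delta_\Lambda(m)}s_m$. A grading of a $C^*$-algebra is an automorphism $\alpha$ with $\alpha^2=1$, and $a$ has degree $\partial a=j$ if $\alpha(a)=(-1)^ja$. The graded tensor product has, for homogeneous elements, $(a\widehat\otimes b)(a'\widehat\otimes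 b')=(-1)^{\partial b\cdot\partial a'}aa'\widehat\otimes bb'$, $(a\widehat\otimes b)^*=(-1)^{\partial a\cdot\partial b}a^*\widehat\otimes b^*$, and grading $\alpha\widehat\otimes\beta$. $\mathbb{C}\mathrm{liff}_1$ is $\mathbb{C}\oplus\mathbb{C}$ with grading $(z,w)\mapsto(w,z)$, and $\mathbb{C}\mathrm{liff}_{n+1}=\mathbb{C}\mathrm{liff}_n\widehat\otimes\mathbb{C}\mathrm{liff}_1$. *)

theory Defs
  imports Complex_Main "HOL-Library.Z2"
begin

section \<open>Graded C*-algebras\<close>

text \<open>Algebras are complex and need not be unital; all operations matter only on the carrier.\<close>

record 'a star_alg =
  car :: "'a set"
  azero :: 'a
  aadd :: "'a \<Rightarrow> 'a \<Rightarrow> 'a"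
  ascale :: "complex \<Rightarrow> 'a \<Rightarrow> 'a"
  amult :: "'a \<Rightarrow> 'a \<Rightarrow> 'a"
  astar :: "'a \<Rightarrow> 'a"

record 'a cstar_alg = "'a star_alg" +
  anorm :: "'a \<Rightarrow> real"

record 'a graded_cstar_alg = "'a cstar_alg" +
  grade :: "'a \<Rightarrow> 'a"

definition adiff :: "('a, 'x) star_alg_scheme \<Rightarrow> 'a \<Rightarrow> 'a \<Rightarrow> 'a" where
  "adiff A x y = aadd A x (ascale A (- 1) y)"

locale star_algebra =
  fixes A :: "('a, 'x) star_alg_scheme"
  assumes zero_closed: "azero A \<in> car A"
    and add_closed: "\<lbrakk>x \<in> car A; y \<in> car A\<rbrakk> \<Longrightarrow> aadd A x y \<in> car A"
    and scale_closed: "x \<in> car A \<Longrightarrow> ascale A c x \<in> car A"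
    and mult_closed: "\<lbrakk>x \<in> car A; y \<in> car A\<rbrakk> \<Longrightarrow> amult A x y \<in> car A"
    and star_closed: "x \<in> car A \<Longrightarrow> astar A x \<in> car A"
    and add_assoc: "\<lbrakk>x \<in> car A; y \<in> car A; z \<in> car A\<rbrakk>
          \<Longrightarrow> aadd A (aadd A x y) z = aadd A x (aadd A y z)"
    and add_commute: "\<lbrakk>x \<in> car A; y \<in> car A\<rbrakk> \<Longrightarrow> aadd A x y = aadd A y x"
    and add_zero: "x \<in> car A \<Longrightarrow> aadd A (azero A) x = x"
    and diff_self: "x \<in> car A \<Longrightarrow> adiff A x x = azero A"
    and scale_add_right: "\<lbrakk>x \<in> car A; y \<in> car A\<rbrakk>
          \<Longrightarrow> ascale A c (aadd A x y) = aadd A (ascale A c x) (ascale A c y)"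
    and scale_add_left: "x \<in> car A
          \<Longrightarrow> ascale A (c + d) x = aadd A (ascale A c x) (ascale A d x)"
    and scale_scale: "x \<in> car A \<Longrightarrow> ascale A c (ascale A d x) = ascale A (c * d) x"
    and scale_one: "x \<in> car A \<Longrightarrow> ascale A 1 x = x"
    and mult_assoc: "\<lbrakk>x \<in> car A; y \<in> car A; z \<in> car A\<rbrakk>
          \<Longrightarrow> amult A (amult A x y) z = amult A x (amult A y z)"
    and mult_add_left: "\<lbrakk>x \<in> car A; y \<in> car A; z \<in> car A\<rbrakk>
          \<Longrightarrow> amult A (aadd A x y) z = aadd A (amult A x z) (amult A y z)"
    and mult_add_right: "\<lbrakk>x \<in> car A; y \<in> car A; z \<in> car A\<rbrakk>
          \<Longrightarrow> amult A z (aadd A x y) = aadd A (amult A z x) (amult A z y)"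
    and mult_scale_left: "\<lbrakk>x \<in> car A; y \<in> car A\<rbrakk>
          \<Longrightarrow> amult A (ascale A c x) y = ascale A c (amult A x y)"
    and mult_scale_right: "\<lbrakk>x \<in> car A; y \<in> car A\<rbrakk>
          \<Longrightarrow> amult A x (ascale A c y) = ascale A c (amult A x y)"
    and star_star: "x \<in> car A \<Longrightarrow> astar A (astar A x) = x"
    and star_add: "\<lbrakk>x \<in> car A; y \<in> car A\<rbrakk>
          \<Longrightarrow> astar A (aadd A x y) = aadd A (astar A x) (astar A y)"
    and star_scale: "x \<in> car A \<Longrightarrow> astar A (ascale A c x) = ascale A (cnj c) (astar A x)"
    and star_mult: "\<lbrakk>x \<in> car A; y \<in> car A\<rbrakk>
          \<Longrightarrow> astar A (amult A x y) = amult A (astar A y) (astar A x)"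

definition cstar_seminorm :: "('a, 'x) star_alg_scheme \<Rightarrow> ('a \<Rightarrow> real) \<Rightarrow> bool" where
  "cstar_seminorm A p \<longleftrightarrow>
     (\<forall>x\<in>car A. 0 \<le> p x) \<and>
     (\<forall>x\<in>car A. \<forall>y\<in>car A. p (aadd A x y) \<le> p x + p y) \<and>
     (\<forall>c. \<forall>x\<in>car A. p (ascale A c x) = cmod c * p x) \<and>
     (\<forall>x\<in>car A. \<forall>y\<in>car A. p (amult A x y) \<le> p x * p y) \<and>
     (\<forall>x\<in>car A. p (astar A x) = p x) \<and>
     (\<forall>x\<in>car A. p (amult A (astar A x) x) = (p x)\<^sup>2)"

definition cauchy_seqs :: "('a, 'x) star_alg_scheme \<Rightarrow> ('a \<Rightarrow> real) \<Rightarrow> (nat \<Rightarrow> 'a) set" where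
  "cauchy_seqs A p = {X. (\<forall>n. X n \<in> car A) \<and>
     (\<forall>e>0. \<exists>N. \<forall>m\<ge>N. \<forall>n\<ge>N. p (adiff A (X m) (X n)) < e)}"

locale cstar_algebra = star_algebra A for A :: "('a, 'x) cstar_alg_scheme" +
  assumes norm_cstar: "cstar_seminorm A (anorm A)"
    and norm_definite: "\<lbrakk>x \<in> car A; anorm A x = 0\<rbrakk> \<Longrightarrow> x = azero A"
    and norm_complete: "X \<in> cauchy_seqs A (anorm A)
          \<Longrightarrow> \<exists>x\<in>car A. (\<lambda>n. anorm A (adiff A (X n) x)) \<longlonglongrightarrow> 0"

definition star_hom :: "('a \<Rightarrow> 'b) \<Rightarrow> ('a, 'x) star_alg_scheme \<Rightarrow> ('b, 'y) star_alg_scheme \<Rightarrow> bool"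
  where "star_hom f A B \<longleftrightarrow>
     (\<forall>x\<in>car A. f x \<in> car B) \<and>
     (\<forall>x\<in>car A. \<forall>y\<in>car A. f (aadd A x y) = aadd B (f x) (f y)) \<and>
     (\<forall>c. \<forall>x\<in>car A. f (ascale A c x) = ascale B c (f x)) \<and>
     (\<forall>x\<in>car A. \<forall>y\<in>car A. f (amult A x y) = amult B (f x) (f y)) \<and>
     (\<forall>x\<in>car A. f (astar A x) = astar B (f x))"

definition star_iso :: "('a \<Rightarrow> 'b) \<Rightarrow> ('a, 'x) star_alg_scheme \<Rightarrow> ('b, 'y) star_alg_scheme \<Rightarrow> bool"
  where "star_iso f A B \<longleftrightarrow> star_hom f A B \<and> bij_betw f (car A) (car B)"

locale graded_cstar_algebra = cstar_algebra A for A :: "('a, 'x) graded_cstar_alg_scheme" +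
  assumes grade_automorphism: "star_iso (grade A) A A"
    and grade_grade: "x \<in> car A \<Longrightarrow> grade A (grade A x) = x"

definition graded_iso ::
  "('a \<Rightarrow> 'b) \<Rightarrow> ('a, 'x) graded_cstar_alg_scheme \<Rightarrow> ('b, 'y) graded_cstar_alg_scheme \<Rightarrow> bool"
  where "graded_iso f A B \<longleftrightarrow>
     star_iso f A B \<and> (\<forall>x\<in>car A. f (grade A x) = grade B (f x))"


section \<open>Universal C*-algebras of generators and relations\<close>

definition max_cstar_seminorm :: "('a, 'x) star_alg_scheme \<Rightarrow> 'a set \<Rightarrow> 'a \<Rightarrow> real" where
  "max_cstar_seminorm A R x =
     (SUP p \<in> {p. cstar_seminorm A p \<and> (\<forall>r\<in>R. p r = 0)}. p x)"

text \<open>Separated completion of a *-algebra in a C*-seminorm: Cauchy sequences modulo null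
  sequences.\<close>

definition null_rel ::
  "('a, 'x) star_alg_scheme \<Rightarrow> ('a \<Rightarrow> real) \<Rightarrow> ((nat \<Rightarrow> 'a) \<times> (nat \<Rightarrow> 'a)) set" where
  "null_rel A p = {(X, Y). X \<in> cauchy_seqs A p \<and> Y \<in> cauchy_seqs A p \<and>
     (\<lambda>n. p (adiff A (X n) (Y n))) \<longlonglongrightarrow> 0}"

definition seq_class :: "('a, 'x) star_alg_scheme \<Rightarrow> ('a \<Rightarrow> real) \<Rightarrow> (nat \<Rightarrow> 'a) \<Rightarrow> (nat \<Rightarrow> 'a) set"
  where "seq_class A p X = null_rel A p `` {X}"

definition completion_map ::
  "('a, 'x) star_alg_scheme \<Rightarrow> ('a \<Rightarrow> real) \<Rightarrow> ('a \<Rightarrow> 'a) \<Rightarrow> (nat \<Rightarrow> 'a) set \<Rightarrow> (nat \<Rightarrow> 'a) set" where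
  "completion_map A p f S = (\<Union>X\<in>S. seq_class A p (\<lambda>n. f (X n)))"

definition completion_map2 ::
  "('a, 'x) star_alg_scheme \<Rightarrow> ('a \<Rightarrow> real) \<Rightarrow> ('a \<Rightarrow> 'a \<Rightarrow> 'a) \<Rightarrow>
   (nat \<Rightarrow> 'a) set \<Rightarrow> (nat \<Rightarrow> 'a) set \<Rightarrow> (nat \<Rightarrow> 'a) set" where
  "completion_map2 A p f S T = (\<Union>X\<in>S. \<Union>Y\<in>T. seq_class A p (\<lambda>n. f (X n) (Y n)))"

definition completion :: "'a star_alg \<Rightarrow> ('a \<Rightarrow> real) \<Rightarrow> (nat \<Rightarrow> 'a) set cstar_alg" where
  "completion A p =
     \<lparr>car = cauchy_seqs A p // null_rel A p,
      azero = seq_class A p (\<lambda>_. azero A),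
      aadd = completion_map2 A p (aadd A),
      ascale = (\<lambda>c. completion_map A p (ascale A c)),
      amult = completion_map2 A p (amult A),
      astar = completion_map A p (astar A),
      anorm = (\<lambda>S. lim (\<lambda>n. p ((SOME X. X \<in> S) n)))\<rparr>"

definition unit_at :: "'k \<Rightarrow> 'k \<Rightarrow> complex" where
  "unit_at k = (\<lambda>j. if j = k then 1 else 0)"

text \<open>The free non-unital *-algebra on \<open>G\<close>: finite linear combinations of non-empty words in
  the letters \<open>(g, False)\<close>, standing for \<open>g\<close>, and \<open>(g, True)\<close>, standing for the adjoint
  of \<open>g\<close>.\<close>

type_synonym 'g star_poly = "('g \<times> bool) list \<Rightarrow> complex"

definition free_star_alg :: "'g set \<Rightarrow> 'g star_poly star_alg" where
  "free_star_alg G =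
     \<lparr>car = {f. finite {w. f w \<noteq> 0} \<and> (\<forall>w. f w \<noteq> 0 \<longrightarrow> w \<noteq> [] \<and> fst ` set w \<subseteq> G)},
      azero = (\<lambda>_. 0),
      aadd = (\<lambda>f g w. f w + g w),
      ascale = (\<lambda>c f w. c * f w),
      amult = (\<lambda>f g w. \<Sum>k\<le>length w. f (take k w) * g (drop k w)),
      astar = (\<lambda>f w. cnj (f (rev (map (apsnd Not) w))))\<rparr>"

definition free_gen :: "'g \<Rightarrow> 'g star_poly" where
  "free_gen g = unit_at [(g, False)]"

definition universal_seminorm :: "'g set \<Rightarrow> 'g star_poly set \<Rightarrow> 'g star_poly \<Rightarrow> real" where
  "universal_seminorm G R = max_cstar_seminorm (free_star_alg G) R"

text \<open>The relations are \<open>r = 0\<close> for \<open>r\<close> in \<open>R\<close>.  As usual, the universal C*-algebra exists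
  only if \<open>R\<close> bounds the C*-seminorms of every generator; otherwise the supremum above
  is meaningless.\<close>

definition universal_cstar ::
  "'g set \<Rightarrow> 'g star_poly set \<Rightarrow> (nat \<Rightarrow> 'g star_poly) set cstar_alg" where
  "universal_cstar G R = completion (free_star_alg G) (universal_seminorm G R)"

definition universal_gen ::
  "'g set \<Rightarrow> 'g star_poly set \<Rightarrow> 'g \<Rightarrow> (nat \<Rightarrow> 'g star_poly) set" where
  "universal_gen G R g = seq_class (free_star_alg G) (universal_seminorm G R) (\<lambda>_. free_gen g)"


section \<open>The twisted C*-algebra of the $\mathbb{Z}_2^l$-graph $\prod_{i=1}^l Z_2$\<close>

definition Z2_pow :: "nat \<Rightarrow> (nat \<Rightarrow> bit) set" where
  "Z2_pow l = {m. \<forall>i. i \<notin> {1..l} \<longrightarrow> m i = 0}"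

definition Z2_add :: "(nat \<Rightarrow> bit) \<Rightarrow> (nat \<Rightarrow> bit) \<Rightarrow> nat \<Rightarrow> bit" where
  "Z2_add m n = (\<lambda>i. m i + n i)"

definition Z2_zero :: "nat \<Rightarrow> bit" where
  "Z2_zero = (\<lambda>_. 0)"

definition sign_bit :: "bit \<Rightarrow> complex" where
  "sign_bit b = (if b = 0 then 1 else - 1)"

definition kappa :: "nat \<Rightarrow> (nat \<Rightarrow> bit) \<Rightarrow> (nat \<Rightarrow> bit) \<Rightarrow> bit" where
  "kappa l m n = (\<Sum>(j, i) \<in> {(j, i). 1 \<le> j \<and> j < i \<and> i \<le> l}. m i * n j)"

definition cocycle :: "nat \<Rightarrow> (nat \<Rightarrow> bit) \<Rightarrow> (nat \<Rightarrow> bit) \<Rightarrow> complex" where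
  "cocycle l m n = sign_bit (kappa l m n)"

definition delta :: "nat \<Rightarrow> (nat \<Rightarrow> bit) \<Rightarrow> bit" where
  "delta l m = (\<Sum>i=1..l. m i)"

definition twisted_relations :: "nat \<Rightarrow> (nat \<Rightarrow> bit) star_poly set" where
  "twisted_relations l =
    (let F = free_star_alg (Z2_pow l); s = free_gen in
      {adiff F (amult F (s Z2_zero) (s Z2_zero)) (s Z2_zero),
       adiff F (astar F (s Z2_zero)) (s Z2_zero)} \<union>
      {adiff F (amult F (s m) (s n)) (ascale F (cocycle l m n) (s (Z2_add m n))) | m n.
         m \<in> Z2_pow l \<and> n \<in> Z2_pow l} \<union>
      {adiff F (amult F (astar F (s m)) (s m)) (s Z2_zero) | m. m \<in> Z2_pow l} \<union>
      {adiff F (amult F (s m) (astar F (s m))) (s Z2_zero) | m. m \<in> Z2_pow l})"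

definition twisted_gen ::
  "nat \<Rightarrow> (nat \<Rightarrow> bit) \<Rightarrow> (nat \<Rightarrow> (nat \<Rightarrow> bit) star_poly) set" where
  "twisted_gen l = universal_gen (Z2_pow l) (twisted_relations l)"

text \<open>The automorphism induced by \<open>delta\<close>: on the free *-algebra it multiplies a word by the
  product of the signs of its letters.\<close>

definition delta_sign :: "nat \<Rightarrow> (nat \<Rightarrow> bit) star_poly \<Rightarrow> (nat \<Rightarrow> bit) star_poly" where
  "delta_sign l f = (\<lambda>w. (\<Prod>a\<leftarrow>w. sign_bit (delta l (fst a))) * f w)"

definition alpha_delta ::
  "nat \<Rightarrow> (nat \<Rightarrow> (nat \<Rightarrow> bit) star_poly) set \<Rightarrow> (nat \<Rightarrow> (nat \<Rightarrow> bit) star_poly) set" where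
  "alpha_delta l = completion_map (free_star_alg (Z2_pow l))
     (universal_seminorm (Z2_pow l) (twisted_relations l)) (delta_sign l)"

definition twisted_cstar :: "nat \<Rightarrow> (nat \<Rightarrow> (nat \<Rightarrow> bit) star_poly) set graded_cstar_alg" where
  "twisted_cstar l =
     cstar_alg.extend (universal_cstar (Z2_pow l) (twisted_relations l))
       (graded_cstar_alg.fields (alpha_delta l))"


section \<open>Complex Clifford algebras\<close>

text \<open>Finite-dimensional algebras are realised on spaces of functions that vanish off a finite set
  of lists, all of one length.  Concatenation is then injective on pairs of indices, and the
  algebraic tensor product of the functions on \<open>I\<close> with those on \<open>J\<close> is the space of
  functions on \<open>{u @ v | u \<in> I, v \<in> J}\<close>; being finite-dimensional, it needs no completion.\<close>

type_synonym 'i coord_alg = "('i list \<Rightarrow> complex) graded_cstar_alg"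

definition index_set :: "'i coord_alg \<Rightarrow> 'i list set" where
  "index_set A = {u. unit_at u \<in> car A}"

definition tensor ::
  "'i coord_alg \<Rightarrow> 'i coord_alg \<Rightarrow> ('i list \<Rightarrow> complex) \<Rightarrow> ('i list \<Rightarrow> complex) \<Rightarrow> 'i list \<Rightarrow> complex"
  where "tensor A B a b =
    (\<lambda>w. \<Sum>u\<in>index_set A. \<Sum>v\<in>index_set B. if w = u @ v then a u * b v else 0)"

definition degree_part ::
  "('a, 'x) graded_cstar_alg_scheme \<Rightarrow> nat \<Rightarrow> 'a \<Rightarrow> 'a" where
  "degree_part A j a = ascale A (1 / 2) (aadd A a (ascale A ((- 1) ^ j) (grade A a)))"

text \<open>For homogeneous \<open>b\<close> and \<open>a'\<close> only the summand with \<open>p\<close> the degree of \<open>b\<close> and \<open>q\<close> the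
  degree of \<open>a'\<close> survives below; likewise for the adjoint.\<close>

definition gtensor_mult_pure ::
  "'i coord_alg \<Rightarrow> 'i coord_alg \<Rightarrow> ('i list \<Rightarrow> complex) \<Rightarrow> ('i list \<Rightarrow> complex) \<Rightarrow>
   ('i list \<Rightarrow> complex) \<Rightarrow> ('i list \<Rightarrow> complex) \<Rightarrow> 'i list \<Rightarrow> complex" where
  "gtensor_mult_pure A B a b a' b' =
    (\<lambda>w. \<Sum>p\<in>{0, 1}. \<Sum>q\<in>{0, 1}. (- 1) ^ (p * q) *
       tensor A B (amult A a (degree_part A q a')) (amult B (degree_part B p b) b') w)"

definition gtensor_star_pure ::
  "'i coord_alg \<Rightarrow> 'i coord_alg \<Rightarrow> ('i list \<Rightarrow> complex) \<Rightarrow> ('i list \<Rightarrow> complex) \<Rightarrow>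
   'i list \<Rightarrow> complex" where
  "gtensor_star_pure A B a b =
    (\<lambda>w. \<Sum>p\<in>{0, 1}. \<Sum>q\<in>{0, 1}. (- 1) ^ (p * q) *
       tensor A B (astar A (degree_part A p a)) (astar B (degree_part B q b)) w)"

definition gtensor_star_alg ::
  "'i coord_alg \<Rightarrow> 'i coord_alg \<Rightarrow> ('i list \<Rightarrow> complex) star_alg" where
  "gtensor_star_alg A B =
    (let I = index_set A; J = index_set B in
     \<lparr>car = {x. \<forall>w. x w \<noteq> 0 \<longrightarrow> (\<exists>u\<in>I. \<exists>v\<in>J. w = u @ v)},
      azero = (\<lambda>_. 0),
      aadd = (\<lambda>x y w. x w + y w),
      ascale = (\<lambda>c x w. c * x w),
      amult = (\<lambda>x y w. \<Sum>u\<in>I. \<Sum>v\<in>J. \<Sum>u'\<in>I. \<Sum>v'\<in>J. x (u @ v) * y (u' @ v') *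
         gtensor_mult_pure A B (unit_at u) (unit_at v) (unit_at u') (unit_at v') w),
      astar = (\<lambda>x w. \<Sum>u\<in>I. \<Sum>v\<in>J. cnj (x (u @ v)) *
         gtensor_star_pure A B (unit_at u) (unit_at v) w)\<rparr>)"

definition gtensor_grade ::
  "'i coord_alg \<Rightarrow> 'i coord_alg \<Rightarrow> ('i list \<Rightarrow> complex) \<Rightarrow> 'i list \<Rightarrow> complex" where
  "gtensor_grade A B x =
    (\<lambda>w. \<Sum>u\<in>index_set A. \<Sum>v\<in>index_set B. x (u @ v) *
       tensor A B (grade A (unit_at u)) (grade B (unit_at v)) w)"

text \<open>The norm is the largest C*-seminorm: on a finite-dimensional *-algebra that admits a C*-norm
  at all, this is the only C*-norm.\<close>

definition gtensor :: "'i coord_alg \<Rightarrow> 'i coord_alg \<Rightarrow> 'i coord_alg" where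
  "gtensor A B =
     cstar_alg.extend
       (star_alg.extend (gtensor_star_alg A B)
         (cstar_alg.fields (max_cstar_seminorm (gtensor_star_alg A B) {})))
       (graded_cstar_alg.fields (gtensor_grade A B))"

text \<open>The C*-algebra $\mathbb{C} \oplus \mathbb{C}$; the pair $(z, w)$ is the function with value
  $z$ at \<open>[False]\<close> and $w$ at \<open>[True]\<close>.\<close>

definition cliff_one :: "bool coord_alg" where
  "cliff_one =
     \<lparr>car = {x. \<forall>u. x u \<noteq> 0 \<longrightarrow> u \<in> {[False], [True]}},
      azero = (\<lambda>_. 0),
      aadd = (\<lambda>x y u. x u + y u),
      ascale = (\<lambda>c x u. c * x u),
      amult = (\<lambda>x y u. x u * y u),
      astar = (\<lambda>x u. cnj (x u)),
      anorm = (\<lambda>x. max (cmod (x [False])) (cmod (x [True]))),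
      grade = (\<lambda>x u. x (map Not u))\<rparr>"

text \<open>Nothing is specified for index 0.\<close>

fun cliff :: "nat \<Rightarrow> bool coord_alg" where
  "cliff (Suc 0) = cliff_one"
| "cliff (Suc (Suc n)) = gtensor (cliff (Suc n)) cliff_one"

end

theory Submission
  imports Defs "HOL-Analysis.L2_Norm"
begin

text \<open>Both algebras are compared with the twisted group algebra of $\mathbb{Z}_2^l$, a
  $2^l$-dimensional *-algebra with basis $(s_m)$.  Its left regular representation on
  $\ell^2(\mathbb{Z}_2^l)$ gives a C*-norm that dominates the coordinates, so that the largest
  C*-seminorm, which is finite because the $s_m$ are unitary, is a complete C*-norm.

  Every C*-seminorm on the free *-algebra that kills the relations factors through this algebra,
  because the relations reduce each word to a multiple of a generator.  Hence the universal
  seminorm is the pullback of the largest C*-seminorm, and an element of the completion is the set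
  of all sequences whose images converge to one element of the twisted group algebra.

  On the other side, $s_m$ is sent to the character $w \mapsto (-1)^{m \cdot w}$ as an element of
  the Clifford algebra, whose coordinates are indexed by bit strings of length $l$.  This is the
  Fourier transform of $\mathbb{Z}_2^l$, hence bijective; it is multiplicative by induction on
  $l$, since the sign rule of the graded tensor product reproduces the cocycle.\<close>

section \<open>C*-seminorms\<close>

text \<open>On the twisted group algebra and on \<open>gtensor\<close> the norm is a supremum over
  all C*-seminorms. Such a norm depends only on the *-algebra, so a bijective *-homomorphism
  preserves it without any estimate. \<open>max_cstar_seminorm_transfer\<close> makes this precise
  for surjections, in the presence of relations, and serves the free algebra, the grading and the
  Clifford side alike; \<open>cliff_one\<close> alone has an explicit norm and is treated by hand.
  The price is twofold. Suprema of reals must be shown finite, and a concrete C*-norm must be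
  exhibited: the relations by themselves do not exclude that the universal algebra collapses, and
  the regular representation is what shows that the largest seminorm separates points. The Fourier
  transform has its origin in l = 1. In C + C with the swap as grading the odd self-adjoint unitary
  is (1, -1), up to sign, so s_0 and s_1 go to (1, 1) and (1, -1), the characters of Z_2. Graded
  tensor products of these are the characters of Z_2^l.\<close>

lemma cstar_seminormD:
  assumes "cstar_seminorm A p"
  shows "x \<in> car A \<Longrightarrow> 0 \<le> p x"
    and "\<lbrakk>x \<in> car A; y \<in> car A\<rbrakk> \<Longrightarrow> p (aadd A x y) \<le> p x + p y"
    and "x \<in> car A \<Longrightarrow> p (ascale A c x) = cmod c * p x"
    and "\<lbrakk>x \<in> car A; y \<in> car A\<rbrakk> \<Longrightarrow> p (amult A x y) \<le> p x * p y"
    and "x \<in> car A \<Longrightarrow> p (astar A x) = p x"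
    and "x \<in> car A \<Longrightarrow> p (amult A (astar A x) x) = (p x)\<^sup>2"
  using assms by (simp_all add: cstar_seminorm_def)

lemma star_homD:
  assumes "star_hom f A B"
  shows "x \<in> car A \<Longrightarrow> f x \<in> car B"
    and "\<lbrakk>x \<in> car A; y \<in> car A\<rbrakk> \<Longrightarrow> f (aadd A x y) = aadd B (f x) (f y)"
    and "x \<in> car A \<Longrightarrow> f (ascale A c x) = ascale B c (f x)"
    and "\<lbrakk>x \<in> car A; y \<in> car A\<rbrakk> \<Longrightarrow> f (amult A x y) = amult B (f x) (f y)"
    and "x \<in> car A \<Longrightarrow> f (astar A x) = astar B (f x)"
  using assms by (simp_all add: star_hom_def)

section \<open>Arithmetic of differences in a *-algebra\<close>

context star_algebra
begin

lemma diff_closed: "\<lbrakk>x \<in> car A; y \<in> car A\<rbrakk> \<Longrightarrow> adiff A x y \<in> car A"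
  by (simp add: adiff_def add_closed scale_closed)

lemmas closed = zero_closed add_closed scale_closed mult_closed star_closed diff_closed

lemma hom_diff: "\<lbrakk>star_hom f A B; x \<in> car A; y \<in> car A\<rbrakk> \<Longrightarrow> f (adiff A x y) = adiff B (f x) (f y)"
  by (simp add: adiff_def star_homD[of f A B] closed)

lemma scale_zero: "x \<in> car A \<Longrightarrow> ascale A 0 x = azero A"
  using diff_self[of x] scale_add_left[of x 1 "- 1"] by (simp add: adiff_def scale_one)

lemma add_left_commute:
  "\<lbrakk>x \<in> car A; y \<in> car A; z \<in> car A\<rbrakk> \<Longrightarrow> aadd A x (aadd A y z) = aadd A y (aadd A x z)"
  by (metis add_assoc add_commute)

lemma diff_add_cancel:
  assumes "x \<in> car A" "y \<in> car A"
  shows "aadd A (adiff A x y) y = x"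
proof -
  have "aadd A (ascale A (- 1) y) y = azero A"
    using diff_self[OF assms(2)] assms by (simp add: adiff_def add_commute closed)
  then show ?thesis
    using assms by (simp add: adiff_def add_assoc closed) (metis add_commute add_zero zero_closed)
qed

lemma diff_telescope:
  assumes "x \<in> car A" "y \<in> car A" "z \<in> car A"
  shows "aadd A (adiff A x y) (adiff A y z) = adiff A x z"
  using assms diff_add_cancel[of x y] by (simp add: adiff_def add_assoc[symmetric] closed)

lemma diff_swap:
  assumes "x \<in> car A" "y \<in> car A"
  shows "ascale A (- 1) (adiff A x y) = adiff A y x"
  using assms by (simp add: adiff_def scale_add_right scale_scale scale_one add_commute closed)

lemma add_diff_add:
  assumes "x \<in> car A" "y \<in> car A" "z \<in> car A" "w \<in> car A"
  shows "adiff A (aadd A x y) (aadd A z w) = aadd A (adiff A x z) (adiff A y w)"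
  using assms by (simp add: adiff_def scale_add_right add_assoc add_left_commute closed)

lemma scale_diff:
  assumes "x \<in> car A" "y \<in> car A"
  shows "adiff A (ascale A c x) (ascale A c y) = ascale A c (adiff A x y)"
  using assms by (simp add: adiff_def scale_add_right scale_scale closed)

lemma star_diff:
  assumes "x \<in> car A" "y \<in> car A"
  shows "adiff A (astar A x) (astar A y) = astar A (adiff A x y)"
  using assms by (simp add: adiff_def star_add star_scale closed)

text \<open>Inserting z y splits the difference into one part where only the first factor changes
  and one where only the second does. Continuity of the product on sequences rests on this.\<close>

lemma mult_diff:
  assumes "x \<in> car A" "y \<in> car A" "z \<in> car A" "w \<in> car A"
  shows "adiff A (amult A x y) (amult A z w)
    = aadd A (amult A (adiff A x z) y) (amult A z (adiff A y w))"
proof -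
  have "amult A (adiff A x z) y = adiff A (amult A x y) (amult A z y)"
    "amult A z (adiff A y w) = adiff A (amult A z y) (amult A z w)"
    using assms by (simp_all add: adiff_def mult_add_left mult_add_right mult_scale_left
        mult_scale_right closed)
  then show ?thesis using assms by (simp add: diff_telescope closed)
qed

end

text \<open>Applying the inequality to \<open>inverse c\<close> and \<open>ascale A c x\<close>
  gives the reverse inequality. Suprema yield only the inequality directly, so both the largest
  seminorm and the operator norm obtain homogeneity from here.\<close>

lemma seminorm_scale_eqI:
  assumes "star_algebra A"
    and nonneg: "\<And>x. x \<in> car A \<Longrightarrow> 0 \<le> p x"
    and le: "\<And>c x. x \<in> car A \<Longrightarrow> p (ascale A c x) \<le> cmod c * p x"
    and x: "x \<in> car A"
  shows "p (ascale A c x) = cmod c * p x"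
proof (cases "c = 0")
  interpret star_algebra A by fact
  case True
  then show ?thesis using le[OF x, of 0] nonneg[of "ascale A 0 x"] x closed by simp
next
  interpret star_algebra A by fact
  case False
  have "p x = p (ascale A (inverse c) (ascale A c x))"
    using False x by (simp add: scale_scale scale_one)
  also have "\<dots> \<le> cmod (inverse c) * p (ascale A c x)" using x by (intro le closed)
  finally have "cmod c * p x \<le> p (ascale A c x)"
    using False by (simp add: norm_inverse norm_divide field_simps)
  then show ?thesis using le[OF x] by (simp add: antisym)
qed

section \<open>The largest C*-seminorm\<close>

definition cstar_seminorms_vanishing :: "('a, 'x) star_alg_scheme \<Rightarrow> 'a set \<Rightarrow> ('a \<Rightarrow> real) set" where
  "cstar_seminorms_vanishing A R = {p. cstar_seminorm A p \<and> (\<forall>r\<in>R. p r = 0)}"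

text \<open>Makes the set of competing seminorms nonempty, so that a bound for each member bounds
  the supremum. It also shows that the supremum is nonnegative.\<close>

lemma zero_seminorm_vanishing: "(\<lambda>_. 0) \<in> cstar_seminorms_vanishing A R"
  by (simp add: cstar_seminorms_vanishing_def cstar_seminorm_def)

lemma max_cstar_seminorm_eq:
  "max_cstar_seminorm A R x = (SUP p \<in> cstar_seminorms_vanishing A R. p x)"
  by (simp add: max_cstar_seminorm_def cstar_seminorms_vanishing_def)

text \<open>Each axiom survives a pointwise supremum, provided that the supremum is finite;
  \<open>bdd\<close> excludes the case in which \<open>SUP\<close> on the reals has no
  meaning.\<close>

lemma cstar_seminorm_max:
  assumes "star_algebra A"
    and bdd: "\<And>x. x \<in> car A \<Longrightarrow> bdd_above ((\<lambda>p. p x) ` cstar_seminorms_vanishing A R)"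
  shows "cstar_seminorm A (max_cstar_seminorm A R)"
proof -
  interpret star_algebra A by fact
  let ?Q = "cstar_seminorms_vanishing A R" and ?M = "max_cstar_seminorm A R"
  have Q: "cstar_seminorm A p" if "p \<in> ?Q" for p
    using that by (simp add: cstar_seminorms_vanishing_def)
  have up: "p x \<le> ?M x" if "p \<in> ?Q" "x \<in> car A" for p x
    unfolding max_cstar_seminorm_eq using bdd that by (intro cSUP_upper[where f = "\<lambda>p. p x"])
  have least: "?M x \<le> K" if "\<And>p. p \<in> ?Q \<Longrightarrow> p x \<le> K" for x K
    unfolding max_cstar_seminorm_eq using zero_seminorm_vanishing that by (intro cSUP_least) auto
  have nonneg: "0 \<le> ?M x" if "x \<in> car A" for x
    using up[OF zero_seminorm_vanishing that] .
  have scale_le: "?M (ascale A c x) \<le> cmod c * ?M x" if "x \<in> car A" for c x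
    using that by (intro least) (simp add: cstar_seminormD[OF Q] up mult_left_mono)
  have scale: "?M (ascale A c x) = cmod c * ?M x" if "x \<in> car A" for c x
    using star_algebra_axioms nonneg scale_le that by (rule seminorm_scale_eqI)
  have sq: "?M (amult A (astar A x) x) = (?M x)\<^sup>2" if x: "x \<in> car A" for x
  proof (rule antisym)
    show "?M (amult A (astar A x) x) \<le> (?M x)\<^sup>2"
      using x by (intro least) (simp add: cstar_seminormD[OF Q] up power_mono)
    \<comment> \<open>This half of the C*-identity passes to the supremum after taking square roots,
      where it bounds every p x by one constant.\<close>
    have "p x \<le> sqrt (?M (amult A (astar A x) x))" if "p \<in> ?Q" for p
      using up[OF that, of "amult A (astar A x) x"] x
      by (intro real_le_rsqrt) (simp add: cstar_seminormD[OF Q[OF that]] closed)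
    then have "?M x \<le> sqrt (?M (amult A (astar A x) x))" by (rule least)
    then show "(?M x)\<^sup>2 \<le> ?M (amult A (astar A x) x)"
      using nonneg x closed by (metis power_mono real_sqrt_pow2)
  qed
  have "?M (astar A x) = ?M x" if x: "x \<in> car A" for x
    unfolding max_cstar_seminorm_eq using x by (intro SUP_cong) (simp_all add: cstar_seminormD[OF Q])
  moreover have "?M (aadd A x y) \<le> ?M x + ?M y" if "x \<in> car A" "y \<in> car A" for x y
    using that by (intro least) (meson cstar_seminormD(2)[OF Q] up add_mono order_trans)
  moreover have "?M (amult A x y) \<le> ?M x * ?M y" if "x \<in> car A" "y \<in> car A" for x y
  proof (rule least)
    fix p assume p: "p \<in> ?Q"
    have "p (amult A x y) \<le> p x * p y" using cstar_seminormD(4)[OF Q[OF p]] that .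
    also have "\<dots> \<le> ?M x * ?M y"
      using p that up nonneg cstar_seminormD(1)[OF Q[OF p]] by (intro mult_mono) auto
    finally show "p (amult A x y) \<le> ?M x * ?M y" .
  qed
  ultimately show ?thesis
    using nonneg scale sq by (simp add: cstar_seminorm_def)
qed

text \<open>Composition with f carries seminorms on B to seminorms on A that kill R, and
  \<open>fibre\<close> lets those on A descend to B, so both suprema are over the same set of
  values. The axioms of B are available only through f. Therefore the hypothesis on R expresses by
  scaling that f r is zero, and homogeneity turns this into p (f r) = 0.\<close>

lemma max_cstar_seminorm_transfer:
  assumes "star_algebra A" and hom: "star_hom f A B" and surj: "f ` car A = car B"
    and R: "R \<subseteq> car A" "\<And>r. r \<in> R \<Longrightarrow> f r = ascale B 0 (f r)"
    and fibre: "\<And>p x y. \<lbrakk>p \<in> cstar_seminorms_vanishing A R; x \<in> car A; y \<in> car A; f x = f y\<rbrakk>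
      \<Longrightarrow> p x = p y"
    and x: "x \<in> car A"
  shows "max_cstar_seminorm A R x = max_cstar_seminorm B {} (f x)"
proof -
  interpret star_algebra A by fact
  note h = star_homD[OF hom]
  have "(\<lambda>p. p x) ` cstar_seminorms_vanishing A R
    = (\<lambda>p. p (f x)) ` cstar_seminorms_vanishing B {}" (is "?L = ?R")
  proof
    show "?R \<subseteq> ?L"
    proof
      fix t assume "t \<in> ?R"
      then obtain p where p: "cstar_seminorm B p" "t = p (f x)"
        by (auto simp: cstar_seminorms_vanishing_def)
      have "cstar_seminorm A (\<lambda>z. p (f z))"
        using cstar_seminormD[OF p(1)] by (simp add: cstar_seminorm_def h closed)
      moreover have "p (f r) = 0" if "r \<in> R" for r
        using cstar_seminormD(3)[OF p(1), of "f r" 0] R that h(1) by fastforce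
      ultimately show "t \<in> ?L"
        using p(2) by (auto simp: cstar_seminorms_vanishing_def image_iff)
    qed
    show "?L \<subseteq> ?R"
    proof
      fix t assume "t \<in> ?L"
      then obtain p where p: "p \<in> cstar_seminorms_vanishing A R" "t = p x" by auto
      \<comment> \<open>Any choice of preimages does, since p is constant on the fibres of
        f.\<close>
      define g where "g = inv_into (car A) f"
      have q: "p (g (f z)) = p z" if "z \<in> car A" for z
        unfolding g_def using p(1) that by (intro fibre) (auto simp: inv_into_into f_inv_into_f)
      have P: "cstar_seminorm A p" using p(1) by (simp add: cstar_seminorms_vanishing_def)
      have "cstar_seminorm B (\<lambda>y. p (g y))"
        using cstar_seminormD[OF P]
        by (simp add: cstar_seminorm_def surj[symmetric] q closed flip: h(2-5))
      then show "t \<in> ?R"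
        using p(2) q[OF x] by (auto simp: cstar_seminorms_vanishing_def image_iff)
    qed
  qed
  then show ?thesis by (simp add: max_cstar_seminorm_eq)
qed

text \<open>Congruence modulo the kernel of p. Calculations in the quotient by the kernel are done
  with this relation, without forming the quotient; carrier membership is built in so that chains of
  steps carry it along.\<close>

definition seminorm_equiv :: "('a, 'x) star_alg_scheme \<Rightarrow> ('a \<Rightarrow> real) \<Rightarrow> 'a \<Rightarrow> 'a \<Rightarrow> bool" where
  "seminorm_equiv A p x y \<longleftrightarrow> x \<in> car A \<and> y \<in> car A \<and> p (adiff A x y) = 0"

context
  fixes A :: "('a, 'x) star_alg_scheme" and p :: "'a \<Rightarrow> real"
  assumes A: "star_algebra A" and p: "cstar_seminorm A p"
begin

interpretation star_algebra A by (rule A)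

private lemmas cs = cstar_seminormD[OF p]

lemma seminorm_zero: "p (azero A) = 0"
  using cs(3)[OF zero_closed, of 0] by (simp add: scale_zero zero_closed)

lemma seminorm_diff_commute: "x \<in> car A \<Longrightarrow> y \<in> car A \<Longrightarrow> p (adiff A x y) = p (adiff A y x)"
  using cs(3)[of "adiff A x y" "- 1"] by (simp add: diff_swap closed)

lemma seminorm_diff_triangle:
  "\<lbrakk>x \<in> car A; y \<in> car A; z \<in> car A\<rbrakk> \<Longrightarrow> p (adiff A x z) \<le> p (adiff A x y) + p (adiff A y z)"
  using cs(2)[of "adiff A x y" "adiff A y z"] by (simp add: diff_telescope closed)

lemma seminorm_le_add_diff:
  "\<lbrakk>x \<in> car A; y \<in> car A\<rbrakk> \<Longrightarrow> p x \<le> p (adiff A x y) + p y"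
  using cs(2)[of "adiff A x y" y] by (simp add: diff_add_cancel closed)

lemma seminorm_add_diff:
  "\<lbrakk>x \<in> car A; y \<in> car A; z \<in> car A; w \<in> car A\<rbrakk>
    \<Longrightarrow> p (adiff A (aadd A x y) (aadd A z w)) \<le> p (adiff A x z) + p (adiff A y w)"
  by (simp add: add_diff_add cs(2) closed)

lemma seminorm_mult_diff:
  assumes "x \<in> car A" "y \<in> car A" "z \<in> car A" "w \<in> car A"
  shows "p (adiff A (amult A x y) (amult A z w)) \<le> p (adiff A x z) * p y + p z * p (adiff A y w)"
  unfolding mult_diff[OF assms]
  using assms by (intro order_trans[OF cs(2)] add_mono cs(4)) (simp_all add: closed)

lemma seminorm_equiv_refl: "x \<in> car A \<Longrightarrow> seminorm_equiv A p x x"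
  by (simp add: seminorm_equiv_def diff_self seminorm_zero)

lemma seminorm_equiv_sym: "seminorm_equiv A p x y \<Longrightarrow> seminorm_equiv A p y x"
  by (simp add: seminorm_equiv_def seminorm_diff_commute)

lemma seminorm_equiv_trans [trans]:
  assumes "seminorm_equiv A p x y" "seminorm_equiv A p y z"
  shows "seminorm_equiv A p x z"
  using assms seminorm_diff_triangle[of x y z] cs(1)[of "adiff A x z"]
  by (simp add: seminorm_equiv_def closed)

lemma seminorm_equiv_add:
  assumes "seminorm_equiv A p x z" "seminorm_equiv A p y w"
  shows "seminorm_equiv A p (aadd A x y) (aadd A z w)"
  using assms seminorm_add_diff[of x y z w] cs(1)[of "adiff A (aadd A x y) (aadd A z w)"]
  by (simp add: seminorm_equiv_def closed)

lemma seminorm_equiv_mult: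
  assumes "seminorm_equiv A p x z" "seminorm_equiv A p y w"
  shows "seminorm_equiv A p (amult A x y) (amult A z w)"
  using assms seminorm_mult_diff[of x y z w] cs(1)[of "adiff A (amult A x y) (amult A z w)"]
  by (simp add: seminorm_equiv_def closed)

lemma seminorm_equiv_scale:
  "seminorm_equiv A p x y \<Longrightarrow> seminorm_equiv A p (ascale A c x) (ascale A c y)"
  by (simp add: seminorm_equiv_def scale_diff cs(3) closed)

lemma seminorm_equiv_star:
  "seminorm_equiv A p x y \<Longrightarrow> seminorm_equiv A p (astar A x) (astar A y)"
  by (simp add: seminorm_equiv_def star_diff cs(5) closed)

lemma seminorm_equiv_eq:
  assumes "seminorm_equiv A p x y"
  shows "p x = p y"
  using assms seminorm_le_add_diff[of x y] seminorm_le_add_diff[of y x]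
  by (simp add: seminorm_equiv_def seminorm_diff_commute)

end

section \<open>The operator norm of left multiplications\<close>

definition operator_norm :: "('a, 'x) star_alg_scheme \<Rightarrow> ('a \<Rightarrow> real) \<Rightarrow> 'a \<Rightarrow> real" where
  "operator_norm A h a = (SUP b \<in> {b \<in> car A. h b \<le> 1}. h (amult A a b))"

context
  fixes A :: "('a, 'x) star_alg_scheme" and h :: "'a \<Rightarrow> real" and K :: "'a \<Rightarrow> real"
  assumes star_algebra: "star_algebra A"
    and h_nonneg: "\<And>x. x \<in> car A \<Longrightarrow> 0 \<le> h x"
    and h_add: "\<And>x y. \<lbrakk>x \<in> car A; y \<in> car A\<rbrakk> \<Longrightarrow> h (aadd A x y) \<le> h x + h y"
    and h_scale: "\<And>c x. x \<in> car A \<Longrightarrow> h (ascale A c x) = cmod c * h x"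
    and h_mult: "\<And>a b. \<lbrakk>a \<in> car A; b \<in> car A\<rbrakk> \<Longrightarrow> h (amult A a b) \<le> K a * h b"
    and h_adjoint: "\<And>a b. \<lbrakk>a \<in> car A; b \<in> car A\<rbrakk>
      \<Longrightarrow> (h (amult A a b))\<^sup>2 \<le> h (amult A (astar A a) (amult A a b)) * h b"
begin

interpretation star_algebra A by (rule star_algebra)

private lemma h_zero: "h (azero A) = 0"
  using h_scale[OF zero_closed, of 0] by (simp add: scale_zero zero_closed)

private lemma h_mult_unit:
  assumes a: "a \<in> car A" and c: "c \<in> car A" "h c \<le> 1"
  shows "h (amult A a c) \<le> \<bar>K a\<bar>"
proof -
  have "K a * h c \<le> \<bar>K a\<bar> * 1"
    using c h_nonneg[OF c(1)] by (intro mult_mono) auto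
  then show ?thesis using h_mult[OF a c(1)] by simp
qed

text \<open>Normalising b reduces to the unit ball, on which K shows the supremum to be finite. If h
  b = 0, normalisation is impossible, and the bound by K already makes the left side
  nonpositive.\<close>

lemma operator_norm_bound:
  assumes a: "a \<in> car A" and b: "b \<in> car A"
  shows "h (amult A a b) \<le> operator_norm A h a * h b"
proof (cases "h b = 0")
  case True
  then show ?thesis using h_mult[OF a b] by simp
next
  case False
  then have pos: "0 < h b" using h_nonneg[OF b] by simp
  let ?b = "ascale A (of_real (1 / h b)) b"
  have b': "?b \<in> car A" "h ?b = 1" using b pos by (simp_all add: closed h_scale norm_divide)
  have "h (amult A a ?b) \<le> operator_norm A h a"
    unfolding operator_norm_def using b' h_mult_unit[OF a]
    by (intro cSUP_upper bdd_aboveI[where M = "\<bar>K a\<bar>"]) auto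
  then show ?thesis
    using a b pos by (simp add: mult_scale_right h_scale norm_divide closed field_simps)
qed

lemma operator_norm_least:
  assumes "0 \<le> k" and le: "\<And>b. b \<in> car A \<Longrightarrow> h (amult A a b) \<le> k * h b"
  shows "operator_norm A h a \<le> k"
  unfolding operator_norm_def
proof (rule cSUP_least)
  show "{b \<in> car A. h b \<le> 1} \<noteq> {}" using zero_closed h_zero by auto
  fix b assume "b \<in> {b \<in> car A. h b \<le> 1}"
  then show "h (amult A a b) \<le> k"
    using le[of b] mult_left_mono[of "h b" 1 k] \<open>0 \<le> k\<close> by auto
qed

lemma operator_norm_nonneg:
  assumes a: "a \<in> car A"
  shows "0 \<le> operator_norm A h a"
proof -
  have "h (amult A a (azero A)) \<le> \<bar>K a\<bar> \<and> 0 \<le> h (amult A a (azero A))"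
    using h_mult[OF a zero_closed] h_nonneg a closed by (simp add: h_zero)
  then show ?thesis
    unfolding operator_norm_def using h_zero zero_closed h_mult_unit[OF a]
    by (intro cSUP_upper2[where x = "azero A"] bdd_aboveI[where M = "\<bar>K a\<bar>"]) auto
qed

text \<open>The inner product of a Hilbert space enters only through \<open>h_adjoint\<close>, which
  bounds the square of the norm of x by the norm of \<open>amult A (astar A x) x\<close>. With
  submultiplicativity and cancellation, the norm of x is at most that of its adjoint, hence equal to
  it by symmetry. The other half of the C*-identity is then submultiplicativity again.\<close>

lemma cstar_seminorm_operator_norm: "cstar_seminorm A (operator_norm A h)"
proof -
  let ?N = "operator_norm A h"
  note bound = operator_norm_bound and nonneg = operator_norm_nonneg
  have scale: "?N (ascale A c x) = cmod c * ?N x" if "x \<in> car A" for c x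
    using star_algebra nonneg _ that
  proof (rule seminorm_scale_eqI)
    fix c x assume x: "x \<in> car A"
    show "?N (ascale A c x) \<le> cmod c * ?N x"
      using x by (intro operator_norm_least)
        (auto simp: nonneg mult_scale_left h_scale closed mult.assoc intro!: mult_left_mono bound)
  qed
  have add: "?N (aadd A x y) \<le> ?N x + ?N y" if "x \<in> car A" "y \<in> car A" for x y
  proof (rule operator_norm_least)
    fix b assume b: "b \<in> car A"
    have "h (amult A (aadd A x y) b) \<le> h (amult A x b) + h (amult A y b)"
      using that b by (simp add: mult_add_left h_add closed)
    also have "\<dots> \<le> ?N x * h b + ?N y * h b" using that b by (intro add_mono bound)
    finally show "h (amult A (aadd A x y) b) \<le> (?N x + ?N y) * h b" by (simp add: distrib_right)
  qed (simp add: that nonneg)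
  have mult: "?N (amult A x y) \<le> ?N x * ?N y" if "x \<in> car A" "y \<in> car A" for x y
  proof (rule operator_norm_least)
    fix b assume b: "b \<in> car A"
    have "h (amult A (amult A x y) b) \<le> ?N x * h (amult A y b)"
      using that b by (simp add: mult_assoc bound closed)
    also have "\<dots> \<le> ?N x * (?N y * h b)" using that b by (intro mult_left_mono bound nonneg)
    finally show "h (amult A (amult A x y) b) \<le> ?N x * ?N y * h b" by (simp add: mult.assoc)
  qed (simp add: that nonneg)
  have sq: "(?N x)\<^sup>2 \<le> ?N (amult A (astar A x) x)" if x: "x \<in> car A" for x
  proof -
    have c: "amult A (astar A x) x \<in> car A" using x by (simp add: closed)
    have "?N x \<le> sqrt (?N (amult A (astar A x) x))"
    proof (rule operator_norm_least)
      fix b assume b: "b \<in> car A"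
      have "(h (amult A x b))\<^sup>2 \<le> h (amult A (amult A (astar A x) x) b) * h b"
        using h_adjoint[OF x b] x b by (simp add: mult_assoc closed)
      also have "\<dots> \<le> ?N (amult A (astar A x) x) * h b * h b"
        using b c by (intro mult_right_mono bound h_nonneg)
      finally have "h (amult A x b) \<le> sqrt (?N (amult A (astar A x) x) * (h b)\<^sup>2)"
        by (intro real_le_rsqrt) (simp add: power2_eq_square mult.assoc)
      then show "h (amult A x b) \<le> sqrt (?N (amult A (astar A x) x)) * h b"
        using h_nonneg[OF b] by (simp add: real_sqrt_mult)
    qed (simp add: nonneg c)
    then show ?thesis using nonneg[OF x] nonneg[OF c] by (metis power_mono real_sqrt_pow2)
  qed
  have star_le: "?N x \<le> ?N (astar A x)" if x: "x \<in> car A" for x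
  proof (cases "?N x = 0")
    case True
    then show ?thesis using nonneg[OF star_closed[OF x]] by simp
  next
    case False
    have "?N x * ?N x \<le> ?N (astar A x) * ?N x"
      using sq[OF x] mult[OF star_closed[OF x] x] by (simp add: power2_eq_square)
    then show ?thesis using False nonneg[OF x] by (simp add: mult_le_cancel_right)
  qed
  have star: "?N (astar A x) = ?N x" if x: "x \<in> car A" for x
    using star_le[OF x] star_le[OF star_closed[OF x]] x by (simp add: star_star)
  have "?N (amult A (astar A x) x) = (?N x)\<^sup>2" if x: "x \<in> car A" for x
    using sq[OF x] mult[OF star_closed[OF x] x] star[OF x] by (simp add: power2_eq_square)
  then show ?thesis
    using nonneg scale add mult star by (simp add: cstar_seminorm_def)
qed

end

section \<open>Transport of structure\<close>

text \<open>\<open>star_hom\<close> does not mention zero, and B is not yet an algebra in which the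
  image of zero could be recognised; hence the separate hypothesis on zero.\<close>

lemma star_algebra_transport:
  assumes "star_algebra A" and iso: "star_iso f A B" and zero: "f (azero A) = azero B"
  shows "star_algebra B"
proof -
  interpret star_algebra A by fact
  have hom: "star_hom f A B" and car: "car B = f ` car A"
    using iso by (auto simp: star_iso_def bij_betw_def)
  note h = star_homD(2-5)[OF hom, symmetric]
  have d: "adiff B (f x) (f y) = f (adiff A x y)" if "x \<in> car A" "y \<in> car A" for x y
    using hom_diff[OF hom that] by simp
  have comm: "f (aadd A x y) = f (aadd A y x)" if "x \<in> car A" "y \<in> car A" for x y
    using add_commute[OF that] by simp
  show ?thesis
    by unfold_locales
      (auto simp: car h comm d zero[symmetric] closed add_assoc add_zero diff_self scale_add_right
        scale_add_left scale_scale scale_one mult_assoc mult_add_left mult_add_right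
        mult_scale_left mult_scale_right star_star star_add star_scale star_mult)
qed

lemma cstar_seminorm_transport:
  assumes "star_algebra A" and hom: "star_hom f A B" "f ` car A = car B"
    and p: "cstar_seminorm A p" "\<And>x. x \<in> car A \<Longrightarrow> q (f x) = p x"
  shows "cstar_seminorm B q"
proof -
  interpret star_algebra A by fact
  show ?thesis
    using cstar_seminormD[OF p(1)]
    by (simp add: cstar_seminorm_def hom(2)[symmetric] p(2) closed flip: star_homD(2-5)[OF hom(1)])
qed

lemma cstar_algebra_transport:
  assumes "cstar_algebra A" and iso: "star_iso f A B" and zero: "f (azero A) = azero B"
    and norm: "\<And>x. x \<in> car A \<Longrightarrow> anorm B (f x) = anorm A x"
  shows "cstar_algebra B"
proof -
  interpret cstar_algebra A by fact
  have hom: "star_hom f A B" and car: "car B = f ` car A" and bij: "bij_betw f (car A) (car B)"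
    using iso by (auto simp: star_iso_def bij_betw_def)
  interpret B: star_algebra B
    using star_algebra_axioms iso zero by (rule star_algebra_transport)
  have d: "anorm B (adiff B (f x) (f y)) = anorm A (adiff A x y)" if "x \<in> car A" "y \<in> car A" for x y
    using hom_diff[OF hom that] that by (simp add: norm closed flip: hom_diff[OF hom])
  show ?thesis
  proof
    show "cstar_seminorm B (anorm B)"
      using star_algebra_axioms hom car[symmetric] norm_cstar norm by (rule cstar_seminorm_transport)
    show "x = azero B" if "x \<in> car B" "anorm B x = 0" for x
      using that norm_definite zero by (auto simp: car norm)
    fix Y assume Y: "Y \<in> cauchy_seqs B (anorm B)"
    define X where "X n = inv_into (car A) f (Y n)" for n
    have Yc: "Y n \<in> car B" for n using Y by (simp add: cauchy_seqs_def)
    then have X: "X n \<in> car A" "f (X n) = Y n" for n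
      by (auto simp: X_def car inv_into_into f_inv_into_f)
    have "X \<in> cauchy_seqs A (anorm A)"
      using Y X(1) by (simp add: cauchy_seqs_def d flip: X(2))
    from norm_complete[OF this] obtain x where
      "x \<in> car A" "(\<lambda>n. anorm A (adiff A (X n) x)) \<longlonglongrightarrow> 0" by blast
    then show "\<exists>y\<in>car B. (\<lambda>n. anorm B (adiff B (Y n) y)) \<longlonglongrightarrow> 0"
      by (intro bexI[of _ "f x"]) (simp_all add: d X(1) car flip: X(2))
  qed
qed

lemma graded_cstar_algebra_transport:
  assumes "graded_cstar_algebra A" and "cstar_algebra B" and iso: "graded_iso f A B"
  shows "graded_cstar_algebra B"
proof -
  interpret graded_cstar_algebra A by fact
  interpret B: cstar_algebra B by fact
  have hom: "star_hom f A B" and car: "car B = f ` car A"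
    using iso by (auto simp: graded_iso_def star_iso_def bij_betw_def)
  have g: "grade B (f x) = f (grade A x)" if "x \<in> car A" for x
    using iso that by (simp add: graded_iso_def)
  have gh: "star_hom (grade A) A A"
    using grade_automorphism by (simp add: star_iso_def)
  note gA = star_homD[OF gh]
  have "star_hom (grade B) B B"
    unfolding star_hom_def car using star_homD(1)[OF hom]
    by (simp add: g gA closed flip: star_homD(2-5)[OF hom])
  moreover have gg: "grade B (grade B y) = y" if "y \<in> car B" for y
    using that by (auto simp: car g gA grade_grade)
  moreover have "bij_betw (grade B) (car B) (car B)"
    by (rule bij_betw_byWitness[where f' = "grade B"]) (use gg gA(1) in \<open>auto simp: car g\<close>)
  ultimately show ?thesis
    by unfold_locales (auto simp: star_iso_def)
qed

lemma graded_iso_inv: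
  assumes "star_algebra A" and iso: "graded_iso f A B" and gc: "\<And>x. x \<in> car A \<Longrightarrow> grade A x \<in> car A"
  shows "graded_iso (inv_into (car A) f) B A"
proof -
  interpret star_algebra A by fact
  let ?g = "inv_into (car A) f"
  have hom: "star_hom f A B" and bij: "bij_betw f (car A) (car B)"
    using iso by (auto simp: graded_iso_def star_iso_def)
  have car: "car B = f ` car A" and inj: "inj_on f (car A)" using bij by (auto simp: bij_betw_def)
  have g: "grade B (f x) = f (grade A x)" if "x \<in> car A" for x
    using iso that by (simp add: graded_iso_def)
  show ?thesis
    unfolding graded_iso_def star_iso_def star_hom_def
    using bij_betw_inv_into[OF bij]
    by (simp add: car g gc inj closed flip: star_homD(2-5)[OF hom])
qed

lemma graded_iso_trans:
  assumes "graded_iso f A B" "graded_iso g B C"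
  shows "graded_iso (\<lambda>x. g (f x)) A C"
  using assms bij_betw_trans[of f "car A" "car B" g "car C"]
  by (simp add: graded_iso_def star_iso_def star_hom_def comp_def)

section \<open>Completions\<close>

lemma tendsto_zero_le:
  fixes u v :: "nat \<Rightarrow> real"
  assumes "\<And>n. 0 \<le> u n" "\<And>n. u n \<le> v n" "v \<longlonglongrightarrow> 0"
  shows "u \<longlonglongrightarrow> 0"
  using assms by (intro tendsto_sandwich[OF _ _ tendsto_const assms(3)] always_eventually allI)

section \<open>The completion for a seminorm pulled back along a surjection onto a
  C*-algebra\<close>

context
  fixes A :: "'a star_alg" and p :: "'a \<Rightarrow> real" and M :: "('b, 'x) cstar_alg_scheme" and f :: "'a \<Rightarrow> 'b"
  assumes A: "star_algebra A" and M: "cstar_algebra M"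
    and hom: "star_hom f A M" and surj: "f ` car A = car M"
    and p: "\<And>x. x \<in> car A \<Longrightarrow> p x = anorm M (f x)"
begin

interpretation A: star_algebra A by (rule A)
interpretation M: cstar_algebra M by (rule M)

private lemmas norm = cstar_seminormD[OF M.norm_cstar]
private lemmas ctxt = M.star_algebra_axioms M.norm_cstar

private lemma f_closed: "x \<in> car A \<Longrightarrow> f x \<in> car M"
  using star_homD(1)[OF hom] .

private abbreviation d where "d a b \<equiv> anorm M (adiff M a b)"

text \<open>The element of the completion that corresponds to \<open>a\<close>: the sequences whose image
  under \<open>f\<close> converges to \<open>a\<close>.\<close>

definition limit_class :: "'b \<Rightarrow> (nat \<Rightarrow> 'a) set" where
  "limit_class a = {X. (\<forall>n. X n \<in> car A) \<and> (\<lambda>n. d (f (X n)) a) \<longlonglongrightarrow> 0}"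

lemma seminorm_diff_eq: "x \<in> car A \<Longrightarrow> y \<in> car A \<Longrightarrow> p (adiff A x y) = d (f x) (f y)"
  by (simp add: p A.closed A.hom_diff[OF hom])

lemma limit_class_cauchy:
  assumes X: "X \<in> limit_class a" and a: "a \<in> car M"
  shows "X \<in> cauchy_seqs A p"
proof -
  have Xc: "X n \<in> car A" for n using X by (simp add: limit_class_def)
  have "\<exists>N. \<forall>m\<ge>N. \<forall>n\<ge>N. p (adiff A (X m) (X n)) < e" if "0 < e" for e
  proof -
    have "(\<lambda>n. d (f (X n)) a) \<longlonglongrightarrow> 0" using X by (simp add: limit_class_def)
    then have "\<forall>\<^sub>F n in sequentially. d (f (X n)) a < e / 2"
      using that by (intro order_tendstoD) auto
    then obtain N where N: "\<And>n. n \<ge> N \<Longrightarrow> d (f (X n)) a < e / 2"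
      by (auto simp: eventually_sequentially)
    have "p (adiff A (X m) (X n)) < e" if "m \<ge> N" "n \<ge> N" for m n
      using seminorm_diff_triangle[OF ctxt f_closed[OF Xc] a f_closed[OF Xc], of m n]
        N[OF that(1)] N[OF that(2)] seminorm_diff_commute[OF ctxt f_closed[OF Xc] a, of n]
      by (simp add: seminorm_diff_eq Xc)
    then show ?thesis by blast
  qed
  then show ?thesis using Xc by (simp add: cauchy_seqs_def)
qed

lemma cauchy_limit_class:
  assumes X: "X \<in> cauchy_seqs A p"
  shows "\<exists>a\<in>car M. X \<in> limit_class a"
proof -
  have Xc: "X n \<in> car A" for n using X by (simp add: cauchy_seqs_def)
  have "(\<lambda>n. f (X n)) \<in> cauchy_seqs M (anorm M)"
    using X by (simp add: cauchy_seqs_def seminorm_diff_eq f_closed Xc)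
  from M.norm_complete[OF this] show ?thesis using Xc by (auto simp: limit_class_def)
qed

text \<open>Once the image of X converges to a, the triangle inequality shows that Y is at
  p-distance tending to zero from X exactly when its image converges to a as well. The equivalence
  classes are therefore the fibres of the limit.\<close>

lemma seq_class_eq:
  assumes X: "X \<in> limit_class a" and a: "a \<in> car M"
  shows "seq_class A p X = limit_class a"
proof -
  have lim: "(\<lambda>n. d (f (X n)) a) \<longlonglongrightarrow> 0" and Xc: "X n \<in> car A" for n
    using X by (simp_all add: limit_class_def)
  note Xf = f_closed[OF Xc]
  have "Y \<in> limit_class a \<longleftrightarrow> Y \<in> cauchy_seqs A p \<and> (\<lambda>n. p (adiff A (X n) (Y n))) \<longlonglongrightarrow> 0" for Y
  proof
    assume Y: "Y \<in> limit_class a"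
    then have Yc: "Y n \<in> car A" and Ylim: "(\<lambda>n. d (f (Y n)) a) \<longlonglongrightarrow> 0" for n
      by (simp_all add: limit_class_def)
    have "d (f (X n)) (f (Y n)) \<le> d (f (X n)) a + d (f (Y n)) a" for n
      using seminorm_diff_triangle[OF ctxt Xf a f_closed[OF Yc], of n n]
        seminorm_diff_commute[OF ctxt f_closed[OF Yc] a] by simp
    then have "(\<lambda>n. d (f (X n)) (f (Y n))) \<longlonglongrightarrow> 0"
      by (intro tendsto_zero_le[OF _ _ tendsto_eq_rhs[OF tendsto_add[OF lim Ylim]]])
        (simp_all add: norm(1) M.closed Xf f_closed Yc)
    then show "Y \<in> cauchy_seqs A p \<and> (\<lambda>n. p (adiff A (X n) (Y n))) \<longlonglongrightarrow> 0"
      using limit_class_cauchy[OF Y a] by (simp add: seminorm_diff_eq Xc Yc)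
  next
    assume Y: "Y \<in> cauchy_seqs A p \<and> (\<lambda>n. p (adiff A (X n) (Y n))) \<longlonglongrightarrow> 0"
    then have Yc: "Y n \<in> car A" for n by (simp add: cauchy_seqs_def)
    have Ylim: "(\<lambda>n. d (f (X n)) (f (Y n))) \<longlonglongrightarrow> 0"
      using Y by (simp add: seminorm_diff_eq Xc Yc)
    have "d (f (Y n)) a \<le> d (f (X n)) (f (Y n)) + d (f (X n)) a" for n
      using seminorm_diff_triangle[OF ctxt f_closed[OF Yc] Xf a, of n n]
        seminorm_diff_commute[OF ctxt f_closed[OF Yc] Xf, of n n] by simp
    then have "(\<lambda>n. d (f (Y n)) a) \<longlonglongrightarrow> 0"
      by (intro tendsto_zero_le[OF _ _ tendsto_eq_rhs[OF tendsto_add[OF Ylim lim]]])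
        (simp_all add: norm(1) M.closed f_closed Yc a)
    then show "Y \<in> limit_class a" using Yc by (simp add: limit_class_def)
  qed
  then show ?thesis
    using limit_class_cauchy[OF X a] by (auto simp: seq_class_def null_rel_def)
qed

lemma const_limit_class: "x \<in> car A \<Longrightarrow> (\<lambda>_. x) \<in> limit_class (f x)"
  by (simp add: limit_class_def M.diff_self f_closed seminorm_zero[OF ctxt])

text \<open>Surjectivity of f provides a constant sequence over a. This matters because the
  operations on classes are unions over representatives, and an empty class would make them
  empty.\<close>

lemma limit_class_nonempty: "a \<in> car M \<Longrightarrow> limit_class a \<noteq> {}"
  unfolding surj[symmetric] by (auto dest: const_limit_class)

lemma car_completion: "car (completion A p) = limit_class ` car M"
proof -
  have "seq_class A p X \<in> limit_class ` car M" if "X \<in> cauchy_seqs A p" for X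
    using cauchy_limit_class[OF that] seq_class_eq by blast
  moreover have "\<exists>X\<in>cauchy_seqs A p. limit_class a = seq_class A p X" if "a \<in> car M" for a
    using limit_class_nonempty[OF that] seq_class_eq[OF _ that] limit_class_cauchy[OF _ that] by blast
  ultimately show ?thesis
    by (auto simp: completion_def quotient_def seq_class_def[symmetric])
qed

text \<open>Uniqueness of limits: a common representative forces a and b to distance zero, and the
  norm of M is definite.\<close>

lemma limit_class_inj: "inj_on limit_class (car M)"
proof (rule inj_onI)
  fix a b assume ab: "a \<in> car M" "b \<in> car M" "limit_class a = limit_class b"
  obtain X where "X \<in> limit_class a" "X \<in> limit_class b"
    using limit_class_nonempty[OF ab(1)] ab(3) by blast
  then have Xc: "X n \<in> car A" and lim: "(\<lambda>n. d (f (X n)) a) \<longlonglongrightarrow> 0" "(\<lambda>n. d (f (X n)) b) \<longlonglongrightarrow> 0" for n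
    by (simp_all add: limit_class_def)
  have "d a b \<le> d (f (X n)) a + d (f (X n)) b" for n
    using seminorm_diff_triangle[OF ctxt ab(1) f_closed[OF Xc] ab(2), of n]
      seminorm_diff_commute[OF ctxt f_closed[OF Xc] ab(1)] by simp
  then have "(\<lambda>_. d a b) \<longlonglongrightarrow> 0"
    using ab
      by (intro tendsto_zero_le[OF _ _ tendsto_eq_rhs[OF tendsto_add[OF lim]]])
      (simp_all add: norm(1) M.closed)
  then have "d a b = 0" by (simp add: LIMSEQ_const_iff)
  then have "adiff M a b = azero M" using ab by (intro M.norm_definite M.closed)
  then show "a = b" using M.diff_add_cancel[OF ab(1,2)] M.add_zero[OF ab(2)] by simp
qed

text \<open>All members of the union coincide as soon as g maps representatives of a to
  representatives of b; nonemptiness then makes the union that one class.\<close>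

lemma completion_map_limit_class:
  assumes "a \<in> car M" "b \<in> car M" "\<And>X. X \<in> limit_class a \<Longrightarrow> (\<lambda>n. g (X n)) \<in> limit_class b"
  shows "completion_map A p g (limit_class a) = limit_class b"
  using limit_class_nonempty[OF assms(1)] seq_class_eq[OF assms(3,2)]
  by (auto simp: completion_map_def)

lemma completion_map2_limit_class:
  assumes "a \<in> car M" "b \<in> car M" "c \<in> car M"
    "\<And>X Y. \<lbrakk>X \<in> limit_class a; Y \<in> limit_class b\<rbrakk> \<Longrightarrow> (\<lambda>n. g (X n) (Y n)) \<in> limit_class c"
  shows "completion_map2 A p g (limit_class a) (limit_class b) = limit_class c"
  using limit_class_nonempty[OF assms(1)] limit_class_nonempty[OF assms(2)]
    seq_class_eq[OF assms(4) assms(3)]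
  by (auto simp: completion_map2_def)

text \<open>Serves the grading: a map on A that lies over an isometric homomorphism of M can be
  applied to sequences term by term and respects limits.\<close>

lemma completion_map_isometry:
  assumes a: "a \<in> car M" and h: "star_hom h M M" "\<And>b. b \<in> car M \<Longrightarrow> anorm M (h b) = anorm M b"
    and g: "\<And>x. x \<in> car A \<Longrightarrow> g x \<in> car A" "\<And>x. x \<in> car A \<Longrightarrow> f (g x) = h (f x)"
  shows "completion_map A p g (limit_class a) = limit_class (h a)"
  using a
  by (intro completion_map_limit_class)
    (simp_all add: limit_class_def g star_homD(1)[OF h(1)] h(2) f_closed M.closed
      flip: M.hom_diff[OF h(1)])

lemma completion_add:
  assumes ab: "a \<in> car M" "b \<in> car M"
  shows "aadd (completion A p) (limit_class a) (limit_class b) = limit_class (aadd M a b)"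
proof -
  have "completion_map2 A p (aadd A) (limit_class a) (limit_class b) = limit_class (aadd M a b)"
    using ab
  proof (rule completion_map2_limit_class)
    fix X Y assume "X \<in> limit_class a" "Y \<in> limit_class b"
    then have c: "X n \<in> car A" "Y n \<in> car A"
      and lim: "(\<lambda>n. d (f (X n)) a) \<longlonglongrightarrow> 0" "(\<lambda>n. d (f (Y n)) b) \<longlonglongrightarrow> 0" for n
      by (simp_all add: limit_class_def)
    have "d (f (aadd A (X n) (Y n))) (aadd M a b) \<le> d (f (X n)) a + d (f (Y n)) b" for n
      using seminorm_add_diff[OF ctxt f_closed[OF c(1)] f_closed[OF c(2)] ab, of n n]
      by (simp add: star_homD(2)[OF hom] c)
    then have "(\<lambda>n. d (f (aadd A (X n) (Y n))) (aadd M a b)) \<longlonglongrightarrow> 0"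
      using ab
      by (intro tendsto_zero_le[OF _ _ tendsto_eq_rhs[OF tendsto_add[OF lim]]])
        (simp_all add: norm(1) M.closed f_closed A.closed c)
    then show "(\<lambda>n. aadd A (X n) (Y n)) \<in> limit_class (aadd M a b)"
      by (simp add: limit_class_def A.closed c)
  qed (simp add: M.closed ab)
  then show ?thesis by (simp add: completion_def)
qed

lemma completion_mult:
  assumes ab: "a \<in> car M" "b \<in> car M"
  shows "amult (completion A p) (limit_class a) (limit_class b) = limit_class (amult M a b)"
proof -
  have "completion_map2 A p (amult A) (limit_class a) (limit_class b) = limit_class (amult M a b)"
    using ab
  proof (rule completion_map2_limit_class)
    fix X Y assume "X \<in> limit_class a" "Y \<in> limit_class b"
    then have c: "X n \<in> car A" "Y n \<in> car A"
      and lim: "(\<lambda>n. d (f (X n)) a) \<longlonglongrightarrow> 0" "(\<lambda>n. d (f (Y n)) b) \<longlonglongrightarrow> 0" for n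
      by (simp_all add: limit_class_def)
    \<comment> \<open>The norm of f (Y n) varies with n. Bounding it by the distance to b plus the
      norm of b gives an upper bound whose limit is visibly zero.\<close>
    let ?v = "\<lambda>n. d (f (X n)) a * (d (f (Y n)) b + anorm M b) + anorm M a * d (f (Y n)) b"
    have le: "d (f (amult A (X n) (Y n))) (amult M a b) \<le> ?v n" for n
    proof -
      have "d (f (amult A (X n) (Y n))) (amult M a b)
          \<le> d (f (X n)) a * anorm M (f (Y n)) + anorm M a * d (f (Y n)) b"
        using seminorm_mult_diff[OF ctxt f_closed[OF c(1)] f_closed[OF c(2)] ab, of n n]
        by (simp add: star_homD(4)[OF hom] c)
      also have "\<dots> \<le> ?v n"
        using seminorm_le_add_diff[OF ctxt f_closed[OF c(2)] ab(2), of n] ab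
        by (intro add_mono mult_left_mono order_refl) (simp_all add: norm(1) M.closed f_closed c)
      finally show ?thesis .
    qed
    have v: "?v \<longlonglongrightarrow> 0 * (0 + anorm M b) + anorm M a * 0"
      using lim by (intro tendsto_intros)
    have "(\<lambda>n. d (f (amult A (X n) (Y n))) (amult M a b)) \<longlonglongrightarrow> 0"
      using le ab
      by (intro tendsto_zero_le[OF _ _ tendsto_eq_rhs[OF v]]) (simp_all add: norm(1) M.closed f_closed A.closed c)
    then show "(\<lambda>n. amult A (X n) (Y n)) \<in> limit_class (amult M a b)"
      by (simp add: limit_class_def A.closed c)
  qed (simp add: M.closed ab)
  then show ?thesis by (simp add: completion_def)
qed

lemma completion_scale:
  assumes a: "a \<in> car M"
  shows "ascale (completion A p) c (limit_class a) = limit_class (ascale M c a)"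
proof -
  have "completion_map A p (ascale A c) (limit_class a) = limit_class (ascale M c a)"
    using a
  proof (rule completion_map_limit_class)
    fix X assume "X \<in> limit_class a"
    then have Xc: "X n \<in> car A" and lim: "(\<lambda>n. d (f (X n)) a) \<longlonglongrightarrow> 0" for n
      by (simp_all add: limit_class_def)
    show "(\<lambda>n. ascale A c (X n)) \<in> limit_class (ascale M c a)"
      using tendsto_mult_left[OF lim, of "cmod c"] a
      by (simp add: limit_class_def A.closed Xc star_homD(3)[OF hom] M.scale_diff f_closed norm(3) M.closed)
  qed (simp add: M.closed a)
  then show ?thesis by (simp add: completion_def)
qed

lemma completion_star:
  assumes a: "a \<in> car M"
  shows "astar (completion A p) (limit_class a) = limit_class (astar M a)"
proof -
  have "completion_map A p (astar A) (limit_class a) = limit_class (astar M a)"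
    using a
    by (intro completion_map_limit_class)
      (simp_all add: limit_class_def A.closed star_homD(5)[OF hom] M.star_diff f_closed norm(5) M.closed)
  then show ?thesis by (simp add: completion_def)
qed

text \<open>The norm of a class is read off from an arbitrarily chosen representative; by the
  reverse triangle inequality every representative has the same limit of seminorms.\<close>

lemma completion_norm:
  assumes a: "a \<in> car M"
  shows "anorm (completion A p) (limit_class a) = anorm M a"
proof -
  define X where "X = (SOME X. X \<in> limit_class a)"
  have "X \<in> limit_class a"
    unfolding X_def using limit_class_nonempty[OF a] by (simp add: some_in_eq)
  then have Xc: "X n \<in> car A" and lim: "(\<lambda>n. d (f (X n)) a) \<longlonglongrightarrow> 0" for n
    by (simp_all add: limit_class_def)
  have "\<bar>p (X n) - anorm M a\<bar> \<le> d (f (X n)) a" for n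
    using seminorm_le_add_diff[OF ctxt f_closed[OF Xc] a, of n]
      seminorm_le_add_diff[OF ctxt a f_closed[OF Xc], of n]
      seminorm_diff_commute[OF ctxt f_closed[OF Xc] a, of n]
    by (simp add: p Xc)
  then have "(\<lambda>n. \<bar>p (X n) - anorm M a\<bar>) \<longlonglongrightarrow> 0"
    by (intro tendsto_zero_le[OF _ _ lim]) simp_all
  then have "(\<lambda>n. p (X n)) \<longlonglongrightarrow> anorm M a"
    by (simp add: tendsto_rabs_zero_iff LIM_zero_iff)
  then show ?thesis by (simp add: completion_def limI flip: X_def)
qed

lemma completion_zero: "azero (completion A p) = limit_class (azero M)"
proof -
  \<comment> \<open>Preservation of zero is not part of \<open>star_hom\<close>; writing zero as a
    difference brings in operations that f does preserve.\<close>
  have "f (adiff A (azero A) (azero A)) = azero M"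
    using A.hom_diff[OF hom A.zero_closed A.zero_closed] M.diff_self[OF f_closed[OF A.zero_closed]]
    by simp
  then have "f (azero A) = azero M" by (simp add: A.diff_self A.zero_closed)
  then show ?thesis
    using seq_class_eq[OF const_limit_class[OF A.zero_closed] f_closed[OF A.zero_closed]]
    by (simp add: completion_def)
qed

lemma star_iso_completion: "star_iso limit_class M (completion A p)"
  by (simp add: star_iso_def star_hom_def bij_betw_def limit_class_inj car_completion
      completion_add completion_mult completion_scale completion_star)

end

section \<open>Algebras of functions on a finite set\<close>

text \<open>Only the vector space is fixed; product, adjoint and norm stay free, so that the group
  algebra, \<open>cliff_one\<close> and the graded tensor products can share the results
  below.\<close>

definition function_algebra :: "('i \<Rightarrow> complex, 'x) star_alg_scheme \<Rightarrow> 'i set \<Rightarrow> bool" where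
  "function_algebra A I \<longleftrightarrow> finite I \<and> car A = {x. \<forall>i. x i \<noteq> 0 \<longrightarrow> i \<in> I} \<and>
     azero A = (\<lambda>_. 0) \<and> aadd A = (\<lambda>x y i. x i + y i) \<and> ascale A = (\<lambda>c x i. c * x i)"

lemma finite_support_induct [consumes 2, case_names zero add]:
  assumes "finite S" and "\<And>i. x i \<noteq> 0 \<Longrightarrow> i \<in> S"
    and zero: "P (\<lambda>_. 0)"
    and add: "\<And>x c i. \<lbrakk>i \<in> S; \<And>j. x j \<noteq> 0 \<Longrightarrow> j \<in> S; P x\<rbrakk> \<Longrightarrow> P (\<lambda>j. x j + c * unit_at i j)"
  shows "P x"
proof -
  have "P x" if "finite T" "T \<subseteq> S" "\<And>i. x i \<noteq> 0 \<Longrightarrow> i \<in> T" for T x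
    using that
  proof (induction T arbitrary: x)
    case empty
    then have "x = (\<lambda>_. 0)" by auto
    then show ?case using zero by simp
  next
    case (insert i T)
    let ?y = "x(i := 0)"
    have "P ?y" using insert.prems by (intro insert.IH) (auto split: if_splits)
    then have "P (\<lambda>j. ?y j + x i * unit_at i j)"
      using insert.prems by (intro add[OF _ _ \<open>P ?y\<close>]) (auto split: if_splits)
    moreover have "(\<lambda>j. ?y j + x i * unit_at i j) = x" by (auto simp: unit_at_def)
    ultimately show ?case by simp
  qed
  from this[OF assms(1) subset_refl assms(2)] show ?thesis .
qed

lemma function_algebra_diff:
  "function_algebra A I \<Longrightarrow> adiff A x y = (\<lambda>i. x i - y i)"
  by (simp add: function_algebra_def adiff_def)

lemma function_algebra_unit: "function_algebra A I \<Longrightarrow> i \<in> I \<Longrightarrow> unit_at i \<in> car A"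
  by (auto simp: function_algebra_def unit_at_def)

lemma function_algebra_induct [consumes 2, case_names zero add]:
  assumes A: "function_algebra A I" and x: "x \<in> car A"
    and zero: "P (azero A)"
    and add: "\<And>x c i. \<lbrakk>x \<in> car A; i \<in> I; P x\<rbrakk> \<Longrightarrow> P (aadd A x (ascale A c (unit_at i)))"
  shows "P x"
proof (rule finite_support_induct[where S = I])
  show "finite I" "P (\<lambda>_. 0)" using A zero by (simp_all add: function_algebra_def)
  show "\<And>i. x i \<noteq> 0 \<Longrightarrow> i \<in> I" using A x by (simp add: function_algebra_def)
  fix y c i assume "i \<in> I" "\<And>j. y j \<noteq> 0 \<Longrightarrow> j \<in> I" "P y"
  then show "P (\<lambda>j. y j + c * unit_at i j)"
    using add[of y i c] A by (simp add: function_algebra_def)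
qed

text \<open>Turns sums over unit vectors, by which the graded tensor product is defined, back into
  values at arbitrary elements. F is linear on the carrier only; homogeneity with scalar zero
  supplies its value at zero.\<close>

lemma linear_functional_expand:
  assumes A: "function_algebra A I" and x: "x \<in> car A"
    and add: "\<And>x y. \<lbrakk>x \<in> car A; y \<in> car A\<rbrakk> \<Longrightarrow> F (aadd A x y) = F x + F y"
    and scale: "\<And>c x. x \<in> car A \<Longrightarrow> F (ascale A c x) = c * F x"
  shows "(\<Sum>i\<in>I. x i * F (unit_at i)) = (F x :: complex)"
  using A x
proof (induction rule: function_algebra_induct)
  case zero
  have "azero A = ascale A 0 (azero A)" "azero A \<in> car A"
    using A by (simp_all add: function_algebra_def)
  then have "F (azero A) = 0" using scale[of "azero A" 0] by simp
  then show ?case using A by (simp add: function_algebra_def)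
next
  case (add x c i)
  have c: "unit_at i \<in> car A" "ascale A c (unit_at i) \<in> car A" and I: "finite I"
    using function_algebra_unit[OF A add(2)] A by (auto simp: function_algebra_def)
  have "(\<Sum>j\<in>I. c * unit_at i j * F (unit_at j)) = (\<Sum>j\<in>I. if j = i then c * F (unit_at i) else 0)"
    by (intro sum.cong refl) (auto simp: unit_at_def)
  then have "(\<Sum>j\<in>I. c * unit_at i j * F (unit_at j)) = c * F (unit_at i)"
    using add(2) I by simp
  moreover have "aadd A x (ascale A c (unit_at i)) j = x j + c * unit_at i j" for j
    using A by (simp add: function_algebra_def)
  ultimately have "(\<Sum>j\<in>I. aadd A x (ascale A c (unit_at i)) j * F (unit_at j)) = F x + c * F (unit_at i)"
    using add by (simp add: distrib_right sum.distrib)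
  then show ?case using add c assms(3,4) by simp
qed

text \<open>The triangle inequality along the basis expansion. Every seminorm is thus controlled by
  its values on the basis, which yields both finite suprema and norm limits from coordinate
  limits.\<close>

lemma function_algebra_seminorm_le:
  assumes A: "function_algebra A I" and p: "cstar_seminorm A p" and x: "x \<in> car A"
  shows "p x \<le> (\<Sum>i\<in>I. cmod (x i) * p (unit_at i))"
proof -
  note cs = cstar_seminormD[OF p]
  have I: "finite I" and car: "y \<in> car A \<longleftrightarrow> (\<forall>i. y i \<noteq> 0 \<longrightarrow> i \<in> I)" for y
    using A by (auto simp: function_algebra_def)
  have aadd: "(\<lambda>i. y i + z i) = aadd A y z" and ascale: "(\<lambda>i. c * y i) = ascale A c y" for y z c
    using A by (auto simp: function_algebra_def)
  have zero: "(\<lambda>_. 0) \<in> car A" by (simp add: car)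
  have p0: "p (\<lambda>_. 0) = 0" using cs(3)[OF zero, of 0] by (simp flip: ascale)
  have "p x \<le> (\<Sum>i\<in>T. cmod (x i) * p (unit_at i))"
    if "finite T" "T \<subseteq> I" "\<And>i. x i \<noteq> 0 \<Longrightarrow> i \<in> T" for T x
    using that
  proof (induction T arbitrary: x)
    case empty
    then have "x = (\<lambda>_. 0)" by auto
    then show ?case using p0 by simp
  next
    case (insert i T)
    let ?y = "x(i := 0)"
    have u: "unit_at i \<in> car A" using insert.prems function_algebra_unit[OF A] by simp
    have y: "?y \<in> car A" using insert.prems by (auto simp: car)
    have su: "(\<lambda>j. x i * unit_at i j) \<in> car A" using u by (simp add: car)
    have "x = (\<lambda>j. ?y j + x i * unit_at i j)" by (auto simp: unit_at_def)
    then have "p x = p (aadd A ?y (\<lambda>j. x i * unit_at i j))" using aadd by metis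
    also have "\<dots> \<le> p ?y + p (\<lambda>j. x i * unit_at i j)" using y su by (rule cs(2))
    also have "p (\<lambda>j. x i * unit_at i j) = cmod (x i) * p (unit_at i)"
      unfolding ascale using u by (rule cs(3))
    also have "p ?y \<le> (\<Sum>j\<in>T. cmod (?y j) * p (unit_at j))"
      using insert.prems by (intro insert.IH) (auto split: if_splits)
    also have "\<dots> = (\<Sum>j\<in>T. cmod (x j) * p (unit_at j))"
      using insert.hyps by (intro sum.cong) auto
    finally show ?case using insert.hyps by simp
  qed
  from this[OF I subset_refl] show ?thesis using x car by blast
qed

text \<open>The coordinate bound makes the norm definite and Cauchy sequences convergent in each
  coordinate; the bound by the basis expansion turns this into convergence in norm.\<close>

lemma cstar_algebra_function_algebra:
  assumes "star_algebra A" and A: "function_algebra A I"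
    and norm: "cstar_seminorm A (anorm A)"
    and coord: "\<And>x i. x \<in> car A \<Longrightarrow> cmod (x i) \<le> anorm A x"
  shows "cstar_algebra A"
proof -
  interpret star_algebra A by fact
  have I: "finite I" and car: "y \<in> car A \<longleftrightarrow> (\<forall>i. y i \<noteq> 0 \<longrightarrow> i \<in> I)" for y
    using A by (auto simp: function_algebra_def)
  note diff = function_algebra_diff[OF A]
  show ?thesis
  proof
    show "x = azero A" if "x \<in> car A" "anorm A x = 0" for x
      using coord[OF that(1)] that(2) A by (simp add: function_algebra_def fun_eq_iff)
    fix X assume X: "X \<in> cauchy_seqs A (anorm A)"
    then have Xc: "X n \<in> car A" for n by (simp add: cauchy_seqs_def)
    have "Cauchy (\<lambda>n. X n i)" for i
    proof (rule metric_CauchyI)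
      fix e :: real assume "0 < e"
      then obtain N where N: "\<And>m n. m \<ge> N \<Longrightarrow> n \<ge> N \<Longrightarrow> anorm A (adiff A (X m) (X n)) < e"
        using X by (force simp: cauchy_seqs_def)
      have "dist (X m i) (X n i) < e" if "m \<ge> N" "n \<ge> N" for m n
        using coord[OF diff_closed[OF Xc Xc], of m n i] N[OF that]
        by (simp add: diff dist_norm)
      then show "\<exists>N. \<forall>m\<ge>N. \<forall>n\<ge>N. dist (X m i) (X n i) < e" by blast
    qed
    then have lim: "(\<lambda>n. X n i) \<longlonglongrightarrow> lim (\<lambda>n. X n i)" for i
      by (simp add: Cauchy_convergent convergent_LIMSEQ_iff[symmetric])
    define y where "y i = lim (\<lambda>n. X n i)" for i
    have y: "y \<in> car A"
      unfolding car
    proof (intro allI impI)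
      fix i assume "y i \<noteq> 0"
      moreover have "y i = 0" if "i \<notin> I"
      proof -
        have "X n i = 0" for n using Xc that car by blast
        then show ?thesis by (simp add: y_def)
      qed
      ultimately show "i \<in> I" by blast
    qed
    have "(\<lambda>n. \<Sum>i\<in>I. cmod (X n i - y i) * anorm A (unit_at i))
        \<longlonglongrightarrow> (\<Sum>i\<in>I. cmod (y i - y i) * anorm A (unit_at i))"
      using lim unfolding y_def by (intro tendsto_intros)
    then have l: "(\<lambda>n. \<Sum>i\<in>I. cmod (X n i - y i) * anorm A (unit_at i)) \<longlonglongrightarrow> 0" by simp
    have "anorm A (adiff A (X n) y) \<le> (\<Sum>i\<in>I. cmod (X n i - y i) * anorm A (unit_at i))" for n
      using function_algebra_seminorm_le[OF A norm diff_closed[OF Xc y], of n] by (simp add: diff)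
    moreover have "0 \<le> anorm A (adiff A (X n) y)" for n
      using cstar_seminormD(1)[OF norm diff_closed[OF Xc y]] .
    ultimately have "(\<lambda>n. anorm A (adiff A (X n) y)) \<longlonglongrightarrow> 0"
      by (intro tendsto_sandwich[OF _ _ tendsto_const l] always_eventually allI)
    then show "\<exists>x\<in>car A. (\<lambda>n. anorm A (adiff A (X n) x)) \<longlonglongrightarrow> 0" using y by blast
  qed (rule norm)
qed

section \<open>The twisted group algebra\<close>

text \<open>These rules would rewrite sums and products of bits into bitwise operations, out of
  reach of the ring laws on which the computations with \<open>kappa\<close> and
  \<open>delta\<close> rest.\<close>

declare add_bit_eq_xor [simp del] mult_bit_eq_and [simp del]

lemma bit_add_self: "(a::bit) + a = 0"
  by (cases a) simp_all

lemma sign_bit_add: "sign_bit (a + b) = sign_bit a * sign_bit b"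
  by (cases a; cases b) (simp_all add: sign_bit_def)

lemma sign_bit_sq: "sign_bit a * sign_bit a = 1"
  by (simp add: sign_bit_def)

lemma cnj_sign_bit [simp]: "cnj (sign_bit a) = sign_bit a"
  by (simp add: sign_bit_def)

lemma norm_sign_bit [simp]: "cmod (sign_bit a) = 1"
  by (simp add: sign_bit_def)

section \<open>The group Z_2^l and its cocycle\<close>

lemma Z2_add_commute: "Z2_add m n = Z2_add n m"
  by (simp add: Z2_add_def add.commute)

lemma Z2_add_assoc: "Z2_add (Z2_add m n) k = Z2_add m (Z2_add n k)"
  by (simp add: Z2_add_def add.assoc)

lemma Z2_add_left_commute: "Z2_add m (Z2_add n k) = Z2_add n (Z2_add m k)"
  by (simp add: Z2_add_def add.left_commute)

lemma Z2_add_self: "Z2_add m m = Z2_zero"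
  by (simp add: Z2_add_def Z2_zero_def bit_add_self)

lemma Z2_add_zero [simp]: "Z2_add Z2_zero m = m" "Z2_add m Z2_zero = m"
  by (simp_all add: Z2_add_def Z2_zero_def)

lemma Z2_add_cancel: "Z2_add m (Z2_add m n) = n"
  by (simp add: Z2_add_self flip: Z2_add_assoc)

lemmas Z2_add_ac = Z2_add_assoc Z2_add_commute Z2_add_left_commute Z2_add_self Z2_add_cancel

lemma Z2_add_eq_iff: "Z2_add m n = k \<longleftrightarrow> n = Z2_add m k"
  by (metis Z2_add_cancel)

lemma Z2_zero_in_pow [simp]: "Z2_zero \<in> Z2_pow l"
  by (simp add: Z2_pow_def Z2_zero_def)

lemma Z2_add_in_pow [simp]: "m \<in> Z2_pow l \<Longrightarrow> n \<in> Z2_pow l \<Longrightarrow> Z2_add m n \<in> Z2_pow l"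
  by (simp add: Z2_pow_def Z2_add_def)

lemma Z2_add_in_pow_iff: "m \<in> Z2_pow l \<Longrightarrow> Z2_add m n \<in> Z2_pow l \<longleftrightarrow> n \<in> Z2_pow l"
  by (metis Z2_add_cancel Z2_add_in_pow)

lemma finite_Z2_pow [simp]: "finite (Z2_pow l)"
proof -
  have "finite (UNIV :: bit set)"
    by (rule finite_subset[of _ "{0, 1}"]) auto
  then have "finite {m. \<forall>i. (i \<in> {1..l} \<longrightarrow> m i \<in> (UNIV :: bit set)) \<and> (i \<notin> {1..l} \<longrightarrow> m i = 0)}"
    by (intro finite_set_of_finite_funs) auto
  then show ?thesis by (simp add: Z2_pow_def)
qed

lemma sum_Z2_shift:
  "m \<in> Z2_pow l \<Longrightarrow> (\<Sum>k\<in>Z2_pow l. f (Z2_add m k)) = (\<Sum>k\<in>Z2_pow l. f k)"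
  by (rule sum.reindex_bij_witness[where i = "Z2_add m" and j = "Z2_add m"])
    (simp_all add: Z2_add_cancel)

text \<open>\<open>kappa\<close> is bilinear, so the cocycle is multiplicative in each argument. As
  its values are signs, the 2-cocycle identity and all regroupings below become
  simplifications.\<close>

lemma cocycle_add_left: "cocycle l (Z2_add m n) k = cocycle l m k * cocycle l n k"
  by (simp add: cocycle_def kappa_def Z2_add_def distrib_right sum.distrib case_prod_unfold
      sign_bit_add)

lemma cocycle_add_right: "cocycle l k (Z2_add m n) = cocycle l k m * cocycle l k n"
  by (simp add: cocycle_def kappa_def Z2_add_def distrib_left sum.distrib case_prod_unfold
      sign_bit_add)

lemma cocycle_sq: "cocycle l m n * cocycle l m n = 1"
  by (simp add: cocycle_def sign_bit_sq)

lemma cocycle_sq_left: "cocycle l m n * (cocycle l m n * z) = z"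
  by (simp add: cocycle_sq flip: mult.assoc)

lemma cocycle_zero [simp]: "cocycle l Z2_zero n = 1" "cocycle l n Z2_zero = 1"
  by (simp_all add: cocycle_def kappa_def Z2_zero_def sign_bit_def)

lemma cnj_cocycle [simp]: "cnj (cocycle l m n) = cocycle l m n"
  by (simp add: cocycle_def)

lemma norm_cocycle [simp]: "cmod (cocycle l m n) = 1"
  by (simp add: cocycle_def)

lemma delta_add: "delta l (Z2_add m n) = delta l m + delta l n"
  by (simp add: delta_def Z2_add_def sum.distrib)

lemmas cocycle_simps = cocycle_add_left cocycle_add_right cocycle_sq cocycle_sq_left

text \<open>Twisted convolution: every group element is its own inverse, so the partner of m in the
  coefficient at k is m + k. As s_m s_m is c(m,m) s_0, the inverse of s_m, and hence its adjoint, is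
  c(m,m) s_m.\<close>

definition twisted_group_star_alg :: "nat \<Rightarrow> ((nat \<Rightarrow> bit) \<Rightarrow> complex) star_alg" where
  "twisted_group_star_alg l =
     \<lparr>car = {x. \<forall>m. x m \<noteq> 0 \<longrightarrow> m \<in> Z2_pow l},
      azero = (\<lambda>_. 0),
      aadd = (\<lambda>x y m. x m + y m),
      ascale = (\<lambda>c x m. c * x m),
      amult = (\<lambda>x y k. \<Sum>m\<in>Z2_pow l. cocycle l m (Z2_add m k) * x m * y (Z2_add m k)),
      astar = (\<lambda>x m. cocycle l m m * cnj (x m))\<rparr>"

lemma function_algebra_twisted_group: "function_algebra (twisted_group_star_alg l) (Z2_pow l)"
  by (simp add: function_algebra_def twisted_group_star_alg_def)

lemma star_algebra_twisted_group: "star_algebra (twisted_group_star_alg l)"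
proof -
  let ?A = "twisted_group_star_alg l" and ?G = "Z2_pow l"
  note A = twisted_group_star_alg_def
  have mult_closed: "amult ?A x y \<in> car ?A" if "x \<in> car ?A" "y \<in> car ?A" for x y
    using that by (auto simp: A Z2_add_in_pow_iff elim!: sum.not_neutral_contains_not_neutral)
  have mult_assoc: "amult ?A (amult ?A x y) z = amult ?A x (amult ?A y z)" for x y z
  proof
    fix k
    define F where "F n m = cocycle l m (Z2_add m k) * cocycle l n (Z2_add n m) * x n
      * y (Z2_add n m) * z (Z2_add m k)" for n m
    have "amult ?A (amult ?A x y) z k = (\<Sum>m\<in>?G. \<Sum>n\<in>?G. F n m)"
      by (simp add: A F_def sum_distrib_left sum_distrib_right mult_ac)
    also have "\<dots> = (\<Sum>n\<in>?G. \<Sum>m\<in>?G. F n m)"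
      by (rule sum.swap)
    \<comment> \<open>Here m indexes the product of the first two factors; in terms of the second
      factor p it is n + p, which is the indexing of the other bracketing.\<close>
    also have "\<dots> = (\<Sum>n\<in>?G. \<Sum>p\<in>?G. F n (Z2_add n p))"
      by (rule sum.cong[OF refl], rule sum_Z2_shift[symmetric])
    also have "\<dots> = amult ?A x (amult ?A y z) k"
      by (simp add: A F_def sum_distrib_left cocycle_simps Z2_add_ac mult_ac)
    finally show "amult ?A (amult ?A x y) z k = amult ?A x (amult ?A y z) k" .
  qed
  have star_mult: "astar ?A (amult ?A x y) = amult ?A (astar ?A y) (astar ?A x)"
    if "x \<in> car ?A" "y \<in> car ?A" for x y
  proof
    fix k
    show "astar ?A (amult ?A x y) k = amult ?A (astar ?A y) (astar ?A x) k"
    proof (cases "k \<in> ?G")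
      case True
      define F where "F m = cocycle l m (Z2_add m k) * (cocycle l m m * cnj (y m))
        * (cocycle l (Z2_add m k) (Z2_add m k) * cnj (x (Z2_add m k)))" for m
      have "amult ?A (astar ?A y) (astar ?A x) k = (\<Sum>m\<in>?G. F m)"
        by (simp add: A F_def)
      also have "\<dots> = (\<Sum>m\<in>?G. F (Z2_add k m))"
        by (rule sum_Z2_shift[OF True, symmetric])
      also have "\<dots> = astar ?A (amult ?A x y) k"
        by (simp add: A F_def sum_distrib_left cocycle_simps Z2_add_ac mult_ac)
      finally show ?thesis by simp
    next
      \<comment> \<open>Translation by k preserves the group only for k inside it. For other k both
        sides vanish, because products stay in the carrier.\<close>
      case False
      have zero: "u k = 0" if "u \<in> car ?A" for u
        using that False by (auto simp: A)
      have "astar ?A (amult ?A x y) k = cocycle l k k * cnj (amult ?A x y k)"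
        by (simp add: A)
      then have "astar ?A (amult ?A x y) k = 0"
        using zero[OF mult_closed[OF that]] by simp
      moreover have "amult ?A (astar ?A y) (astar ?A x) k = 0"
        using that by (intro zero mult_closed) (simp_all add: A)
      ultimately show ?thesis by simp
    qed
  qed
  show ?thesis
  proof
    fix x y assume "x \<in> car ?A" "y \<in> car ?A"
    then show "amult ?A x y \<in> car ?A" "astar ?A (amult ?A x y) = amult ?A (astar ?A y) (astar ?A x)"
      by (rule mult_closed, rule star_mult)
  next
    fix x y assume "x \<in> car ?A" "y \<in> car ?A"
    then show "aadd ?A x y \<in> car ?A" by (simp add: A) (metis add.right_neutral)
  qed (rule mult_assoc
      | simp add: A adiff_def algebra_simps sum.distrib sum_distrib_left cocycle_simps fun_eq_iff)+
qed

lemma twisted_group_mult_unit: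
  assumes "m \<in> Z2_pow l"
  shows "amult (twisted_group_star_alg l) (unit_at m) (unit_at n)
    = ascale (twisted_group_star_alg l) (cocycle l m n) (unit_at (Z2_add m n))"
proof
  fix k
  have "(\<Sum>i\<in>Z2_pow l. cocycle l i (Z2_add i k) * unit_at m i * unit_at n (Z2_add i k))
    = (\<Sum>i\<in>Z2_pow l. if i = m then cocycle l m n * unit_at (Z2_add m n) k else 0)"
    by (intro sum.cong refl) (auto simp: unit_at_def Z2_add_eq_iff Z2_add_cancel)
  then show "amult (twisted_group_star_alg l) (unit_at m) (unit_at n) k
    = ascale (twisted_group_star_alg l) (cocycle l m n) (unit_at (Z2_add m n)) k"
    using assms by (simp add: twisted_group_star_alg_def)
qed

lemma twisted_group_star_unit:
  "astar (twisted_group_star_alg l) (unit_at m)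
    = ascale (twisted_group_star_alg l) (cocycle l m m) (unit_at m)"
  by (rule ext) (simp add: twisted_group_star_alg_def unit_at_def)

lemma twisted_group_mult_one:
  "amult (twisted_group_star_alg l) x (unit_at Z2_zero) k
    = (if k \<in> Z2_pow l then x k else 0)"
proof -
  have "(\<Sum>i\<in>Z2_pow l. cocycle l i (Z2_add i k) * x i * unit_at Z2_zero (Z2_add i k))
    = (\<Sum>i\<in>Z2_pow l. if i = k then x k else 0)"
    by (intro sum.cong refl) (auto simp: unit_at_def Z2_add_eq_iff Z2_add_self)
  then show ?thesis by (simp add: twisted_group_star_alg_def)
qed

section \<open>The regular representation on l^2 of the group\<close>

definition l2_norm :: "nat \<Rightarrow> ((nat \<Rightarrow> bit) \<Rightarrow> complex) \<Rightarrow> real" where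
  "l2_norm l x = L2_set (\<lambda>m. cmod (x m)) (Z2_pow l)"

definition l2_inner :: "nat \<Rightarrow> ((nat \<Rightarrow> bit) \<Rightarrow> complex) \<Rightarrow> ((nat \<Rightarrow> bit) \<Rightarrow> complex) \<Rightarrow> complex" where
  "l2_inner l x y = (\<Sum>m\<in>Z2_pow l. x m * cnj (y m))"

lemma l2_norm_sq: "of_real ((l2_norm l x)\<^sup>2) = l2_inner l x x"
  by (simp add: l2_norm_def l2_inner_def L2_set_def sum_nonneg complex_norm_square
      del: of_real_power)

lemma l2_inner_le: "cmod (l2_inner l x y) \<le> l2_norm l x * l2_norm l y"
proof -
  have "cmod (l2_inner l x y) \<le> (\<Sum>m\<in>Z2_pow l. \<bar>cmod (x m)\<bar> * \<bar>cmod (y m)\<bar>)"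
    unfolding l2_inner_def by (rule order_trans[OF norm_sum]) (simp add: norm_mult)
  also have "\<dots> \<le> l2_norm l x * l2_norm l y"
    unfolding l2_norm_def by (rule L2_set_mult_ineq)
  finally show ?thesis .
qed

text \<open>Both sides are sums over pairs, matched by translating the second index by the first.
  Left multiplication is thereby a *-representation.\<close>

lemma l2_inner_adjoint:
  "l2_inner l (amult (twisted_group_star_alg l) a x) y
    = l2_inner l x (amult (twisted_group_star_alg l) (astar (twisted_group_star_alg l) a) y)"
proof -
  let ?G = "Z2_pow l"
  define F where "F m k = cocycle l m (Z2_add m k) * a m * x (Z2_add m k) * cnj (y k)" for m k
  have "l2_inner l (amult (twisted_group_star_alg l) a x) y = (\<Sum>k\<in>?G. \<Sum>m\<in>?G. F m k)"
    by (simp add: l2_inner_def twisted_group_star_alg_def F_def sum_distrib_right)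
  also have "\<dots> = (\<Sum>m\<in>?G. \<Sum>k\<in>?G. F m k)" by (rule sum.swap)
  also have "\<dots> = (\<Sum>m\<in>?G. \<Sum>k\<in>?G. F m (Z2_add m k))"
    by (rule sum.cong[OF refl], rule sum_Z2_shift[symmetric])
  also have "\<dots> = (\<Sum>k\<in>?G. \<Sum>m\<in>?G. F m (Z2_add m k))" by (rule sum.swap)
  also have "\<dots> = l2_inner l x (amult (twisted_group_star_alg l) (astar (twisted_group_star_alg l) a) y)"
    by (simp add: l2_inner_def twisted_group_star_alg_def F_def sum_distrib_left cocycle_simps
        Z2_add_cancel mult_ac)
  finally show ?thesis .
qed

lemma l2_norm_coord: "m \<in> Z2_pow l \<Longrightarrow> cmod (x m) \<le> l2_norm l x"
  unfolding l2_norm_def by (rule member_le_L2_set) auto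

text \<open>A crude estimate: each coordinate of the product is at most the l^1 norm of a times the
  l^2 norm of x, and an l^2 norm is at most the sum of the absolute coordinates, whence the factor
  \<open>card\<close>. Its purpose is to make the operator norm finite.\<close>

lemma l2_norm_mult:
  "l2_norm l (amult (twisted_group_star_alg l) a x)
    \<le> (real (card (Z2_pow l)) * (\<Sum>m\<in>Z2_pow l. cmod (a m))) * l2_norm l x"
proof -
  let ?G = "Z2_pow l" and ?y = "amult (twisted_group_star_alg l) a x"
  have "cmod (?y k) \<le> (\<Sum>m\<in>?G. cmod (a m)) * l2_norm l x" if "k \<in> ?G" for k
  proof -
    have "cmod (?y k) \<le> (\<Sum>m\<in>?G. cmod (a m) * cmod (x (Z2_add m k)))"
      unfolding twisted_group_star_alg_def
      by (simp, rule order_trans[OF norm_sum]) (simp add: norm_mult)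
    also have "\<dots> \<le> (\<Sum>m\<in>?G. cmod (a m) * l2_norm l x)"
      using that by (intro sum_mono mult_left_mono l2_norm_coord) auto
    finally show ?thesis by (simp add: sum_distrib_right)
  qed
  then have "(\<Sum>k\<in>?G. cmod (?y k)) \<le> (\<Sum>k\<in>?G. (\<Sum>m\<in>?G. cmod (a m)) * l2_norm l x)"
    by (rule sum_mono)
  moreover have "l2_norm l ?y \<le> (\<Sum>k\<in>?G. cmod (?y k))"
    unfolding l2_norm_def by (rule L2_set_le_sum) simp
  ultimately show ?thesis by (simp add: mult.assoc)
qed

abbreviation twisted_op_norm :: "nat \<Rightarrow> ((nat \<Rightarrow> bit) \<Rightarrow> complex) \<Rightarrow> real" where
  "twisted_op_norm l \<equiv> operator_norm (twisted_group_star_alg l) (l2_norm l)"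

lemma twisted_op_norm:
  shows "cstar_seminorm (twisted_group_star_alg l) (twisted_op_norm l)"
    and "x \<in> car (twisted_group_star_alg l) \<Longrightarrow> cmod (x i) \<le> twisted_op_norm l x"
proof -
  let ?A = "twisted_group_star_alg l" and ?h = "l2_norm l"
  let ?K = "\<lambda>a. real (card (Z2_pow l)) * (\<Sum>m\<in>Z2_pow l. cmod (a m))"
  have nonneg: "0 \<le> ?h x" for x by (simp add: l2_norm_def L2_set_nonneg)
  have add: "?h (aadd ?A x y) \<le> ?h x + ?h y" for x y
  proof -
    have "?h (aadd ?A x y) \<le> L2_set (\<lambda>m. cmod (x m) + cmod (y m)) (Z2_pow l)"
      by (simp add: l2_norm_def twisted_group_star_alg_def L2_set_mono norm_triangle_ineq)
    also have "\<dots> \<le> ?h x + ?h y" unfolding l2_norm_def by (rule L2_set_triangle_ineq)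
    finally show ?thesis .
  qed
  have scale: "?h (ascale ?A c x) = cmod c * ?h x" for c x
    by (simp add: l2_norm_def twisted_group_star_alg_def L2_set_right_distrib norm_mult)
  have adjoint: "(?h (amult ?A a b))\<^sup>2 \<le> ?h (amult ?A (astar ?A a) (amult ?A a b)) * ?h b" for a b
  proof -
    \<comment> \<open>The square is the inner product of a b with itself; moving a to the other side
      and applying Cauchy-Schwarz gives the bound.\<close>
    have "(?h (amult ?A a b))\<^sup>2 = cmod (of_real ((?h (amult ?A a b))\<^sup>2))"
      by (simp del: of_real_power)
    also have "\<dots> = cmod (l2_inner l b (amult ?A (astar ?A a) (amult ?A a b)))"
      unfolding l2_norm_sq l2_inner_adjoint ..
    also have "\<dots> \<le> ?h b * ?h (amult ?A (astar ?A a) (amult ?A a b))" by (rule l2_inner_le)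
    finally show ?thesis by (simp add: mult.commute)
  qed
  note ctxt = star_algebra_twisted_group nonneg add scale l2_norm_mult adjoint
  show "cstar_seminorm ?A (twisted_op_norm l)"
    by (rule cstar_seminorm_operator_norm[where A = ?A and h = ?h and K = ?K, OF ctxt])
  show "cmod (x i) \<le> twisted_op_norm l x" if x: "x \<in> car ?A"
  proof (cases "i \<in> Z2_pow l")
    case True
    \<comment> \<open>s_0 is a unit vector and x s_0 = x, so the operator norm of x is at least its
      l^2 norm, which dominates every coordinate.\<close>
    let ?e = "unit_at Z2_zero :: (nat \<Rightarrow> bit) \<Rightarrow> complex"
    have e: "?e \<in> car ?A" by (rule function_algebra_unit[OF function_algebra_twisted_group]) simp
    have "(cmod (?e m))\<^sup>2 = (if m = Z2_zero then 1 else 0)" for m by (simp add: unit_at_def)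
    then have "(?h ?e)\<^sup>2 = 1" by (simp add: l2_norm_def L2_set_def)
    then have "?h ?e = 1" using nonneg[of ?e] by (simp add: power2_eq_1_iff)
    moreover have "cmod (x i) \<le> ?h (amult ?A x ?e)"
      using l2_norm_coord[OF True, of "amult ?A x ?e"] True by (simp add: twisted_group_mult_one)
    ultimately show ?thesis
      using operator_norm_bound[where A = ?A and h = ?h and K = ?K, OF ctxt x e] by simp
  next
    case False
    then have "x i = 0" using x by (auto simp: twisted_group_star_alg_def)
    then show ?thesis
      using operator_norm_nonneg[where A = ?A and h = ?h and K = ?K, OF ctxt x] by simp
  qed
qed

text \<open>The C*-identity makes p e equal to its own square, so it is 0 or 1.\<close>

lemma cstar_seminorm_projection_le:
  assumes "cstar_seminorm A p" "e \<in> car A" "amult A (astar A e) e = e"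
  shows "p e \<le> 1"
proof -
  have "p e * p e = p e" using cstar_seminormD(6)[OF assms(1,2)] assms(3) by (simp add: power2_eq_square)
  then show ?thesis by (metis mult_cancel_right1 order_refl zero_le_one)
qed

lemma cstar_seminorm_isometry_le:
  assumes "cstar_seminorm A p" "u \<in> car A" "p (amult A (astar A u) u) \<le> 1"
  shows "p u \<le> 1"
proof -
  have "(p u)\<^sup>2 \<le> 1" using cstar_seminormD(6)[OF assms(1,2)] assms(3) by simp
  then show ?thesis using power2_le_imp_le[of "p u" 1] by simp
qed

text \<open>s_0 is a projection, and the adjoint of s_m times s_m is s_0, so every seminorm is at
  most 1 on the basis; it may be smaller, since a seminorm can vanish. The l^1 norm then bounds all
  seminorms at once.\<close>

lemma bdd_twisted_group_seminorms:
  assumes x: "x \<in> car (twisted_group_star_alg l)"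
  shows "bdd_above ((\<lambda>p. p x) ` cstar_seminorms_vanishing (twisted_group_star_alg l) {})"
proof (rule bdd_aboveI2)
  let ?A = "twisted_group_star_alg l"
  note A = function_algebra_twisted_group[of l]
  interpret star_algebra ?A by (rule star_algebra_twisted_group)
  fix p assume "p \<in> cstar_seminorms_vanishing ?A {}"
  then have p: "cstar_seminorm ?A p" by (simp add: cstar_seminorms_vanishing_def)
  have sq: "amult ?A (astar ?A (unit_at m)) (unit_at m) = unit_at Z2_zero" if "m \<in> Z2_pow l" for m
    using that function_algebra_unit[OF A that] function_algebra_unit[OF A Z2_zero_in_pow]
    by (simp add: twisted_group_star_unit twisted_group_mult_unit mult_scale_left scale_scale
        Z2_add_self cocycle_sq scale_one)
  have "p (unit_at Z2_zero) \<le> 1"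
    by (rule cstar_seminorm_projection_le[OF p function_algebra_unit[OF A Z2_zero_in_pow] sq]) simp
  then have "p (unit_at m) \<le> 1" if "m \<in> Z2_pow l" for m
    using that by (intro cstar_seminorm_isometry_le[OF p function_algebra_unit[OF A that]]) (simp add: sq)
  then have "(\<Sum>i\<in>Z2_pow l. cmod (x i) * p (unit_at i)) \<le> (\<Sum>i\<in>Z2_pow l. cmod (x i) * 1)"
    by (intro sum_mono mult_left_mono) auto
  then show "p x \<le> (\<Sum>i\<in>Z2_pow l. cmod (x i))"
    using function_algebra_seminorm_le[OF A p x] by simp
qed

text \<open>The norm is the largest seminorm and not the operator norm itself: in this form it can
  be compared, supremum against supremum, with the universal seminorm and with the norm of
  \<open>gtensor\<close>.\<close>

definition twisted_group_alg :: "nat \<Rightarrow> ((nat \<Rightarrow> bit) \<Rightarrow> complex) graded_cstar_alg" where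
  "twisted_group_alg l =
     cstar_alg.extend
       (star_alg.extend (twisted_group_star_alg l)
         (cstar_alg.fields (max_cstar_seminorm (twisted_group_star_alg l) {})))
       (graded_cstar_alg.fields (\<lambda>x m. sign_bit (delta l m) * x m))"

lemma twisted_group_alg_simps [simp]:
  "car (twisted_group_alg l) = car (twisted_group_star_alg l)"
  "azero (twisted_group_alg l) = azero (twisted_group_star_alg l)"
  "aadd (twisted_group_alg l) = aadd (twisted_group_star_alg l)"
  "ascale (twisted_group_alg l) = ascale (twisted_group_star_alg l)"
  "amult (twisted_group_alg l) = amult (twisted_group_star_alg l)"
  "astar (twisted_group_alg l) = astar (twisted_group_star_alg l)"
  "anorm (twisted_group_alg l) = max_cstar_seminorm (twisted_group_star_alg l) {}"
  "grade (twisted_group_alg l) = (\<lambda>x m. sign_bit (delta l m) * x m)"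
  by (simp_all add: twisted_group_alg_def cstar_alg.defs star_alg.defs graded_cstar_alg.defs)

lemma star_iso_twisted_group: "star_iso (\<lambda>x. x) (twisted_group_star_alg l) (twisted_group_alg l)"
  by (simp add: star_iso_def star_hom_def bij_betw_def)

lemma graded_cstar_algebra_twisted_group: "graded_cstar_algebra (twisted_group_alg l)"
proof -
  let ?S = "twisted_group_star_alg l" and ?A = "twisted_group_alg l"
  have star: "star_algebra ?A"
    using star_algebra_twisted_group star_iso_twisted_group by (rule star_algebra_transport) simp
  have norm: "cstar_seminorm ?S (max_cstar_seminorm ?S {})"
    using star_algebra_twisted_group bdd_twisted_group_seminorms by (rule cstar_seminorm_max)
  have "cstar_algebra ?A"
    using star
  proof (rule cstar_algebra_function_algebra[where I = "Z2_pow l"])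
    show "function_algebra ?A (Z2_pow l)"
      using function_algebra_twisted_group[of l] by (simp add: function_algebra_def)
    show "cstar_seminorm ?A (anorm ?A)"
      using norm by (simp add: cstar_seminorm_def)
    fix x i assume x: "x \<in> car ?A"
    have "cmod (x i) \<le> twisted_op_norm l x" using x twisted_op_norm(2) by simp
    also have "\<dots> \<le> anorm ?A x"
      unfolding twisted_group_alg_simps max_cstar_seminorm_eq
      using bdd_twisted_group_seminorms x twisted_op_norm(1)
      by (intro cSUP_upper[where f = "\<lambda>p. p x"]) (simp_all add: cstar_seminorms_vanishing_def)
    finally show "cmod (x i) \<le> anorm ?A x" .
  qed
  then interpret cstar_algebra ?A .
  have mult: "grade ?A (amult ?A x y) = amult ?A (grade ?A x) (grade ?A y)" for x y
  proof
    fix k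
    \<comment> \<open>\<open>delta\<close> is additive and k is the sum of m and m + k, so each term
      of the convolution carries the signs of its two factors.\<close>
    have s: "sign_bit (delta l k) = sign_bit (delta l m) * sign_bit (delta l (Z2_add m k))" for m
      by (simp add: delta_add sign_bit_add sign_bit_sq flip: mult.assoc)
    have e: "sign_bit (delta l k) * (cocycle l m (Z2_add m k) * x m * y (Z2_add m k))
      = cocycle l m (Z2_add m k) * (sign_bit (delta l m) * x m)
        * (sign_bit (delta l (Z2_add m k)) * y (Z2_add m k))" for m
      by (subst s[of m]) (simp add: mult_ac)
    then show "grade ?A (amult ?A x y) k = amult ?A (grade ?A x) (grade ?A y) k"
      by (simp add: twisted_group_star_alg_def sum_distrib_left e)
  qed
  have "star_hom (grade ?A) ?A ?A"
    unfolding star_hom_def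
  proof (intro conjI ballI allI)
    fix x y assume "x \<in> car ?A" "y \<in> car ?A"
    show "grade ?A (amult ?A x y) = amult ?A (grade ?A x) (grade ?A y)" by (rule mult)
  qed (auto simp: twisted_group_star_alg_def algebra_simps)
  moreover have gg: "grade ?A (grade ?A x) = x" for x
    by (simp add: sign_bit_sq flip: mult.assoc)
  moreover have "bij_betw (grade ?A) (car ?A) (car ?A)"
    by (rule bij_betw_byWitness[where f' = "grade ?A"])
      (use gg in \<open>auto simp: twisted_group_star_alg_def\<close>)
  ultimately show ?thesis
    by unfold_locales (auto simp: star_iso_def)
qed

section \<open>The free *-algebra and its quotient\<close>

definition word_star :: "('g \<times> bool) list \<Rightarrow> ('g \<times> bool) list" where
  "word_star w = rev (map (apsnd Not) w)"

lemma word_star_star [simp]: "word_star (word_star w) = w"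
  by (auto simp: word_star_def rev_map intro!: map_idI)

lemma word_star_Nil_iff [simp]: "word_star w = [] \<longleftrightarrow> w = []"
  by (simp add: word_star_def)

lemma fst_set_word_star [simp]: "fst ` set (word_star w) = fst ` set w"
  by (force simp: word_star_def)

definition words :: "'g set \<Rightarrow> ('g \<times> bool) list set" where
  "words G = {w. w \<noteq> [] \<and> fst ` set w \<subseteq> G}"

lemma words_word_star [simp]: "word_star w \<in> words G \<longleftrightarrow> w \<in> words G"
  by (simp add: words_def)

lemma free_star_alg_simps:
  "f \<in> car (free_star_alg G) \<longleftrightarrow> finite {w. f w \<noteq> 0} \<and> (\<forall>w. f w \<noteq> 0 \<longrightarrow> w \<in> words G)"
  "azero (free_star_alg G) = (\<lambda>_. 0)"
  "aadd (free_star_alg G) = (\<lambda>f g w. f w + g w)"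
  "ascale (free_star_alg G) = (\<lambda>c f w. c * f w)"
  "amult (free_star_alg G) = (\<lambda>f g w. \<Sum>k\<le>length w. f (take k w) * g (drop k w))"
  "astar (free_star_alg G) = (\<lambda>f w. cnj (f (word_star w)))"
  by (simp_all add: free_star_alg_def words_def word_star_def)

text \<open>Two ways to cut a word into three pieces: at k and then at j inside the prefix, or at j
  and then after i further letters. This is associativity of the product of the free
  algebra.\<close>

lemma sum_triangle_shift:
  fixes a :: "nat \<Rightarrow> nat \<Rightarrow> 'a::comm_monoid_add"
  shows "(\<Sum>k\<le>n. \<Sum>j\<le>k. a j k) = (\<Sum>j\<le>n. \<Sum>i\<le>n - j. a j (j + i))"
proof -
  have "(\<Sum>(k, j)\<in>(SIGMA k:{..n}. {..k}). a j k) = (\<Sum>(j, i)\<in>(SIGMA j:{..n}. {..n - j}). a j (j + i))"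
    by (rule sum.reindex_bij_witness[where i = "\<lambda>(j, i). (j + i, j)" and j = "\<lambda>(k, j). (j, k - j)"])
      auto
  then show ?thesis by (simp add: sum.Sigma)
qed

lemma star_algebra_free: "star_algebra (free_star_alg G)"
proof
  let ?F = "free_star_alg G"
  note F = free_star_alg_simps
  fix f g h :: "'a star_poly" and c d :: complex
  show "azero ?F \<in> car ?F" by (simp add: F)
  show "aadd ?F f g \<in> car ?F" if "f \<in> car ?F" "g \<in> car ?F"
  proof -
    have "{w. f w + g w \<noteq> 0} \<subseteq> {w. f w \<noteq> 0} \<union> {w. g w \<noteq> 0}" by auto
    moreover have "f w \<noteq> 0 \<or> g w \<noteq> 0" if "f w + g w \<noteq> 0" for w using that by auto
    ultimately show ?thesis using that finite_subset by (fastforce simp: F)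
  qed
  show "ascale ?F c f \<in> car ?F" if "f \<in> car ?F"
    using that by (auto simp: F elim: rev_finite_subset)
  show "amult ?F f g \<in> car ?F" if "f \<in> car ?F" "g \<in> car ?F"
  proof -
    have *: "\<exists>u v. w = u @ v \<and> f u \<noteq> 0 \<and> g v \<noteq> 0" if "amult ?F f g w \<noteq> 0" for w
    proof -
      obtain k where "f (take k w) * g (drop k w) \<noteq> 0"
        using \<open>amult ?F f g w \<noteq> 0\<close> by (auto simp: F elim: sum.not_neutral_contains_not_neutral)
      then show ?thesis by (intro exI[of _ "take k w"] exI[of _ "drop k w"]) simp
    qed
    then have "{w. amult ?F f g w \<noteq> 0} \<subseteq> (\<lambda>(u, v). u @ v) ` ({w. f w \<noteq> 0} \<times> {w. g w \<noteq> 0})"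
      by fastforce
    then have "finite {w. amult ?F f g w \<noteq> 0}"
      by (rule finite_subset) (use that in \<open>simp add: F\<close>)
    moreover have "w \<in> words G" if "amult ?F f g w \<noteq> 0" for w
      using *[OF that] \<open>f \<in> car ?F\<close> \<open>g \<in> car ?F\<close> by (fastforce simp: F(1) words_def)
    ultimately show ?thesis by (simp only: F(1)) blast
  qed
  show "astar ?F f \<in> car ?F" if "f \<in> car ?F"
  proof -
    have "{w. astar ?F f w \<noteq> 0} \<subseteq> word_star ` {w. f w \<noteq> 0}"
      by (auto simp: F image_iff) (metis word_star_star)
    then have "finite {w. astar ?F f w \<noteq> 0}"
      by (rule finite_subset) (use that in \<open>simp add: F\<close>)
    then show ?thesis using that by (fastforce simp: F)
  qed
  show "amult ?F (amult ?F f g) h = amult ?F f (amult ?F g h)"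
  proof
    fix w
    have "amult ?F (amult ?F f g) h w = (\<Sum>k\<le>length w. \<Sum>j\<le>k.
        f (take j w) * g (drop j (take k w)) * h (drop k w))"
      by (auto simp: F sum_distrib_right min_def intro!: sum.cong)
    also have "\<dots> = amult ?F f (amult ?F g h) w"
      unfolding sum_triangle_shift
      by (simp add: F sum_distrib_left drop_take add.commute mult.assoc)
    finally show "amult ?F (amult ?F f g) h w = amult ?F f (amult ?F g h) w" .
  qed
  show "astar ?F (amult ?F f g) = amult ?F (astar ?F g) (astar ?F f)"
  proof
    fix w
    have "astar ?F (amult ?F f g) w
      = (\<Sum>k\<le>length w. cnj (f (word_star (drop (length w - k) w))) * cnj (g (word_star (take (length w - k) w))))"
      by (simp add: F) (simp add: word_star_def take_rev drop_rev take_map drop_map)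
    also have "\<dots> = (\<Sum>k\<le>length w. cnj (f (word_star (drop k w))) * cnj (g (word_star (take k w))))"
      by (rule sum.reindex_bij_witness[where i = "\<lambda>k. length w - k" and j = "\<lambda>k. length w - k"]) auto
    also have "\<dots> = amult ?F (astar ?F g) (astar ?F f) w"
      by (simp add: F mult.commute)
    finally show "astar ?F (amult ?F f g) w = amult ?F (astar ?F g) (astar ?F f) w" .
  qed
qed (simp_all add: free_star_alg_simps adiff_def algebra_simps sum.distrib sum_distrib_left fun_eq_iff)

lemma free_star_alg_unit: "w \<in> words G \<Longrightarrow> unit_at w \<in> car (free_star_alg G)"
  by (simp add: free_star_alg_simps unit_at_def)

lemma free_star_alg_mult_unit:
  "amult (free_star_alg G) (unit_at u) (unit_at v) = unit_at (u @ v)"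
proof
  fix w
  have "unit_at u (take k w) * unit_at v (drop k w)
    = (if k = length u then unit_at (u @ v) w else 0)" if "k \<le> length w" for k
  proof (cases "k = length u")
    case True
    then show ?thesis by (simp add: unit_at_def) (metis append_eq_conv_conj append_take_drop_id)
  next
    case False
    then have "take k w \<noteq> u" using that by auto
    then show ?thesis using False by (simp add: unit_at_def)
  qed
  then have "(\<Sum>k\<le>length w. unit_at u (take k w) * unit_at v (drop k w))
    = (\<Sum>k\<le>length w. if k = length u then unit_at (u @ v) w else 0)"
    by (intro sum.cong refl) simp
  also have "\<dots> = unit_at (u @ v) w"
    by simp (simp add: unit_at_def)
  finally show "amult (free_star_alg G) (unit_at u) (unit_at v) w = unit_at (u @ v) w"
    by (simp add: free_star_alg_simps)
qed

lemma free_star_alg_star_unit: "astar (free_star_alg G) (unit_at w) = unit_at (word_star w)"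
  by (auto simp: free_star_alg_simps unit_at_def fun_eq_iff)

lemma free_star_alg_induct [consumes 1, case_names zero add]:
  assumes f: "f \<in> car (free_star_alg G)"
    and zero: "P (azero (free_star_alg G))"
    and add: "\<And>f c w. \<lbrakk>f \<in> car (free_star_alg G); w \<in> words G; P f\<rbrakk>
      \<Longrightarrow> P (aadd (free_star_alg G) f (ascale (free_star_alg G) c (unit_at w)))"
  shows "P f"
proof -
  have "finite {w. f w \<noteq> 0}" and G: "\<And>w. f w \<noteq> 0 \<Longrightarrow> w \<in> words G"
    using f by (auto simp: free_star_alg_simps)
  show ?thesis
  proof (rule finite_support_induct[where x = f and S = "{w. f w \<noteq> 0}"])
    show "P (\<lambda>_. 0)" using zero by (simp add: free_star_alg_simps)
    fix g c w
    assume w: "w \<in> {w. f w \<noteq> 0}" and g: "\<And>v. g v \<noteq> 0 \<Longrightarrow> v \<in> {w. f w \<noteq> 0}" and "P g"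
    have "finite {v. g v \<noteq> 0}"
      using g \<open>finite {w. f w \<noteq> 0}\<close> by (rule_tac finite_subset[of _ "{w. f w \<noteq> 0}"]) auto
    then have "g \<in> car (free_star_alg G)" using g G by (simp add: free_star_alg_simps)
    with w \<open>P g\<close> G add[of g w c] show "P (\<lambda>j. g j + c * unit_at w j)"
      by (simp add: free_star_alg_simps)
  qed (use \<open>finite {w. f w \<noteq> 0}\<close> in simp_all)
qed

section \<open>Normal forms of words modulo the relations\<close>

fun word_elt :: "((nat \<Rightarrow> bit) \<times> bool) list \<Rightarrow> nat \<Rightarrow> bit" where
  "word_elt [] = Z2_zero"
| "word_elt (a # w) = Z2_add (fst a) (word_elt w)"

text \<open>Modulo the relations a word becomes its \<open>word_sign\<close> times the generator at
  its \<open>word_elt\<close>. A starred letter has the group element of the letter itself and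
  contributes c(m,m), because the adjoint of s_m is c(m,m) s_m.\<close>

fun word_sign :: "nat \<Rightarrow> ((nat \<Rightarrow> bit) \<times> bool) list \<Rightarrow> complex" where
  "word_sign l [] = 1"
| "word_sign l (a # w) = (if snd a then cocycle l (fst a) (fst a) else 1)
     * cocycle l (fst a) (word_elt w) * word_sign l w"

lemma word_elt_append: "word_elt (u @ v) = Z2_add (word_elt u) (word_elt v)"
  by (induction u) (simp_all add: Z2_add_assoc)

lemma word_sign_append:
  "word_sign l (u @ v) = word_sign l u * word_sign l v * cocycle l (word_elt u) (word_elt v)"
  by (induction u) (simp_all add: word_elt_append cocycle_simps mult_ac)

lemma cnj_word_sign [simp]: "cnj (word_sign l w) = word_sign l w"
  by (induction w) simp_all

lemma word_star_Cons: "word_star (a # w) = word_star w @ [apsnd Not a]"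
  by (simp add: word_star_def)

lemma word_elt_star: "word_elt (word_star w) = word_elt w"
  by (induction w) (simp_all add: word_star_Cons word_elt_append Z2_add_ac, simp add: word_star_def)

text \<open>For a sign c, which is real, the adjoint of c s_m is c c(m,m) s_m.\<close>

lemma word_sign_star: "word_sign l (word_star w) = word_sign l w * cocycle l (word_elt w) (word_elt w)"
proof (induction w)
  case Nil
  then show ?case by (simp add: word_star_def)
next
  case (Cons a w)
  then show ?case
    by (cases "snd a") (simp_all add: word_star_Cons word_sign_append word_elt_star cocycle_simps mult_ac)
qed

lemma word_elt_in_pow: "fst ` set w \<subseteq> Z2_pow l \<Longrightarrow> word_elt w \<in> Z2_pow l"
  by (induction w) auto

text \<open>Additivity of \<open>delta\<close> makes the letterwise sign depend on the group element
  only. Hence \<open>delta_sign\<close> lies over the grading of the twisted group algebra.\<close>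

lemma delta_word_elt: "(\<Prod>a\<leftarrow>w. sign_bit (delta l (fst a))) = sign_bit (delta l (word_elt w))"
  by (induction w) (simp_all add: delta_add sign_bit_add, simp add: delta_def Z2_zero_def sign_bit_def)

text \<open>Linear extension of the normal form of words, read coordinatewise: the *-homomorphism
  that sends each generator m to \<open>unit_at m\<close>.\<close>

definition free_eval :: "nat \<Rightarrow> (nat \<Rightarrow> bit) star_poly \<Rightarrow> (nat \<Rightarrow> bit) \<Rightarrow> complex" where
  "free_eval l f k = (\<Sum>w | f w \<noteq> 0. if word_elt w = k then word_sign l w * f w else 0)"

text \<open>Any finite set containing the support may be summed over, which brings f, g and f + g to
  one index set.\<close>

lemma free_eval_sum:
  assumes "finite S" "\<And>w. f w \<noteq> 0 \<Longrightarrow> w \<in> S"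
  shows "free_eval l f k = (\<Sum>w\<in>S. if word_elt w = k then word_sign l w * f w else 0)"
  unfolding free_eval_def using assms by (intro sum.mono_neutral_left) auto

lemma free_eval_unit:
  "free_eval l (unit_at w) = ascale (twisted_group_star_alg l) (word_sign l w) (unit_at (word_elt w))"
proof
  fix k
  show "free_eval l (unit_at w) k
    = ascale (twisted_group_star_alg l) (word_sign l w) (unit_at (word_elt w)) k"
    by (subst free_eval_sum[of "{w}"]) (auto simp: unit_at_def twisted_group_star_alg_def split: if_splits)
qed

text \<open>A linear section of \<open>free_eval\<close> by one-letter words, that is, by
  representatives in normal form.\<close>

definition free_lift :: "((nat \<Rightarrow> bit) \<Rightarrow> complex) \<Rightarrow> (nat \<Rightarrow> bit) star_poly" where
  "free_lift a w = (if \<exists>m. w = [(m, False)] then a (fst (hd w)) else 0)"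

lemma free_lift_unit: "free_lift (unit_at m) = free_gen m"
  by (auto simp: free_lift_def free_gen_def unit_at_def fun_eq_iff)

lemma singleton_in_words [simp]: "[a] \<in> words G \<longleftrightarrow> fst a \<in> G"
  by (simp add: words_def)

lemma free_gen_closed: "m \<in> G \<Longrightarrow> free_gen m \<in> car (free_star_alg G)"
  by (simp add: free_gen_def free_star_alg_unit)

section \<open>Evaluation of the free algebra and the universal seminorm\<close>

context
  fixes l :: nat
begin

private abbreviation F where "F \<equiv> free_star_alg (Z2_pow l)"
private abbreviation S where "S \<equiv> twisted_group_star_alg l"

interpretation F: star_algebra F by (rule star_algebra_free)
interpretation S: star_algebra S by (rule star_algebra_twisted_group)

lemma free_eval_zero: "free_eval l (azero F) = azero S"
  by (auto simp: free_eval_def free_star_alg_simps twisted_group_star_alg_def)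

lemma free_eval_closed:
  assumes "f \<in> car F"
  shows "free_eval l f \<in> car S"
proof -
  have "\<exists>w. f w \<noteq> 0 \<and> word_elt w = k" if "free_eval l f k \<noteq> 0" for k
    using that unfolding free_eval_def
    by (elim sum.not_neutral_contains_not_neutral) (auto split: if_splits)
  then show ?thesis
    using assms word_elt_in_pow by (fastforce simp: twisted_group_star_alg_def free_star_alg_simps words_def)
qed

lemma free_eval_add:
  assumes "f \<in> car F" "g \<in> car F"
  shows "free_eval l (aadd F f g) = aadd S (free_eval l f) (free_eval l g)"
proof
  fix k
  let ?W = "{w. f w \<noteq> 0} \<union> {w. g w \<noteq> 0}"
  have fin: "finite ?W" using assms by (simp add: free_star_alg_simps)
  have "free_eval l (aadd F f g) k = (\<Sum>w\<in>?W. if word_elt w = k then word_sign l w * aadd F f g w else 0)"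
    using fin by (rule free_eval_sum) (auto simp: free_star_alg_simps)
  also have "\<dots> = (\<Sum>w\<in>?W. if word_elt w = k then word_sign l w * f w else 0)
      + (\<Sum>w\<in>?W. if word_elt w = k then word_sign l w * g w else 0)"
    unfolding sum.distrib[symmetric]
    by (intro sum.cong refl) (simp add: free_star_alg_simps distrib_left)
  also have "\<dots> = free_eval l f k + free_eval l g k"
    by (subst (1 2) free_eval_sum[OF fin]) auto
  finally show "free_eval l (aadd F f g) k = aadd S (free_eval l f) (free_eval l g) k"
    by (simp add: twisted_group_star_alg_def)
qed

lemma free_eval_scale:
  assumes "f \<in> car F"
  shows "free_eval l (ascale F c f) = ascale S c (free_eval l f)"
proof
  fix k
  have "free_eval l (ascale F c f) k
    = (\<Sum>w | f w \<noteq> 0. if word_elt w = k then word_sign l w * ascale F c f w else 0)"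
    using assms by (intro free_eval_sum) (auto simp: free_star_alg_simps)
  then show "free_eval l (ascale F c f) k = ascale S c (free_eval l f) k"
    by (simp add: free_eval_def free_star_alg_simps twisted_group_star_alg_def sum_distrib_left
        if_distrib mult_ac cong: if_cong)
qed

lemma unit_word_closed: "w \<in> words (Z2_pow l) \<Longrightarrow> unit_at (word_elt w) \<in> car S"
  by (intro function_algebra_unit[OF function_algebra_twisted_group] word_elt_in_pow)
    (simp add: words_def)

text \<open>Bilinearity allows induction on one argument at a time. For two words the cocycle in
  \<open>word_sign_append\<close> is the factor produced by multiplying two basis vectors.\<close>

lemma free_eval_mult:
  assumes f: "f \<in> car F" and g: "g \<in> car F"
  shows "free_eval l (amult F f g) = amult S (free_eval l f) (free_eval l g)"
proof -
  note cl = F.closed S.closed free_eval_closed free_star_alg_unit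
  note lin = free_eval_add free_eval_scale F.mult_add_left F.mult_scale_left S.mult_add_left
    S.mult_scale_left F.mult_add_right F.mult_scale_right S.mult_add_right S.mult_scale_right
  have zero: "amult F (azero F) h = azero F" "amult F h (azero F) = azero F"
    "amult S (azero S) y = azero S" "amult S y (azero S) = azero S" for h y
    by (simp_all add: free_star_alg_simps twisted_group_star_alg_def)
  have uv: "free_eval l (amult F (unit_at u) (unit_at v))
    = amult S (free_eval l (unit_at u)) (free_eval l (unit_at v))"
    if "u \<in> words (Z2_pow l)" "v \<in> words (Z2_pow l)" for u v
  proof -
    have uv: "word_elt u \<in> Z2_pow l" "word_elt v \<in> Z2_pow l"
      using that by (auto simp: words_def intro!: word_elt_in_pow)
    then have "unit_at (Z2_add (word_elt u) (word_elt v)) \<in> car S"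
      by (intro function_algebra_unit[OF function_algebra_twisted_group] Z2_add_in_pow)
    then show ?thesis
      using unit_word_closed[OF that(1)] unit_word_closed[OF that(2)] uv
      by (simp add: free_star_alg_mult_unit free_eval_unit word_sign_append word_elt_append
          S.mult_scale_left S.mult_scale_right S.closed twisted_group_mult_unit S.scale_scale mult_ac)
  qed
  have u: "free_eval l (amult F (unit_at u) g) = amult S (free_eval l (unit_at u)) (free_eval l g)"
    if "u \<in> words (Z2_pow l)" for u
    using g that by (induction g rule: free_star_alg_induct) (simp_all add: zero free_eval_zero lin cl uv)
  show ?thesis
    using f g by (induction f rule: free_star_alg_induct) (simp_all add: zero free_eval_zero lin cl u)
qed

lemma free_eval_star:
  assumes f: "f \<in> car F"
  shows "free_eval l (astar F f) = astar S (free_eval l f)"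
proof -
  note cl = F.closed S.closed free_eval_closed free_star_alg_unit
  have zero: "astar F (azero F) = azero F" "astar S (azero S) = azero S"
    by (simp_all add: free_star_alg_simps twisted_group_star_alg_def)
  have "free_eval l (astar F (unit_at w)) = astar S (free_eval l (unit_at w))"
    if "w \<in> words (Z2_pow l)" for w
    using unit_word_closed[OF that]
    by (simp add: free_star_alg_star_unit free_eval_unit word_sign_star word_elt_star S.star_scale
        twisted_group_star_unit S.scale_scale mult_ac)
  with f show ?thesis
    by (induction f rule: free_star_alg_induct)
      (simp_all add: zero free_eval_zero free_eval_add free_eval_scale F.star_add F.star_scale
        S.star_add S.star_scale cl)
qed

lemma star_hom_free_eval: "star_hom (free_eval l) F S"
  by (simp add: star_hom_def free_eval_closed free_eval_add free_eval_scale free_eval_mult free_eval_star)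

private abbreviation R where "R \<equiv> twisted_relations l"

lemma free_lift_closed:
  assumes "a \<in> car S"
  shows "free_lift a \<in> car F"
proof -
  have a: "\<exists>m. w = [(m, False)] \<and> m \<in> Z2_pow l" if "free_lift a w \<noteq> 0" for w
    using that assms by (auto simp: free_lift_def twisted_group_star_alg_def split: if_splits)
  then have "{w. free_lift a w \<noteq> 0} \<subseteq> (\<lambda>m. [(m, False)]) ` Z2_pow l" by blast
  then have "finite {w. free_lift a w \<noteq> 0}" by (rule finite_subset) simp
  then show ?thesis using a by (fastforce simp: free_star_alg_simps)
qed

lemma free_eval_lift:
  assumes "a \<in> car S"
  shows "free_eval l (free_lift a) = a"
proof
  fix k
  let ?W = "(\<lambda>m. [(m, False)]) ` Z2_pow l"
  have "free_eval l (free_lift a) k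
    = (\<Sum>w\<in>?W. if word_elt w = k then word_sign l w * free_lift a w else 0)"
    using assms
    by (intro free_eval_sum)
      (auto simp: free_lift_def twisted_group_star_alg_def split: if_splits)
  also have "\<dots> = (\<Sum>m\<in>Z2_pow l. if m = k then a m else 0)"
    by (subst sum.reindex) (auto simp: inj_on_def free_lift_def intro!: sum.cong)
  also have "\<dots> = a k"
    using assms by (auto simp: twisted_group_star_alg_def)
  finally show "free_eval l (free_lift a) k = a k" .
qed

lemma free_eval_gen: "free_eval l (free_gen m) = unit_at m"
  by (simp add: free_gen_def free_eval_unit) (simp add: twisted_group_star_alg_def)

lemma twisted_relations_closed: "R \<subseteq> car F"
  by (auto simp: twisted_relations_def Let_def free_gen_closed intro!: F.closed)

lemma free_eval_relation:
  assumes "r \<in> R"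
  shows "free_eval l r = azero S"
proof -
  have u: "unit_at m \<in> car S" if "m \<in> Z2_pow l" for m
    using function_algebra_unit[OF function_algebra_twisted_group that] .
  have diff: "free_eval l (adiff F x y) = azero S"
    if "x \<in> car F" "y \<in> car F" "free_eval l x = free_eval l y" for x y
    using F.hom_diff[OF star_hom_free_eval that(1,2)] that S.diff_self[OF free_eval_closed[OF that(2)]]
    by simp
  show ?thesis
    using assms unfolding twisted_relations_def Let_def
    by (auto intro!: diff F.closed free_gen_closed
        simp: free_eval_mult free_eval_star free_eval_scale free_eval_gen free_gen_closed F.closed
          twisted_group_mult_unit twisted_group_star_unit S.mult_scale_left S.mult_scale_right
          S.scale_scale S.scale_one S.closed u Z2_add_self cocycle_sq)
qed

lemma twisted_relations_cases:
  "adiff F (astar F (free_gen Z2_zero)) (free_gen Z2_zero) \<in> R"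
  "m \<in> Z2_pow l \<Longrightarrow> n \<in> Z2_pow l \<Longrightarrow> adiff F (amult F (free_gen m) (free_gen n))
    (ascale F (cocycle l m n) (free_gen (Z2_add m n))) \<in> R"
  "m \<in> Z2_pow l \<Longrightarrow> adiff F (amult F (astar F (free_gen m)) (free_gen m)) (free_gen Z2_zero) \<in> R"
  by (auto simp: twisted_relations_def Let_def)

text \<open>Modulo the kernel of p every element is congruent to \<open>free_lift\<close> of its
  evaluation, so p is a function of the evaluation.\<close>

lemma twisted_seminorm_fibre:
  assumes p: "p \<in> cstar_seminorms_vanishing F R"
    and xy: "x \<in> car F" "y \<in> car F" "free_eval l x = free_eval l y"
  shows "p x = p y"
proof -
  have pc: "cstar_seminorm F p" and pR: "\<And>r. r \<in> R \<Longrightarrow> p r = 0"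
    using p by (auto simp: cstar_seminorms_vanishing_def)
  note ctxt = star_algebra_free[of "Z2_pow l"] pc
  note trans' [trans] = seminorm_equiv_trans[OF ctxt]
  let ?eq = "seminorm_equiv F p" and ?g = "free_gen :: _ \<Rightarrow> (nat \<Rightarrow> bit) star_poly"
  note g = free_gen_closed[of _ "Z2_pow l"]
  note refl = seminorm_equiv_refl[OF ctxt] and sym = seminorm_equiv_sym[OF ctxt]
    and add = seminorm_equiv_add[OF ctxt] and mult = seminorm_equiv_mult[OF ctxt]
    and scale = seminorm_equiv_scale[OF ctxt] and star = seminorm_equiv_star[OF ctxt]
  have rel: "?eq a b" if "adiff F a b \<in> R" "a \<in> car F" "b \<in> car F" for a b
    using pR that by (simp add: seminorm_equiv_def)
  have gg: "?eq (amult F (?g m) (?g n)) (ascale F (cocycle l m n) (?g (Z2_add m n)))"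
    if "m \<in> Z2_pow l" "n \<in> Z2_pow l" for m n
    using that by (intro rel twisted_relations_cases F.closed g Z2_add_in_pow)
  \<comment> \<open>No relation gives the adjoint t of s_m outright. From s_m = s_0 s_m and
    self-adjointness of s_0 one gets t = t s_0; replacing s_0 by c(m,m) s_m s_m and using t s_m =
    s_0 leaves c(m,m) s_m.\<close>
  have gs: "?eq (astar F (?g m)) (ascale F (cocycle l m m) (?g m))" if m: "m \<in> Z2_pow l" for m
  proof -
    let ?c = "cocycle l m m" and ?s = "astar F (?g m)" and ?e = "?g Z2_zero"
    have e: "?e \<in> car F" and gm: "?g m \<in> car F" using m by (simp_all add: g)
    have "?eq (?g m) (amult F ?e (?g m))"
      using sym[OF gg[of Z2_zero m]] m gm by (simp add: F.scale_one)
    then have "?eq ?s (amult F ?s (astar F ?e))"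
      using star e gm by (fastforce simp: F.star_mult)
    also have "?eq \<dots> (amult F ?s ?e)"
      using e gm by (intro mult refl rel twisted_relations_cases F.closed)
    also have "?eq \<dots> (amult F ?s (ascale F ?c (amult F (?g m) (?g m))))"
      using scale[OF sym[OF gg[OF m m]], of ?c] e gm
      by (intro mult refl F.closed) (simp_all add: F.scale_scale cocycle_sq Z2_add_self F.scale_one)
    also have "amult F ?s (ascale F ?c (amult F (?g m) (?g m)))
        = ascale F ?c (amult F (amult F ?s (?g m)) (?g m))"
      using gm by (simp add: F.mult_scale_right F.mult_assoc F.closed)
    also have "?eq \<dots> (ascale F ?c (amult F ?e (?g m)))"
      using e gm m by (intro scale mult refl rel twisted_relations_cases F.closed)
    also have "?eq \<dots> (ascale F ?c (?g m))"
      using gg[of Z2_zero m] m gm by (intro scale) (simp add: F.scale_one)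
    finally show ?thesis .
  qed
  have word: "?eq (unit_at w) (ascale F (word_sign l w) (?g (word_elt w)))"
    if "w \<in> words (Z2_pow l)" for w
    using that
  proof (induction w)
    case Nil
    then show ?case by (simp add: words_def)
  next
    case (Cons a w)
    obtain m b where a: "a = (m, b)" by (cases a)
    then have m: "m \<in> Z2_pow l" using Cons.prems by (simp add: words_def)
    let ?t = "if b then cocycle l m m else 1"
    have letter: "?eq (unit_at [a]) (ascale F ?t (?g m))"
    proof (cases b)
      case True
      have "unit_at [a] = astar F (?g m)"
        using True a by (simp add: free_gen_def free_star_alg_star_unit word_star_def)
      then show ?thesis using gs[OF m] True by simp
    next
      case False
      then show ?thesis using a m by (simp add: F.scale_one g refl flip: free_gen_def)
    qed
    show ?case
    proof (cases "w = []")
      \<comment> \<open>One-letter words are the true base case: their tail is the empty word, which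
        does not belong to the non-unital free algebra.\<close>
      case True
      then show ?thesis using letter a by (cases b) simp_all
    next
      case False
      then have w: "w \<in> words (Z2_pow l)" using Cons.prems by (simp add: words_def)
      then have n: "word_elt w \<in> Z2_pow l" by (intro word_elt_in_pow) (simp add: words_def)
      have "?eq (unit_at (a # w))
          (amult F (ascale F ?t (?g m)) (ascale F (word_sign l w) (?g (word_elt w))))"
        using mult[OF letter Cons.IH[OF w]] by (simp add: free_star_alg_mult_unit)
      also have "amult F (ascale F ?t (?g m)) (ascale F (word_sign l w) (?g (word_elt w)))
          = ascale F (?t * word_sign l w) (amult F (?g m) (?g (word_elt w)))"
        using m n by (simp add: F.mult_scale_left F.mult_scale_right F.scale_scale F.closed g
            mult.commute)
      also have "?eq \<dots> (ascale F (?t * word_sign l w)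
          (ascale F (cocycle l m (word_elt w)) (?g (Z2_add m (word_elt w)))))"
        using m n by (intro scale gg)
      also have "\<dots> = ascale F (word_sign l (a # w)) (?g (word_elt (a # w)))"
        using m n a by (simp add: F.scale_scale g mult_ac)
      finally show ?thesis .
    qed
  qed
  have lift: "?eq x (free_lift (free_eval l x))" if "x \<in> car F" for x
    using that
  proof (induction rule: free_star_alg_induct)
    case zero
    have "free_lift (azero S) = azero F"
      by (auto simp: free_lift_def free_star_alg_simps twisted_group_star_alg_def)
    then show ?case by (simp add: free_eval_zero refl F.closed)
  next
    case (add f c w)
    have u: "unit_at w \<in> car F" using add by (simp add: free_star_alg_unit)
    have "free_lift (free_eval l (aadd F f (ascale F c (unit_at w))))
      = aadd F (free_lift (free_eval l f)) (ascale F c (ascale F (word_sign l w) (?g (word_elt w))))"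
      using add u by (simp add: free_eval_add free_eval_scale F.closed free_eval_unit flip: free_lift_unit)
        (auto simp: free_lift_def free_star_alg_simps twisted_group_star_alg_def fun_eq_iff)
    then show ?case
      using add word by (simp add: seminorm_equiv_add[OF ctxt] scale)
  qed
  show ?thesis
    using seminorm_equiv_eq[OF ctxt lift] xy by metis
qed

lemma universal_seminorm_twisted:
  assumes "x \<in> car F"
  shows "universal_seminorm (Z2_pow l) R x = max_cstar_seminorm S {} (free_eval l x)"
  unfolding universal_seminorm_def
proof (rule max_cstar_seminorm_transfer[OF star_algebra_free star_hom_free_eval])
  show "free_eval l ` car F = car S"
    using free_eval_closed free_lift_closed free_eval_lift by (auto simp: image_iff) metis
  show "free_eval l r = ascale S 0 (free_eval l r)" if "r \<in> R" for r
    using free_eval_relation[OF that] by (simp add: twisted_group_star_alg_def)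
qed (use twisted_relations_closed twisted_seminorm_fibre assms in auto)

section \<open>The completion and its grading\<close>

private abbreviation A where "A \<equiv> twisted_group_alg l"
private abbreviation p where "p \<equiv> universal_seminorm (Z2_pow l) (twisted_relations l)"

interpretation A: graded_cstar_algebra A by (rule graded_cstar_algebra_twisted_group)

private lemma surj: "free_eval l ` car F = car A"
  using free_eval_closed free_lift_closed free_eval_lift
  by (auto simp: image_iff) metis

private lemma hom: "star_hom (free_eval l) F A"
  using star_hom_free_eval by (simp add: star_hom_def)

private lemmas quotient = F.star_algebra_axioms A.cstar_algebra_axioms hom surj
  universal_seminorm_twisted[folded twisted_group_alg_simps]

definition twisted_iso :: "((nat \<Rightarrow> bit) \<Rightarrow> complex) \<Rightarrow> (nat \<Rightarrow> (nat \<Rightarrow> bit) star_poly) set" where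
  "twisted_iso = limit_class F A (free_eval l)"

lemma twisted_cstar_simps [simp]:
  "car (twisted_cstar l) = car (completion F p)"
  "azero (twisted_cstar l) = azero (completion F p)"
  "aadd (twisted_cstar l) = aadd (completion F p)"
  "ascale (twisted_cstar l) = ascale (completion F p)"
  "amult (twisted_cstar l) = amult (completion F p)"
  "astar (twisted_cstar l) = astar (completion F p)"
  "anorm (twisted_cstar l) = anorm (completion F p)"
  "grade (twisted_cstar l) = alpha_delta l"
  by (simp_all add: twisted_cstar_def universal_cstar_def cstar_alg.defs graded_cstar_alg.defs)

lemma delta_sign_closed: "f \<in> car F \<Longrightarrow> delta_sign l f \<in> car F"
  by (auto simp: free_star_alg_simps delta_sign_def elim: rev_finite_subset)

lemma free_eval_delta_sign:
  assumes "f \<in> car F"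
  shows "free_eval l (delta_sign l f) = grade A (free_eval l f)"
proof
  fix k
  have "free_eval l (delta_sign l f) k
    = (\<Sum>w | f w \<noteq> 0. if word_elt w = k then word_sign l w * delta_sign l f w else 0)"
    using assms by (intro free_eval_sum) (auto simp: free_star_alg_simps delta_sign_def)
  also have "\<dots> = (\<Sum>w | f w \<noteq> 0. sign_bit (delta l k) * (if word_elt w = k then word_sign l w * f w else 0))"
    by (intro sum.cong refl) (auto simp: delta_sign_def delta_word_elt)
  finally show "free_eval l (delta_sign l f) k = grade A (free_eval l f) k"
    by (simp add: free_eval_def sum_distrib_left)
qed

text \<open>The grading is an automorphism of the *-algebra and so permutes the seminorms over which
  the supremum is taken.\<close>

lemma norm_grade_twisted_group: "x \<in> car A \<Longrightarrow> anorm A (grade A x) = anorm A x"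
proof -
  assume x: "x \<in> car A"
  have h: "star_hom (grade A) S S" and im: "grade A ` car S = car S" and inj: "inj_on (grade A) (car S)"
    using A.grade_automorphism by (auto simp: star_iso_def star_hom_def bij_betw_def)
  have "max_cstar_seminorm S {} x = max_cstar_seminorm S {} (grade A x)"
    using x inj
    by (intro max_cstar_seminorm_transfer[OF star_algebra_twisted_group h im]) (auto dest: inj_onD)
  then show ?thesis by simp
qed

lemma grade_twisted_iso:
  assumes "a \<in> car A"
  shows "grade (twisted_cstar l) (twisted_iso a) = twisted_iso (grade A a)"
  unfolding twisted_iso_def twisted_cstar_simps alpha_delta_def
  using A.grade_automorphism assms
  by (intro completion_map_isometry[OF quotient])
    (simp_all only: star_iso_def norm_grade_twisted_group delta_sign_closed free_eval_delta_sign)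

lemma graded_iso_twisted: "graded_iso twisted_iso A (twisted_cstar l)"
  using star_iso_completion[OF quotient] grade_twisted_iso
  by (simp add: graded_iso_def star_iso_def star_hom_def flip: twisted_iso_def)

lemma graded_cstar_algebra_twisted: "graded_cstar_algebra (twisted_cstar l)"
proof -
  have "cstar_algebra (twisted_cstar l)"
    using A.cstar_algebra_axioms
  proof (rule cstar_algebra_transport)
    show "star_iso twisted_iso A (twisted_cstar l)" using graded_iso_twisted by (simp add: graded_iso_def)
    show "twisted_iso (azero A) = azero (twisted_cstar l)"
      using completion_zero[OF quotient] by (simp add: twisted_iso_def)
    show "anorm (twisted_cstar l) (twisted_iso x) = anorm A x" if "x \<in> car A" for x
      using completion_norm[OF quotient that] by (simp add: twisted_iso_def)
  qed
  with graded_cstar_algebra_twisted_group show ?thesis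
    using graded_iso_twisted by (rule graded_cstar_algebra_transport)
qed

lemma grade_twisted_gen:
  assumes m: "m \<in> Z2_pow l"
  shows "grade (twisted_cstar l) (twisted_gen l m)
    = ascale (twisted_cstar l) (sign_bit (delta l m)) (twisted_gen l m)"
proof -
  have u: "unit_at m \<in> car A"
    using function_algebra_unit[OF function_algebra_twisted_group m] by simp
  \<comment> \<open>The generator is the class of a constant sequence, and \<open>free_gen m\<close>
    evaluates to \<open>unit_at m\<close>.\<close>
  have "twisted_gen l m = twisted_iso (unit_at m)"
    using seq_class_eq[OF quotient const_limit_class[OF quotient free_gen_closed[OF m]]] u
    by (simp add: twisted_gen_def universal_gen_def twisted_iso_def free_eval_gen)
  moreover have "grade A (unit_at m) = ascale A (sign_bit (delta l m)) (unit_at m)"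
    by (auto simp: twisted_group_star_alg_def unit_at_def)
  moreover have "star_hom twisted_iso A (twisted_cstar l)"
    using graded_iso_twisted by (simp only: graded_iso_def star_iso_def)
  then have "twisted_iso (ascale A (sign_bit (delta l m)) (unit_at m))
    = ascale (twisted_cstar l) (sign_bit (delta l m)) (twisted_iso (unit_at m))"
    using u by (rule star_homD(3))
  ultimately show ?thesis using grade_twisted_iso[OF u] by simp
qed

end

section \<open>Characters of $\mathbb{Z}_2^n$\<close>

text \<open>Position i of the list is paired with coordinate \<open>Suc i\<close>, as vectors in
  \<open>Z2_pow\<close> are indexed from 1. Coordinates beyond the length of w are not seen, which
  drives the inductions on n.\<close>

definition character :: "(nat \<Rightarrow> bit) \<Rightarrow> bool list \<Rightarrow> complex" where
  "character m w = (\<Prod>i<length w. if w ! i then sign_bit (m (Suc i)) else 1)"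

lemma character_Nil [simp]: "character m [] = 1"
  by (simp add: character_def)

lemma character_snoc:
  "character m (w @ [b]) = character m w * (if b then sign_bit (m (Suc (length w))) else 1)"
  by (simp add: character_def lessThan_Suc nth_append mult.commute)

lemma character_add: "character (Z2_add m k) w = character m w * character k w"
  by (simp add: character_def Z2_add_def sign_bit_add prod.distrib[symmetric] if_distrib cong: if_cong)

lemma character_upd [simp]: "length w \<le> n \<Longrightarrow> character (m(Suc n := b)) w = character m w"
  by (auto simp: character_def intro!: prod.cong)

lemma Z2_pow_0: "Z2_pow 0 = {Z2_zero}"
  by (auto simp: Z2_pow_def Z2_zero_def)

lemma Z2_pow_upd [simp]: "m \<in> Z2_pow (Suc n) \<Longrightarrow> m(Suc n := 0) \<in> Z2_pow n"
  by (auto simp: Z2_pow_def)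

lemma sum_Z2_pow_Suc:
  "(\<Sum>m\<in>Z2_pow (Suc n). f m) = (\<Sum>m\<in>Z2_pow n. f m + f (m(Suc n := 1)))"
proof -
  have "Z2_pow (Suc n) = Z2_pow n \<union> (\<lambda>m. m(Suc n := 1)) ` Z2_pow n" (is "?L = ?R")
  proof
    show "?L \<subseteq> ?R"
    proof
      fix m assume m: "m \<in> Z2_pow (Suc n)"
      show "m \<in> ?R"
      proof (cases "m (Suc n)")
        case zero
        then show ?thesis using m by (auto simp: Z2_pow_def) (metis le_Suc_eq)
      next
        case one
        then have "m = (m(Suc n := 0))(Suc n := 1)" by auto
        then show ?thesis using Z2_pow_upd[OF m] by blast
      qed
    qed
    show "?R \<subseteq> ?L" by (auto simp: Z2_pow_def)
  qed
  moreover have "Z2_pow n \<inter> (\<lambda>m. m(Suc n := 1)) ` Z2_pow n = {}"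
  proof -
    have "m (Suc n) = 0" if "m \<in> Z2_pow n" for m using that by (simp add: Z2_pow_def)
    then show ?thesis by force
  qed
  moreover have "inj_on (\<lambda>m. m(Suc n := 1)) (Z2_pow n)"
  proof (rule inj_onI)
    fix m k :: "nat \<Rightarrow> bit"
    assume mk: "m \<in> Z2_pow n" "k \<in> Z2_pow n" "m(Suc n := 1) = k(Suc n := 1)"
    then have "m i = k i" for i
      by (cases "i = Suc n") (auto simp: Z2_pow_def dest: fun_cong[of _ _ i])
    then show "m = k" by auto
  qed
  ultimately show ?thesis
    by (simp add: sum.union_disjoint sum.reindex sum.distrib)
qed

lemma finite_lists_of_length [simp]: "finite {w :: bool list. length w = n}"
  using finite_lists_length_eq[of "UNIV :: bool set" n] by simp

lemma lists_of_length_0 [simp]: "{w. length w = 0} = {[]}"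
  by auto

lemma sum_lists_of_length_Suc:
  "(\<Sum>w | length w = Suc n. f w) = (\<Sum>w | length w = n. f (w @ [False]) + f (w @ [True]))"
proof -
  have "{w. length w = Suc n}
      = (\<lambda>w. w @ [False]) ` {w. length w = n} \<union> (\<lambda>w. w @ [True]) ` {w. length w = n}"
    by (auto simp: length_Suc_conv_rev image_iff)
  moreover have "(\<lambda>w. w @ [False]) ` {w. length w = n} \<inter> (\<lambda>w. w @ [True]) ` {w. length w = n} = {}"
    by auto
  ultimately show ?thesis
    by (simp add: sum.union_disjoint sum.reindex inj_on_def sum.distrib)
qed

text \<open>Summation over the last coordinate of m contributes 2 if the last bits of w and v agree,
  and 1 - 1 = 0 otherwise; the rest is the induction hypothesis.\<close>

lemma character_orthogonal_left:
  assumes "length w = n" "length v = n"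
  shows "(\<Sum>m\<in>Z2_pow n. character m w * character m v) = (if w = v then 2 ^ n else 0)"
  using assms
proof (induction n arbitrary: w v)
  case 0
  then show ?case by (simp add: Z2_pow_0)
next
  case (Suc n)
  obtain w' b v' c where wv: "w = w' @ [b]" "v = v' @ [c]"
    using Suc.prems by (auto simp: length_Suc_conv_rev)
  then have len: "length w' = n" "length v' = n" using Suc.prems by auto
  have "m (Suc n) = 0" if "m \<in> Z2_pow n" for m using that by (simp add: Z2_pow_def)
  then have "(\<Sum>m\<in>Z2_pow (Suc n). character m w * character m v)
    = (\<Sum>m\<in>Z2_pow n. (if b = c then 2 else 0) * (character m w' * character m v'))"
    unfolding sum_Z2_pow_Suc wv
    by (intro sum.cong refl) (auto simp: character_snoc len sign_bit_def)
  also have "\<dots> = (if w = v then 2 ^ Suc n else 0)"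
    using Suc.IH[OF len] by (simp add: wv sum_distrib_left[symmetric])
  finally show ?case .
qed

text \<open>The dual computation: the last bit of w contributes 2 or 0 according to whether m and k
  agree at \<open>Suc n\<close>.\<close>

lemma character_orthogonal_right:
  assumes "m \<in> Z2_pow n" "k \<in> Z2_pow n"
  shows "(\<Sum>w | length w = n. character m w * character k w) = (if m = k then 2 ^ n else 0)"
  using assms
proof (induction n arbitrary: m k)
  case 0
  then show ?case by (simp add: Z2_pow_0)
next
  case (Suc n)
  let ?m = "m(Suc n := 0)" and ?k = "k(Suc n := 0)"
  have "(\<Sum>w | length w = Suc n. character m w * character k w)
    = (\<Sum>w | length w = n. (if m (Suc n) = k (Suc n) then 2 else 0) * (character ?m w * character ?k w))"
    unfolding sum_lists_of_length_Suc
    by (intro sum.cong refl) (auto simp: character_snoc sign_bit_def)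
  also have "\<dots> = (if m (Suc n) = k (Suc n) then 2 else 0) * (if ?m = ?k then 2 ^ n else 0)"
    unfolding sum_distrib_left[symmetric] using Suc by (subst Suc.IH) auto
  also have "\<dots> = (if m = k then 2 ^ Suc n else 0)"
  proof -
    have "m = k \<longleftrightarrow> m (Suc n) = k (Suc n) \<and> ?m = ?k" by (metis fun_upd_triv fun_upd_upd)
    then show ?thesis by simp
  qed
  finally show ?case .
qed

definition fourier :: "nat \<Rightarrow> ((nat \<Rightarrow> bit) \<Rightarrow> complex) \<Rightarrow> bool list \<Rightarrow> complex" where
  "fourier n x w = (if length w = n then \<Sum>m\<in>Z2_pow n. x m * character m w else 0)"

text \<open>Characters of Z_2^n are real, so the inverse transform involves no conjugation; 2^n is
  the order of the group and the squared length of a character.\<close>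

definition fourier_inv :: "nat \<Rightarrow> (bool list \<Rightarrow> complex) \<Rightarrow> (nat \<Rightarrow> bit) \<Rightarrow> complex" where
  "fourier_inv n y m = (if m \<in> Z2_pow n then (\<Sum>w | length w = n. y w * character m w) / 2 ^ n else 0)"

lemma bij_betw_fourier:
  "bij_betw (fourier n) {x. \<forall>m. x m \<noteq> 0 \<longrightarrow> m \<in> Z2_pow n} {y. \<forall>w. y w \<noteq> 0 \<longrightarrow> length w = n}"
proof (rule bij_betw_byWitness[where f' = "fourier_inv n"])
  show "\<forall>x\<in>{x. \<forall>m. x m \<noteq> 0 \<longrightarrow> m \<in> Z2_pow n}. fourier_inv n (fourier n x) = x"
  proof (intro ballI ext)
    fix x :: "(nat \<Rightarrow> bit) \<Rightarrow> complex" and m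
    assume x: "x \<in> {x. \<forall>m. x m \<noteq> 0 \<longrightarrow> m \<in> Z2_pow n}"
    have "(\<Sum>w | length w = n. fourier n x w * character m w) = 2 ^ n * x m" if m: "m \<in> Z2_pow n"
    proof -
      have "(\<Sum>w | length w = n. fourier n x w * character m w)
        = (\<Sum>w | length w = n. \<Sum>k\<in>Z2_pow n. x k * (character k w * character m w))"
        by (intro sum.cong refl) (simp add: fourier_def sum_distrib_right mult.assoc)
      also have "\<dots> = (\<Sum>k\<in>Z2_pow n. x k * (\<Sum>w | length w = n. character k w * character m w))"
        by (subst sum.swap) (simp add: sum_distrib_left)
      also have "\<dots> = (\<Sum>k\<in>Z2_pow n. if k = m then 2 ^ n * x m else 0)"
        using m by (intro sum.cong refl) (simp add: character_orthogonal_right)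
      finally show ?thesis using m by simp
    qed
    then show "fourier_inv n (fourier n x) m = x m"
      using x by (auto simp: fourier_inv_def)
  qed
  show "\<forall>y\<in>{y. \<forall>w. y w \<noteq> 0 \<longrightarrow> length w = n}. fourier n (fourier_inv n y) = y"
  proof (intro ballI ext)
    fix y :: "bool list \<Rightarrow> complex" and v
    assume y: "y \<in> {y. \<forall>w. y w \<noteq> 0 \<longrightarrow> length w = n}"
    have "(\<Sum>m\<in>Z2_pow n. fourier_inv n y m * character m v) = y v" if v: "length v = n"
    proof -
      have "(\<Sum>m\<in>Z2_pow n. fourier_inv n y m * character m v)
        = (\<Sum>m\<in>Z2_pow n. \<Sum>w | length w = n. y w / 2 ^ n * (character m w * character m v))"
        by (intro sum.cong refl) (simp add: fourier_inv_def sum_distrib_right sum_divide_distrib mult.assoc)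
      also have "\<dots> = (\<Sum>w | length w = n. y w / 2 ^ n * (\<Sum>m\<in>Z2_pow n. character m w * character m v))"
        by (subst sum.swap) (simp add: sum_distrib_left)
      also have "\<dots> = (\<Sum>w | length w = n. if w = v then y v else 0)"
        using v by (intro sum.cong refl) (simp add: character_orthogonal_left)
      finally show ?thesis using v by simp
    qed
    then show "fourier n (fourier_inv n y) v = y v"
      using y by (auto simp: fourier_def)
  qed
qed (auto simp: fourier_def fourier_inv_def split: if_splits)

section \<open>Clifford algebras\<close>

text \<open>The image of s_m in the Clifford algebra. For n = 1 these are (1, 1) and (1, -1), the
  even unit and the odd generator of C + C.\<close>

definition clifford_basis :: "nat \<Rightarrow> (nat \<Rightarrow> bit) \<Rightarrow> bool list \<Rightarrow> complex" where
  "clifford_basis n m w = (if length w = n then character m w else 0)"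

lemma fourier_unit: "m \<in> Z2_pow n \<Longrightarrow> fourier n (unit_at m) = clifford_basis n m"
proof
  fix w
  assume m: "m \<in> Z2_pow n"
  have "(\<Sum>k\<in>Z2_pow n. unit_at m k * character k w) = (\<Sum>k\<in>Z2_pow n. if k = m then character m w else 0)"
    by (intro sum.cong refl) (auto simp: unit_at_def)
  then show "fourier n (unit_at m) w = clifford_basis n m w"
    using m by (simp add: fourier_def clifford_basis_def)
qed

text \<open>What the induction on n carries: closure, linearity and three formulas on the basis.
  Associativity and the other axioms of the graded tensor product come afterwards, by transport from
  the twisted group algebra instead of from the sign rule.\<close>

locale clifford_structure =
  fixes n :: nat and A :: "bool coord_alg"
  assumes function_algebra: "function_algebra A {w. length w = n}"
    and mult_closed: "\<lbrakk>x \<in> car A; y \<in> car A\<rbrakk> \<Longrightarrow> amult A x y \<in> car A"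
    and star_closed: "x \<in> car A \<Longrightarrow> astar A x \<in> car A"
    and grade_closed: "x \<in> car A \<Longrightarrow> grade A x \<in> car A"
    and mult_add_left: "\<lbrakk>x \<in> car A; y \<in> car A; z \<in> car A\<rbrakk>
      \<Longrightarrow> amult A (aadd A x y) z = aadd A (amult A x z) (amult A y z)"
    and mult_add_right: "\<lbrakk>x \<in> car A; y \<in> car A; z \<in> car A\<rbrakk>
      \<Longrightarrow> amult A z (aadd A x y) = aadd A (amult A z x) (amult A z y)"
    and mult_scale_left: "\<lbrakk>x \<in> car A; y \<in> car A\<rbrakk>
      \<Longrightarrow> amult A (ascale A c x) y = ascale A c (amult A x y)"
    and mult_scale_right: "\<lbrakk>x \<in> car A; y \<in> car A\<rbrakk>
      \<Longrightarrow> amult A x (ascale A c y) = ascale A c (amult A x y)"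
    and star_add: "\<lbrakk>x \<in> car A; y \<in> car A\<rbrakk>
      \<Longrightarrow> astar A (aadd A x y) = aadd A (astar A x) (astar A y)"
    and star_scale: "x \<in> car A \<Longrightarrow> astar A (ascale A c x) = ascale A (cnj c) (astar A x)"
    and grade_add: "\<lbrakk>x \<in> car A; y \<in> car A\<rbrakk>
      \<Longrightarrow> grade A (aadd A x y) = aadd A (grade A x) (grade A y)"
    and grade_scale: "x \<in> car A \<Longrightarrow> grade A (ascale A c x) = ascale A c (grade A x)"
    and mult_basis: "\<lbrakk>m \<in> Z2_pow n; k \<in> Z2_pow n\<rbrakk>
      \<Longrightarrow> amult A (clifford_basis n m) (clifford_basis n k)
        = ascale A (cocycle n m k) (clifford_basis n (Z2_add m k))"
    and star_basis: "m \<in> Z2_pow n \<Longrightarrow> astar A (clifford_basis n m)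
      = ascale A (cocycle n m m) (clifford_basis n m)"
    and grade_basis: "m \<in> Z2_pow n \<Longrightarrow> grade A (clifford_basis n m)
      = ascale A (sign_bit (delta n m)) (clifford_basis n m)"
begin

lemma car_iff: "x \<in> car A \<longleftrightarrow> (\<forall>w. x w \<noteq> 0 \<longrightarrow> length w = n)"
  using function_algebra by (simp add: function_algebra_def)

lemma zero_eq: "azero A = (\<lambda>_. 0)"
  using function_algebra by (simp add: function_algebra_def)

lemma add_eq: "aadd A x y = (\<lambda>w. x w + y w)"
  using function_algebra by (simp add: function_algebra_def)

lemma scale_eq: "ascale A c x = (\<lambda>w. c * x w)"
  using function_algebra by (simp add: function_algebra_def)

lemma add_closed: "x \<in> car A \<Longrightarrow> y \<in> car A \<Longrightarrow> aadd A x y \<in> car A"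
  by (auto simp: car_iff add_eq) (metis add.right_neutral)

lemma scale_closed: "x \<in> car A \<Longrightarrow> ascale A c x \<in> car A"
  by (auto simp: car_iff scale_eq)

lemma zero_closed: "azero A \<in> car A"
  by (simp add: car_iff zero_eq)

lemma basis_closed: "clifford_basis n m \<in> car A"
  by (simp add: car_iff clifford_basis_def)

lemma unit_closed_iff: "unit_at w \<in> car A \<longleftrightarrow> length w = n"
  by (auto simp: car_iff unit_at_def)

lemmas closed = add_closed scale_closed mult_closed star_closed grade_closed zero_closed basis_closed

lemma scale_scale: "ascale A c (ascale A d x) = ascale A (c * d) x"
  by (simp add: scale_eq mult.assoc)

lemma scale_zero: "ascale A 0 x = azero A"
  by (simp add: scale_eq zero_eq)

lemma zero_maps:
  "x \<in> car A \<Longrightarrow> amult A (azero A) x = azero A" "x \<in> car A \<Longrightarrow> amult A x (azero A) = azero A"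
  "astar A (azero A) = azero A" "grade A (azero A) = azero A"
  using mult_scale_left[OF zero_closed, of x 0] mult_scale_right[OF _ zero_closed, of x 0]
    star_scale[OF zero_closed, of 0] grade_scale[OF zero_closed, of 0]
  by (simp_all add: scale_zero)

lemma graded_iso_fourier: "graded_iso (fourier n) (twisted_group_alg n) A"
proof -
  let ?S = "twisted_group_star_alg n" and ?f = "fourier n"
  interpret S: star_algebra ?S by (rule star_algebra_twisted_group)
  note fS = function_algebra_twisted_group[of n]
  have carS: "car ?S = {x. \<forall>m. x m \<noteq> 0 \<longrightarrow> m \<in> Z2_pow n}" by (simp add: twisted_group_star_alg_def)
  have carA: "car A = {y. \<forall>w. y w \<noteq> 0 \<longrightarrow> length w = n}" by (auto simp: car_iff)
  have bij: "bij_betw ?f (car ?S) (car A)" unfolding carS carA by (rule bij_betw_fourier)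
  have cl: "?f x \<in> car A" for x by (simp add: car_iff fourier_def)
  have zero: "?f (azero ?S) = azero A"
    by (auto simp: fourier_def twisted_group_star_alg_def zero_eq)
  have add: "?f (aadd ?S x y) = aadd A (?f x) (?f y)" for x y
    by (auto simp: fourier_def twisted_group_star_alg_def add_eq distrib_right sum.distrib)
  have scale: "?f (ascale ?S c x) = ascale A c (?f x)" for c x
    by (auto simp: fourier_def twisted_group_star_alg_def scale_eq sum_distrib_left mult.assoc)
  have u: "unit_at m \<in> car ?S" if "m \<in> Z2_pow n" for m
    using function_algebra_unit[OF fS that] .
  have zeroS: "amult ?S (azero ?S) y = azero ?S" "amult ?S y (azero ?S) = azero ?S"
    "astar ?S (azero ?S) = azero ?S" for y
    by (simp_all add: twisted_group_star_alg_def)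
  note lin = add scale mult_add_left mult_scale_left mult_add_right mult_scale_right
    S.mult_add_left S.mult_scale_left S.mult_add_right S.mult_scale_right
    S.closed closed cl u zeroS zero zero_maps
  have uv: "?f (amult ?S (unit_at m) (unit_at k)) = amult A (?f (unit_at m)) (?f (unit_at k))"
    if "m \<in> Z2_pow n" "k \<in> Z2_pow n" for m k
    using that by (simp add: twisted_group_mult_unit scale fourier_unit mult_basis)
  \<comment> \<open>Multiplicativity on pairs of basis vectors is extended by linearity, first in
    the second argument and then in the first.\<close>
  have uy: "?f (amult ?S (unit_at m) y) = amult A (?f (unit_at m)) (?f y)"
    if "m \<in> Z2_pow n" "y \<in> car ?S" for m y
    using fS that(2) that(1) by (induction rule: function_algebra_induct) (simp_all add: lin uv)
  have mult: "?f (amult ?S x y) = amult A (?f x) (?f y)" if "x \<in> car ?S" "y \<in> car ?S" for x y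
    using fS that by (induction rule: function_algebra_induct) (simp_all add: lin uy)
  have su: "?f (astar ?S (unit_at m)) = astar A (?f (unit_at m))" if "m \<in> Z2_pow n" for m
    using that by (simp add: twisted_group_star_unit scale fourier_unit star_basis)
  have star: "?f (astar ?S x) = astar A (?f x)" if "x \<in> car ?S" for x
    using fS that
    by (induction rule: function_algebra_induct)
      (simp_all add: lin su star_add star_scale S.star_add S.star_scale)
  let ?g = "grade (twisted_group_alg n)"
  have g: "?g (aadd ?S x y) = aadd ?S (?g x) (?g y)" "?g (ascale ?S c x) = ascale ?S c (?g x)"
    "?g (azero ?S) = azero ?S" "?g (unit_at m) = ascale ?S (sign_bit (delta n m)) (unit_at m)" for x y c m
    by (auto simp: twisted_group_star_alg_def algebra_simps unit_at_def)
  have gu: "?f (?g (unit_at m)) = grade A (?f (unit_at m))" if "m \<in> Z2_pow n" for m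
    using that by (simp only: g scale fourier_unit grade_basis)
  have "?f (?g x) = grade A (?f x)" if "x \<in> car ?S" for x
    using fS that
    by (induction rule: function_algebra_induct)
      (simp_all add: g(1-3) lin gu grade_add grade_scale del: twisted_group_alg_simps)
  then show ?thesis
    using bij by (simp add: graded_iso_def star_iso_def star_hom_def cl add scale mult star)
qed

end

section \<open>Recursion for the cocycle and the first Clifford algebra\<close>

lemma kappa_1: "kappa (Suc 0) m k = 0"
proof -
  have "{(j, i). 1 \<le> j \<and> j < i \<and> i \<le> Suc 0} = {}" by auto
  then show ?thesis unfolding kappa_def by (simp only: sum.empty)
qed

text \<open>The pairs added at \<open>Suc n\<close> are \<open>(j, Suc n)\<close> with j at most n;
  their terms share the factor m (Suc n), and the remaining factors sum to
  \<open>delta n k\<close>.\<close>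

lemma kappa_Suc: "kappa (Suc n) m k = kappa n m k + m (Suc n) * delta n k"
proof -
  have "{(j, i). 1 \<le> j \<and> j < i \<and> i \<le> Suc n}
      = {(j, i). 1 \<le> j \<and> j < i \<and> i \<le> n} \<union> (\<lambda>j. (j, Suc n)) ` {1..n}"
    by (auto simp: image_iff)
  moreover have "finite {(j, i). 1 \<le> j \<and> j < i \<and> i \<le> n}"
    by (rule finite_subset[of _ "{1..n} \<times> {1..n}"]) auto
  moreover have "{(j, i). 1 \<le> j \<and> j < i \<and> i \<le> n} \<inter> (\<lambda>j. (j, Suc n)) ` {1..n} = {}"
    by auto
  ultimately show ?thesis
    by (simp add: kappa_def delta_def sum.union_disjoint sum.reindex inj_on_def sum_distrib_left)
qed

lemma kappa_upd [simp]: "kappa n (m(Suc n := b)) (k(Suc n := c)) = kappa n m k"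
  unfolding kappa_def by (intro sum.cong refl) auto

lemma delta_upd [simp]: "delta n (m(Suc n := b)) = delta n m"
  unfolding delta_def by (intro sum.cong refl) auto

lemma delta_Suc: "delta (Suc n) m = delta n m + m (Suc n)"
  by (simp add: delta_def)

lemma index_set_function_algebra: "function_algebra A I \<Longrightarrow> index_set A = I"
  by (auto simp: index_set_def function_algebra_def unit_at_def)

lemma length_Suc_0_iff: "length w = Suc 0 \<longleftrightarrow> w = [False] \<or> w = [True]" for w :: "bool list"
proof
  assume "length w = Suc 0"
  then obtain b where "w = [b]" by (auto simp: length_Suc_conv)
  then show "w = [False] \<or> w = [True]" by (cases b) auto
qed auto

text \<open>The generator (1, -1) is self-adjoint, squares to the unit and is negated by the swap of
  the two summands; the cocycle is trivial for a single coordinate.\<close>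

lemma clifford_structure_one: "clifford_structure (Suc 0) cliff_one"
proof
  show "function_algebra cliff_one {w. length w = Suc 0}"
    unfolding length_Suc_0_iff by (auto simp: function_algebra_def cliff_one_def)
  fix m k :: "nat \<Rightarrow> bit"
  have ch: "character m [b] = (if b then sign_bit (m 1) else 1)" for b and m :: "nat \<Rightarrow> bit"
    by (simp add: character_def)
  show "amult cliff_one (clifford_basis (Suc 0) m) (clifford_basis (Suc 0) k)
    = ascale cliff_one (cocycle (Suc 0) m k) (clifford_basis (Suc 0) (Z2_add m k))"
    by (auto simp: cliff_one_def clifford_basis_def cocycle_def kappa_1 character_add sign_bit_def)
  show "astar cliff_one (clifford_basis (Suc 0) m)
    = ascale cliff_one (cocycle (Suc 0) m m) (clifford_basis (Suc 0) m)"
  proof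
    fix w show "astar cliff_one (clifford_basis (Suc 0) m) w
      = ascale cliff_one (cocycle (Suc 0) m m) (clifford_basis (Suc 0) m) w"
      by (cases "length w = Suc 0")
        (auto simp: cliff_one_def clifford_basis_def cocycle_def kappa_1 ch length_Suc_0_iff sign_bit_def)
  qed
  show "grade cliff_one (clifford_basis (Suc 0) m)
    = ascale cliff_one (sign_bit (delta (Suc 0) m)) (clifford_basis (Suc 0) m)"
  proof
    fix w show "grade cliff_one (clifford_basis (Suc 0) m) w
      = ascale cliff_one (sign_bit (delta (Suc 0) m)) (clifford_basis (Suc 0) m) w"
      by (cases "length w = Suc 0")
        (auto simp: cliff_one_def clifford_basis_def delta_def ch length_Suc_0_iff sign_bit_sq)
  qed
  show "grade cliff_one x \<in> car cliff_one" if "x \<in> car cliff_one" for x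
  proof -
    have "length u = Suc 0" if "x (map Not u) \<noteq> 0" for u
      using that \<open>x \<in> car cliff_one\<close> length_Suc_0_iff[of "map Not u"] by (auto simp: cliff_one_def)
    then show ?thesis by (auto simp: cliff_one_def length_Suc_0_iff)
  qed
qed (auto simp: cliff_one_def algebra_simps)

text \<open>\<open>cliff_one\<close> carries the explicit maximum norm, so its C*-conditions are
  checked directly; the algebraic axioms are transported along the Fourier transform.\<close>

lemma cstar_algebra_cliff_one: "cstar_algebra cliff_one"
proof -
  interpret clifford_structure "Suc 0" cliff_one by (rule clifford_structure_one)
  interpret T: graded_cstar_algebra "twisted_group_alg (Suc 0)"
    by (rule graded_cstar_algebra_twisted_group)
  have "star_algebra cliff_one"
    using T.star_algebra_axioms
  proof (rule star_algebra_transport)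
    show "star_iso (fourier (Suc 0)) (twisted_group_alg (Suc 0)) cliff_one"
      using graded_iso_fourier by (simp add: graded_iso_def)
    show "fourier (Suc 0) (azero (twisted_group_alg (Suc 0))) = azero cliff_one"
      by (auto simp: fourier_def twisted_group_star_alg_def cliff_one_def)
  qed
  then show ?thesis
    using function_algebra
  proof (rule cstar_algebra_function_algebra)
    have max_sq: "max (a * a) (b * b) = (max a b)\<^sup>2" if "0 \<le> a" "0 \<le> b" for a b :: real
    proof -
      have "a * a \<le> b * b \<longleftrightarrow> a \<le> b"
        using that by (metis abs_le_square_iff abs_of_nonneg power2_eq_square)
      then show ?thesis by (simp add: max_def power2_eq_square)
    qed
    have max_mult: "max (a * c) (b * d) \<le> max a b * max c d"
      if "0 \<le> a" "0 \<le> b" "0 \<le> c" "0 \<le> d" for a b c d :: real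
      using that by (auto intro!: mult_mono simp: le_max_iff_disj)
    show "cstar_seminorm cliff_one (anorm cliff_one)"
      unfolding cstar_seminorm_def
    proof (intro conjI ballI allI)
      fix x y :: "bool list \<Rightarrow> complex"
      show "anorm cliff_one (aadd cliff_one x y) \<le> anorm cliff_one x + anorm cliff_one y"
        using norm_triangle_ineq[of "x [False]" "y [False]"] norm_triangle_ineq[of "x [True]" "y [True]"]
        by (auto simp: cliff_one_def)
      show "anorm cliff_one (amult cliff_one x y) \<le> anorm cliff_one x * anorm cliff_one y"
        using max_mult by (simp add: cliff_one_def norm_mult)
      show "anorm cliff_one (amult cliff_one (astar cliff_one x) x) = (anorm cliff_one x)\<^sup>2"
        by (simp add: cliff_one_def norm_mult max_sq)
      show "anorm cliff_one (ascale cliff_one c x) = cmod c * anorm cliff_one x" for c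
        by (simp add: cliff_one_def norm_mult max_mult_distrib_left)
    qed (simp_all add: cliff_one_def le_max_iff_disj)
    show "cmod (x w) \<le> anorm cliff_one x" if "x \<in> car cliff_one" for x w
    proof (cases "w \<in> {[False], [True]}")
      case False
      then have "x w = 0" using that by (auto simp: cliff_one_def)
      then show ?thesis by (simp add: cliff_one_def le_max_iff_disj)
    qed (auto simp: cliff_one_def)
  qed
qed

lemma gtensor_simps [simp]:
  "car (gtensor A B) = car (gtensor_star_alg A B)"
  "azero (gtensor A B) = azero (gtensor_star_alg A B)"
  "aadd (gtensor A B) = aadd (gtensor_star_alg A B)"
  "ascale (gtensor A B) = ascale (gtensor_star_alg A B)"
  "amult (gtensor A B) = amult (gtensor_star_alg A B)"
  "astar (gtensor A B) = astar (gtensor_star_alg A B)"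
  "anorm (gtensor A B) = max_cstar_seminorm (gtensor_star_alg A B) {}"
  "grade (gtensor A B) = gtensor_grade A B"
  by (simp_all add: gtensor_def cstar_alg.defs star_alg.defs graded_cstar_alg.defs)

context clifford_structure
begin

lemma index_set_eq: "index_set A = {w. length w = n}"
  using function_algebra by (rule index_set_function_algebra)

lemma degree_part_eq: "degree_part A q x = (\<lambda>w. (x w + (- 1) ^ q * grade A x w) / 2)"
  by (simp add: degree_part_def add_eq scale_eq)

lemma degree_part_closed: "x \<in> car A \<Longrightarrow> degree_part A q x \<in> car A"
  unfolding degree_part_def by (intro closed)

lemma degree_part_add:
  "\<lbrakk>x \<in> car A; y \<in> car A\<rbrakk>
    \<Longrightarrow> degree_part A q (aadd A x y) = aadd A (degree_part A q x) (degree_part A q y)"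
  by (simp add: degree_part_eq grade_add) (simp add: add_eq algebra_simps add_divide_distrib)

lemma degree_part_scale:
  "x \<in> car A \<Longrightarrow> degree_part A q (ascale A c x) = ascale A c (degree_part A q x)"
  by (simp add: degree_part_eq grade_scale) (simp add: scale_eq algebra_simps)

text \<open>On a homogeneous element one degree projection is the identity and the other is zero. Of
  the four summands of a graded product of homogeneous tensors only the one with the right degrees
  remains.\<close>

lemma degree_part_homogeneous:
  assumes "grade A x = ascale A (sign_bit b) x"
  shows "degree_part A 0 x = (if b = 0 then x else azero A)"
    and "degree_part A (Suc 0) x = (if b = 0 then azero A else x)"
  using assms by (auto simp: degree_part_eq sign_bit_def scale_eq zero_eq)

lemma expand:
  assumes "x \<in> car A"
    and "\<And>x y. \<lbrakk>x \<in> car A; y \<in> car A\<rbrakk> \<Longrightarrow> F (aadd A x y) = F x + F y"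
    and "\<And>c x. x \<in> car A \<Longrightarrow> F (ascale A c x) = c * F x"
  shows "(\<Sum>u | length u = n. x u * F (unit_at u)) = (F x :: complex)"
  using function_algebra assms by (rule linear_functional_expand)

end

lemma append_eq_take_drop:
  "length u = n \<Longrightarrow> w = u @ v \<longleftrightarrow> u = take n w \<and> v = drop n w"
  by (metis append_eq_conv_conj append_take_drop_id)

section \<open>Graded tensor products on pure tensors\<close>

locale clifford_tensor = A: clifford_structure n A + B: clifford_structure k B
  for n A k B
begin

abbreviation G where "G \<equiv> gtensor A B"

text \<open>A string of length n + k has exactly one cut into pieces of lengths n and k, so the
  double sum has a single term.\<close>

lemma tensor_eq:
  "tensor A B a b = (\<lambda>w. if length w = n + k then a (take n w) * b (drop n w) else 0)"
proof
  fix w :: "bool list"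
  have t: "tensor A B a b w
    = (\<Sum>u | length u = n. \<Sum>v | length v = k. if w = u @ v then a u * b v else 0)"
    by (simp add: tensor_def A.index_set_eq B.index_set_eq)
  show "tensor A B a b w = (if length w = n + k then a (take n w) * b (drop n w) else 0)"
  proof (cases "length w = n + k")
    case True
    have "tensor A B a b w = (\<Sum>u | length u = n. if u = take n w then
        (\<Sum>v | length v = k. if v = drop n w then a u * b v else 0) else 0)"
      unfolding t
    proof (intro sum.cong refl)
      fix u :: "bool list" assume "u \<in> {u. length u = n}"
      then have u: "w = u @ v \<longleftrightarrow> u = take n w \<and> v = drop n w" for v
        by (simp only: append_eq_take_drop mem_Collect_eq)
      show "(\<Sum>v | length v = k. if w = u @ v then a u * b v else 0)
        = (if u = take n w then (\<Sum>v | length v = k. if v = drop n w then a u * b v else 0) else 0)"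
        unfolding u by (cases "u = take n w") simp_all
    qed
    then show ?thesis using True by simp
  next
    case False
    then show ?thesis unfolding t by (auto intro!: sum.neutral)
  qed
qed

lemma tensor_append: "length u = n \<Longrightarrow> length v = k \<Longrightarrow> tensor A B a b (u @ v) = a u * b v"
  by (simp add: tensor_eq)

lemma tensor_scale: "tensor A B (ascale A c a) (ascale B d b) = (\<lambda>w. c * d * tensor A B a b w)"
  by (auto simp: tensor_eq A.scale_eq B.scale_eq fun_eq_iff)

lemma tensor_zero: "tensor A B (azero A) b = (\<lambda>_. 0)" "tensor A B a (azero B) = (\<lambda>_. 0)"
  by (auto simp: tensor_eq A.zero_eq B.zero_eq fun_eq_iff)

lemma gtensor_car: "car (gtensor_star_alg A B) = {x. \<forall>w. x w \<noteq> 0 \<longrightarrow> length w = n + k}"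
proof -
  have "(\<exists>u\<in>index_set A. \<exists>v\<in>index_set B. w = u @ v) \<longleftrightarrow> length w = n + k" for w
  proof
    assume "length w = n + k"
    then show "\<exists>u\<in>index_set A. \<exists>v\<in>index_set B. w = u @ v"
      by (intro bexI[of _ "take n w"] bexI[of _ "drop n w"]) (auto simp: A.index_set_eq B.index_set_eq)
  qed (auto simp: A.index_set_eq B.index_set_eq)
  then show ?thesis by (simp add: gtensor_star_alg_def Let_def)
qed

lemma gtensor_ops:
  "azero (gtensor_star_alg A B) = (\<lambda>_. 0)"
  "aadd (gtensor_star_alg A B) = (\<lambda>x y w. x w + y w)"
  "ascale (gtensor_star_alg A B) = (\<lambda>c x w. c * x w)"
  "amult (gtensor_star_alg A B) = (\<lambda>x y w.
     \<Sum>u | length u = n. \<Sum>v | length v = k. \<Sum>u' | length u' = n. \<Sum>v' | length v' = k.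
       x (u @ v) * y (u' @ v') *
         gtensor_mult_pure A B (unit_at u) (unit_at v) (unit_at u') (unit_at v') w)"
  "astar (gtensor_star_alg A B) = (\<lambda>x w.
     \<Sum>u | length u = n. \<Sum>v | length v = k. cnj (x (u @ v)) *
       gtensor_star_pure A B (unit_at u) (unit_at v) w)"
  "gtensor_grade A B = (\<lambda>x w.
     \<Sum>u | length u = n. \<Sum>v | length v = k. x (u @ v) *
       tensor A B (grade A (unit_at u)) (grade B (unit_at v)) w)"
  by (simp_all add: gtensor_star_alg_def Let_def A.index_set_eq B.index_set_eq)
    (simp add: gtensor_grade_def A.index_set_eq B.index_set_eq fun_eq_iff)

text \<open>The product is defined by its values on unit vectors. As
  \<open>gtensor_mult_pure\<close> is linear in each of its four arguments, \<open>expand\<close>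
  collapses the fourfold sum one index at a time, innermost first.\<close>

lemma gtensor_mult_tensor:
  assumes ab: "a \<in> car A" "b \<in> car B" "c \<in> car A" "d \<in> car B"
  shows "amult G (tensor A B a b) (tensor A B c d) = gtensor_mult_pure A B a b c d"
proof
  fix w
  let ?P = "\<lambda>a b c d. gtensor_mult_pure A B a b c d w"
  note defs = gtensor_mult_pure_def tensor_eq A.degree_part_closed B.degree_part_closed
    A.degree_part_add A.degree_part_scale B.degree_part_add B.degree_part_scale
    A.mult_add_left A.mult_add_right A.mult_scale_left A.mult_scale_right
    B.mult_add_left B.mult_add_right B.mult_scale_left B.mult_scale_right A.closed B.closed
  note eqs = A.add_eq A.scale_eq B.add_eq B.scale_eq
  have 1: "(\<Sum>u | length u = n. a u * ?P (unit_at u) b c d) = ?P a b c d"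
    if "a \<in> car A" "b \<in> car B" "c \<in> car A" "d \<in> car B" for a b c d
    using that by (intro A.expand) (simp_all add: defs, simp_all add: eqs algebra_simps)
  have 2: "(\<Sum>v | length v = k. b v * ?P a (unit_at v) c d) = ?P a b c d"
    if "a \<in> car A" "b \<in> car B" "c \<in> car A" "d \<in> car B" for a b c d
    using that by (intro B.expand) (simp_all add: defs, simp_all add: eqs algebra_simps)
  have 3: "(\<Sum>u | length u = n. c u * ?P a b (unit_at u) d) = ?P a b c d"
    if "a \<in> car A" "b \<in> car B" "c \<in> car A" "d \<in> car B" for a b c d
    using that by (intro A.expand) (simp_all add: defs, simp_all add: eqs algebra_simps)
  have 4: "(\<Sum>v | length v = k. d v * ?P a b c (unit_at v)) = ?P a b c d"
    if "a \<in> car A" "b \<in> car B" "c \<in> car A" "d \<in> car B" for a b c d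
    using that by (intro B.expand) (simp_all add: defs, simp_all add: eqs algebra_simps)
  have "amult G (tensor A B a b) (tensor A B c d) w
    = (\<Sum>u | length u = n. \<Sum>v | length v = k. \<Sum>u' | length u' = n. \<Sum>v' | length v' = k.
        a u * (b v * (c u' * (d v' * ?P (unit_at u) (unit_at v) (unit_at u') (unit_at v')))))"
    unfolding gtensor_simps gtensor_ops by (intro sum.cong refl) (simp add: tensor_append mult_ac)
  also have "\<dots> = (\<Sum>u | length u = n. a u * (\<Sum>v | length v = k. b v * (\<Sum>u' | length u' = n. c u' *
      (\<Sum>v' | length v' = k. d v' * ?P (unit_at u) (unit_at v) (unit_at u') (unit_at v')))))"
    by (simp only: sum_distrib_left)
  also have "\<dots> = ?P a b c d"
    using ab by (simp add: 1 2 3 4 A.unit_closed_iff B.unit_closed_iff)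
  finally show "amult G (tensor A B a b) (tensor A B c d) w = ?P a b c d" .
qed

lemma gtensor_star_tensor:
  assumes ab: "a \<in> car A" "b \<in> car B"
  shows "astar G (tensor A B a b) = gtensor_star_pure A B a b"
proof
  fix w
  \<comment> \<open>The adjoint is conjugate-linear; conjugating its coordinate gives a linear
    functional, as \<open>expand\<close> requires.\<close>
  let ?P = "\<lambda>a b. cnj (gtensor_star_pure A B a b w)"
  note defs = gtensor_star_pure_def tensor_eq A.degree_part_closed B.degree_part_closed
    A.degree_part_add A.degree_part_scale B.degree_part_add B.degree_part_scale
    A.star_add A.star_scale B.star_add B.star_scale A.closed B.closed
  note eqs = A.add_eq A.scale_eq B.add_eq B.scale_eq
  have 1: "(\<Sum>u | length u = n. a u * ?P (unit_at u) b) = ?P a b"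
    if "a \<in> car A" "b \<in> car B" for a b
    using that by (intro A.expand) (simp_all add: defs, simp_all add: eqs algebra_simps)
  have 2: "(\<Sum>v | length v = k. b v * ?P a (unit_at v)) = ?P a b"
    if "a \<in> car A" "b \<in> car B" for a b
    using that by (intro B.expand) (simp_all add: defs, simp_all add: eqs algebra_simps)
  have "cnj (astar G (tensor A B a b) w)
    = (\<Sum>u | length u = n. \<Sum>v | length v = k. a u * (b v * ?P (unit_at u) (unit_at v)))"
    unfolding gtensor_simps gtensor_ops cnj_sum
    by (intro sum.cong refl) (simp add: tensor_append mult_ac)
  also have "\<dots> = (\<Sum>u | length u = n. a u * (\<Sum>v | length v = k. b v * ?P (unit_at u) (unit_at v)))"
    by (simp only: sum_distrib_left)
  also have "\<dots> = ?P a b"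
    using ab by (simp add: 1 2 A.unit_closed_iff B.unit_closed_iff)
  finally show "astar G (tensor A B a b) w = gtensor_star_pure A B a b w" by simp
qed

lemma gtensor_grade_tensor:
  assumes ab: "a \<in> car A" "b \<in> car B"
  shows "grade G (tensor A B a b) = tensor A B (grade A a) (grade B b)"
proof
  fix w
  let ?P = "\<lambda>a b. tensor A B (grade A a) (grade B b) w"
  note defs = tensor_eq A.grade_add A.grade_scale B.grade_add B.grade_scale
  note eqs = A.add_eq A.scale_eq B.add_eq B.scale_eq
  have 1: "(\<Sum>u | length u = n. a u * ?P (unit_at u) b) = ?P a b"
    if "a \<in> car A" "b \<in> car B" for a b
    using that by (intro A.expand) (simp_all add: defs, simp_all add: eqs algebra_simps)
  have 2: "(\<Sum>v | length v = k. b v * ?P a (unit_at v)) = ?P a b"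
    if "a \<in> car A" "b \<in> car B" for a b
    using that by (intro B.expand) (simp_all add: defs, simp_all add: eqs algebra_simps)
  have "grade G (tensor A B a b) w
    = (\<Sum>u | length u = n. \<Sum>v | length v = k. a u * (b v * ?P (unit_at u) (unit_at v)))"
    unfolding gtensor_simps gtensor_ops
    by (intro sum.cong refl) (simp add: tensor_append mult_ac)
  also have "\<dots> = (\<Sum>u | length u = n. a u * (\<Sum>v | length v = k. b v * ?P (unit_at u) (unit_at v)))"
    by (simp only: sum_distrib_left)
  also have "\<dots> = ?P a b"
    using ab by (simp add: 1 2 A.unit_closed_iff B.unit_closed_iff)
  finally show "grade G (tensor A B a b) w = ?P a b" .
qed

lemma gtensor_mult_homogeneous:
  assumes "a \<in> car A" "b \<in> car B" "c \<in> car A" "d \<in> car B"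
    and "grade B b = ascale B (sign_bit s) b" "grade A c = ascale A (sign_bit r) c"
  shows "amult G (tensor A B a b) (tensor A B c d)
    = (\<lambda>w. sign_bit (s * r) * tensor A B (amult A a c) (amult B b d) w)"
  unfolding gtensor_mult_tensor[OF assms(1-4)] gtensor_mult_pure_def
  using assms(1-4)
  by (cases s; cases r)
    (simp_all add: A.degree_part_homogeneous[OF assms(6)] B.degree_part_homogeneous[OF assms(5)]
      A.zero_maps B.zero_maps tensor_zero sign_bit_def)

lemma gtensor_star_homogeneous:
  assumes "a \<in> car A" "b \<in> car B"
    and "grade A a = ascale A (sign_bit r) a" "grade B b = ascale B (sign_bit s) b"
  shows "astar G (tensor A B a b) = (\<lambda>w. sign_bit (r * s) * tensor A B (astar A a) (astar B b) w)"
  unfolding gtensor_star_tensor[OF assms(1-2)] gtensor_star_pure_def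
  using assms(1-2)
  by (cases s; cases r)
    (simp_all add: A.degree_part_homogeneous[OF assms(3)] B.degree_part_homogeneous[OF assms(4)]
      A.zero_maps B.zero_maps tensor_zero sign_bit_def)

lemma gtensor_closed:
  "amult G x y \<in> car G" "astar G x \<in> car G" "grade G x \<in> car G"
  by (auto simp: gtensor_car gtensor_ops gtensor_mult_pure_def gtensor_star_pure_def tensor_eq
      elim!: sum.not_neutral_contains_not_neutral split: if_splits)

lemma function_algebra_gtensor: "function_algebra G {w. length w = n + k}"
  by (auto simp: function_algebra_def gtensor_car gtensor_ops)

lemma gtensor_linear:
  "amult G (aadd G x y) z = aadd G (amult G x z) (amult G y z)"
  "amult G z (aadd G x y) = aadd G (amult G z x) (amult G z y)"
  "amult G (ascale G c x) y = ascale G c (amult G x y)"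
  "amult G x (ascale G c y) = ascale G c (amult G x y)"
  "astar G (aadd G x y) = aadd G (astar G x) (astar G y)"
  "astar G (ascale G c x) = ascale G (cnj c) (astar G x)"
  "grade G (aadd G x y) = aadd G (grade G x) (grade G y)"
  "grade G (ascale G c x) = ascale G c (grade G x)"
  by (simp_all add: gtensor_ops distrib_left distrib_right sum.distrib sum_distrib_left mult_ac)

end

text \<open>The last coordinate of \<open>m\<close> belongs to the tensor factor \<open>cliff_one\<close>; moving it past the
  first \<open>n\<close> coordinates produces exactly the new terms of \<open>kappa (Suc n)\<close>.\<close>

lemma clifford_structure_Suc:
  assumes "clifford_structure n A"
  shows "clifford_structure (Suc n) (gtensor A cliff_one)"
proof -
  interpret A: clifford_structure n A by (rule assms)
  interpret B: clifford_structure "Suc 0" cliff_one by (rule clifford_structure_one)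
  interpret clifford_tensor n A "Suc 0" cliff_one ..
  \<comment> \<open>\<open>lo\<close> keeps the coordinates of the old factor; \<open>hi\<close>
    moves the last one to position 1, where the single coordinate of \<open>cliff_one\<close>
    sits.\<close>
  define lo where "lo m = m(Suc n := 0)" for m :: "nat \<Rightarrow> bit"
  define hi where "hi m = Z2_zero(Suc 0 := m (Suc n))" for m :: "nat \<Rightarrow> bit"
  let ?E = "\<lambda>m. clifford_basis n (lo m)" and ?H = "\<lambda>m. clifford_basis (Suc 0) (hi m)"
  have lo: "lo m \<in> Z2_pow n" if "m \<in> Z2_pow (Suc n)" for m
    using that by (simp add: lo_def)
  have hi: "hi m \<in> Z2_pow (Suc 0)" for m
    by (simp add: hi_def Z2_pow_def Z2_zero_def)
  have lo_add: "lo (Z2_add m k) = Z2_add (lo m) (lo k)" and hi_add: "hi (Z2_add m k) = Z2_add (hi m) (hi k)" for m k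
    by (auto simp: lo_def hi_def Z2_add_def Z2_zero_def)
  have basis: "clifford_basis (Suc n) m = tensor A cliff_one (?E m) (?H m)" for m
  proof
    fix w
    show "clifford_basis (Suc n) m w = tensor A cliff_one (?E m) (?H m) w"
    proof (cases "length w = Suc n")
      case True
      then obtain u b where "w = u @ [b]" "length u = n" by (auto simp: length_Suc_conv_rev)
      then show ?thesis
        by (simp add: clifford_basis_def tensor_eq lo_def hi_def character_snoc character_def[of _ "[b]"])
    next
      case False
      then show ?thesis by (simp add: clifford_basis_def tensor_eq)
    qed
  qed
  have gH: "grade cliff_one (?H m) = ascale cliff_one (sign_bit (m (Suc n))) (?H m)" for m
    using B.grade_basis[OF hi[of m]] by (simp add: delta_def hi_def)
  have gE: "grade A (?E m) = ascale A (sign_bit (delta n m)) (?E m)" if "m \<in> Z2_pow (Suc n)" for m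
    using A.grade_basis[OF lo[OF that]] by (simp add: lo_def)
  have c1: "cocycle (Suc 0) m k = 1" for m k
    by (simp add: cocycle_def kappa_1 sign_bit_def)
  have cS: "cocycle (Suc n) m k = sign_bit (m (Suc n) * delta n k) * cocycle n (lo m) (lo k)" for m k
    by (simp add: cocycle_def kappa_Suc sign_bit_add lo_def mult.commute)
  show ?thesis
  proof
    show "function_algebra G {w. length w = Suc n}"
      using function_algebra_gtensor by simp
  next
    fix m k assume mk: "m \<in> Z2_pow (Suc n)" "k \<in> Z2_pow (Suc n)"
    have "amult G (clifford_basis (Suc n) m) (clifford_basis (Suc n) k)
      = (\<lambda>w. sign_bit (m (Suc n) * delta n k)
          * tensor A cliff_one (amult A (?E m) (?E k)) (amult cliff_one (?H m) (?H k)) w)"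
      unfolding basis
      by (rule gtensor_mult_homogeneous[OF A.basis_closed B.basis_closed A.basis_closed B.basis_closed
            gH gE[OF mk(2)]])
    also have "\<dots> = ascale G (cocycle (Suc n) m k) (clifford_basis (Suc n) (Z2_add m k))"
      by (simp add: A.mult_basis[OF lo[OF mk(1)] lo[OF mk(2)]] B.mult_basis[OF hi hi] tensor_scale
          basis lo_add hi_add c1 cS gtensor_ops mult.assoc)
    finally show "amult G (clifford_basis (Suc n) m) (clifford_basis (Suc n) k)
      = ascale G (cocycle (Suc n) m k) (clifford_basis (Suc n) (Z2_add m k))" .
  next
    fix m assume m: "m \<in> Z2_pow (Suc n)"
    have "astar G (clifford_basis (Suc n) m) = (\<lambda>w. sign_bit (delta n m * m (Suc n))
        * tensor A cliff_one (astar A (?E m)) (astar cliff_one (?H m)) w)"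
      unfolding basis
      by (rule gtensor_star_homogeneous[OF A.basis_closed B.basis_closed gE[OF m] gH])
    also have "\<dots> = ascale G (cocycle (Suc n) m m) (clifford_basis (Suc n) m)"
      by (simp add: A.star_basis[OF lo[OF m]] B.star_basis[OF hi] tensor_scale
          basis c1 cS gtensor_ops mult.assoc mult.commute[of "delta n m"])
    finally show "astar G (clifford_basis (Suc n) m)
      = ascale G (cocycle (Suc n) m m) (clifford_basis (Suc n) m)" .
    show "grade G (clifford_basis (Suc n) m)
      = ascale G (sign_bit (delta (Suc n) m)) (clifford_basis (Suc n) m)"
      unfolding basis gtensor_grade_tensor[OF A.basis_closed B.basis_closed]
      by (simp add: gE[OF m] gH tensor_scale delta_Suc sign_bit_add gtensor_ops)
  qed (rule gtensor_closed gtensor_linear)+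
qed

lemma clifford_structure_cliff: "clifford_structure (Suc n) (cliff (Suc n))"
  by (induction n) (simp_all add: clifford_structure_one clifford_structure_Suc)

text \<open>For n = 0 the norm is the explicit one. Otherwise it is the largest seminorm of the
  tensor product, and the Fourier transform, being a bijective *-homomorphism, matches it with the
  norm of the twisted group algebra.\<close>

lemma graded_cstar_algebra_cliff: "graded_cstar_algebra (cliff (Suc n))"
proof -
  interpret clifford_structure "Suc n" "cliff (Suc n)" by (rule clifford_structure_cliff)
  let ?S = "twisted_group_star_alg (Suc n)" and ?T = "twisted_group_alg (Suc n)"
  interpret T: graded_cstar_algebra ?T by (rule graded_cstar_algebra_twisted_group)
  have iso: "star_iso (fourier (Suc n)) ?T (cliff (Suc n))"
    using graded_iso_fourier by (simp add: graded_iso_def)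
  have "cstar_algebra (cliff (Suc n))"
  proof (cases n)
    case 0
    then show ?thesis by (simp add: cstar_algebra_cliff_one)
  next
    case (Suc k)
    let ?G = "gtensor_star_alg (cliff (Suc k)) cliff_one"
    have cliff: "cliff (Suc n) = gtensor (cliff (Suc k)) cliff_one" using Suc by simp
    have hom: "star_hom (fourier (Suc n)) ?S ?G" and inj: "inj_on (fourier (Suc n)) (car ?S)"
      and im: "fourier (Suc n) ` car ?S = car ?G"
      using iso by (auto simp: star_iso_def star_hom_def bij_betw_def cliff)
    show ?thesis
      using T.cstar_algebra_axioms iso
    proof (rule cstar_algebra_transport)
      show "fourier (Suc n) (azero ?T) = azero (cliff (Suc n))"
        by (auto simp: zero_eq fourier_def twisted_group_star_alg_def)
      fix x assume x: "x \<in> car ?T"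
      have "max_cstar_seminorm ?S {} x = max_cstar_seminorm ?G {} (fourier (Suc n) x)"
        using x inj
        by (intro max_cstar_seminorm_transfer[OF star_algebra_twisted_group hom im]) (auto dest: inj_onD)
      then show "anorm (cliff (Suc n)) (fourier (Suc n) x) = anorm ?T x"
        by (simp add: cliff)
    qed
  qed
  with graded_cstar_algebra_twisted_group show ?thesis
    using graded_iso_fourier by (rule graded_cstar_algebra_transport)
qed

theorem corollary7p4:
  fixes l :: nat
  assumes "1 \<le> l"
  shows "graded_cstar_algebra (twisted_cstar l) \<and>
    (\<forall>m\<in>Z2_pow l. grade (twisted_cstar l) (twisted_gen l m) =
       ascale (twisted_cstar l) (sign_bit (delta l m)) (twisted_gen l m)) \<and>
    graded_cstar_algebra (cliff l) \<and>
    (\<exists>\<phi>. graded_iso \<phi> (twisted_cstar l) (cliff l))"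
proof -
  obtain n where l: "l = Suc n" using assms by (cases l) auto
  interpret T: graded_cstar_algebra "twisted_group_alg l" by (rule graded_cstar_algebra_twisted_group)
  have "graded_iso (fourier l) (twisted_group_alg l) (cliff l)"
    unfolding l by (intro clifford_structure.graded_iso_fourier clifford_structure_cliff)
  moreover have "graded_iso (inv_into (car (twisted_group_alg l)) (twisted_iso l))
      (twisted_cstar l) (twisted_group_alg l)"
    using T.star_algebra_axioms graded_iso_twisted T.grade_automorphism
    by (intro graded_iso_inv) (simp_all only: star_iso_def star_hom_def)
  ultimately have "\<exists>\<phi>. graded_iso \<phi> (twisted_cstar l) (cliff l)"
    using graded_iso_trans by blast
  then show ?thesis
    using graded_cstar_algebra_twisted grade_twisted_gen graded_cstar_algebra_cliff[of n] l by blast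
qed

end
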